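(* Let $a$ satisfy assumption (a) of the context. The double layer potential $$(D\varphi)(x,t)=\int_0^t\int_{\partial\Omega}\frac{\partial\varepsilon_{n,a}(x-\xi,b(t,\tau))}{\partial\nu(\xi)}\,\varphi(\xi,\tau)\,a(\tau)\,dS_\xi\,d\tau$$ with density $\varphi\in C(\partial\Omega\times[0,T])$ can be continuously extended from $\Omega\times(0,T]$ to $\overline{\Omega}\times(0,T]$ with the limiting values $$\lim_{x\to x_0}(D\varphi)(x,t)=-\frac12\varphi(x_0,t)+\int_0^t\int_{\partial\Omega}\frac{\partial\varepsilon_{n,a}(x_0-\xi,b(t,\tau))}{\partial\nu(\xi)}\,\varphi(\xi,\tau)\,a(\tau)\,dS_\xi\,d\tau$$ for $x_0\in\partial\Omega$ and $0<t\le T$ (limit over $x\in\Omega$), where the time integral exists as an improper integral and $\nu(\xi)$ is the outward unit normal.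
   Context: Setting: $0<T<\infty$, $n\ge 2$, $\Omega\subset\mathbb{R}^n$ is a bounded domain with boundary $\partial\Omega\in C^{1+\lambda}$, $0<\lambda<1$. The coefficient $a\in L_1[0,T]$ is defined on $[0,T]$. Assumption (a): $a(t)$ is nonnegative and becomes zero only at isolated points. Notation: $a_1(t)=\int_0^t a(z)\,dz$, $b(t,\tau)=\int_\tau^t a(z)\,dz=a_1(t)-a_1(\tau)$, $\varepsilon_n(x,t)=\theta(t)(4\pi t)^{-n/2}e^{-|x|^2/(4t)}$ is the fundamental solution of the standard heat operator ($\theta$ is the Heaviside function), and $\varepsilon_{n,a}(x-\xi,b(t,\tau)):=\varepsilon_n(x-\xi,a_1(t)-a_1(\tau))$. $\partial/\partial\nu(\xi)$ is the normal derivative with respect to $\xi$, and $dS_\xi$ is the surface element on $\partial\Omega$. For $x_0\in\partial\Omega$ the time integral is improper and defined as $\lim_{h\to0}\int_0^{t-h}\int_{\partial\Omega}$. *)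

theory Defs
  imports "HOL-Analysis.Analysis"
begin

section \<open>Domains with boundary of class \<open>C\<^sup>1\<close> and \<open>C\<^sup>1\<^sup>+\<^sup>\<alpha>\<close>\<close>

text \<open>
  Inside the open set \<open>U\<close>, the set \<open>\<Omega>\<close> is the region below a \<open>C\<^sup>1\<close> graph over the hyperplane
  \<open>{y. y \<bullet> e = 0}\<close>, where \<open>e\<close> is a unit vector pointing out of \<open>\<Omega>\<close>. A function on the hyperplane is
  represented by its extension \<open>g\<close> to the whole space that is constant in direction \<open>e\<close>; so the
  gradient \<open>G\<close> of \<open>g\<close> is the gradient within the hyperplane, and is orthogonal to \<open>e\<close>. Continuity
  of \<open>g\<close> gives \<open>frontier \<Omega> \<inter> U = {x \<in> U. x \<bullet> e = g x}\<close>.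
\<close>

definition boundary_chart ::
  "(real^'n) set \<Rightarrow> real^'n \<Rightarrow> (real^'n \<Rightarrow> real) \<Rightarrow> (real^'n \<Rightarrow> real^'n) \<Rightarrow> (real^'n) set \<Rightarrow> bool"
where
  "boundary_chart \<Omega> e g G U \<longleftrightarrow>
     norm e = 1 \<and> open U \<and>
     (\<forall>x s. g (x + s *\<^sub>R e) = g x) \<and>
     (\<forall>x. GDERIV g x :> G x) \<and> continuous_on UNIV G \<and>
     \<Omega> \<inter> U = {x \<in> U. x \<bullet> e < g x}"

text \<open>
  A graph function that is \<open>C\<^sup>1\<^sup>+\<^sup>\<alpha>\<close> near a point can be cut off away from that point, so asking for
  a globally defined \<open>g\<close> with a global Hoelder bound is no restriction.
\<close>

definition C1_Hoelder_boundary :: "real \<Rightarrow> (real^'n) set \<Rightarrow> bool" where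
  "C1_Hoelder_boundary \<alpha> \<Omega> \<longleftrightarrow>
     (\<forall>p \<in> frontier \<Omega>. \<exists>e g G U. boundary_chart \<Omega> e g G U \<and> p \<in> U \<and>
        (\<exists>C. \<forall>x y. norm (G x - G y) \<le> C * dist x y powr \<alpha>))"

definition outward_normal :: "(real^'n) set \<Rightarrow> real^'n \<Rightarrow> real^'n" where
  "outward_normal \<Omega> \<xi> =
     (THE \<nu>. \<exists>e g G U. boundary_chart \<Omega> e g G U \<and> \<xi> \<in> U \<and>
        \<nu> = (e - G \<xi>) /\<^sub>R norm (e - G \<xi>))"

section \<open>Surface measure\<close>

text \<open>
  Lebesgue measure of dimension \<open>n - 1\<close> on the hyperplane orthogonal to the unit vector \<open>e\<close>, as the
  image under orthogonal projection of Lebesgue measure on the slab of thickness \<open>1\<close> over it.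
\<close>

definition hyperplane_measure :: "real^'n \<Rightarrow> (real^'n) measure" where
  "hyperplane_measure e =
     distr (density lborel (indicator {x. 0 \<le> x \<bullet> e \<and> x \<bullet> e \<le> 1})) borel
       (\<lambda>x. x - (x \<bullet> e) *\<^sub>R e)"

text \<open>
  The area measure \<open>sqrt (1 + \<bar>\<nabla>g\<bar>\<^sup>2) dy\<close> of the part in \<open>U\<close> of the graph of \<open>g\<close>.
\<close>

definition graph_area_measure ::
  "real^'n \<Rightarrow> (real^'n \<Rightarrow> real) \<Rightarrow> (real^'n \<Rightarrow> real^'n) \<Rightarrow> (real^'n) set \<Rightarrow> (real^'n) measure"
where
  "graph_area_measure e g G U =
     distr
       (density (hyperplane_measure e)
         (\<lambda>y. indicator U (y + g y *\<^sub>R e) * ennreal (sqrt (1 + (norm (G y))\<^sup>2))))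
       borel (\<lambda>y. y + g y *\<^sub>R e)"

text \<open>
  The area measures of two charts agree on the part of the boundary covered by both. The
  measure obtained by gluing them is therefore their supremum in the lattice of Borel measures:
  it is carried by \<open>frontier \<Omega>\<close> and restricts on each chart to the area measure of the chart.
\<close>

definition surface_measure :: "(real^'n) set \<Rightarrow> (real^'n) measure" where
  "surface_measure \<Omega> = Sup {graph_area_measure e g G U | e g G U. boundary_chart \<Omega> e g G U}"

section \<open>The double layer potential\<close>

definition heat_kernel :: "real^'n \<Rightarrow> real \<Rightarrow> real" where
  "heat_kernel x t =
     (if t > 0 then (4 * pi * t) powr (- real CARD('n) / 2) * exp (- (norm x)\<^sup>2 / (4 * t)) else 0)"

definition normal_derivative :: "(real^'n) set \<Rightarrow> (real^'n \<Rightarrow> real) \<Rightarrow> real^'n \<Rightarrow> real" where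
  "normal_derivative \<Omega> f \<xi> = deriv (\<lambda>s. f (\<xi> + s *\<^sub>R outward_normal \<Omega> \<xi>)) 0"

definition coeff_primitive :: "(real \<Rightarrow> real) \<Rightarrow> real \<Rightarrow> real" where
  "coeff_primitive a t = (LINT z:{0..t}|lebesgue. a z)"

definition double_layer_integrand ::
  "(real^'n) set \<Rightarrow> (real \<Rightarrow> real) \<Rightarrow> (real^'n \<Rightarrow> real \<Rightarrow> real) \<Rightarrow>
   real^'n \<Rightarrow> real \<Rightarrow> real \<Rightarrow> real^'n \<Rightarrow> real"
where
  "double_layer_integrand \<Omega> a \<phi> x t \<tau> \<xi> =
     normal_derivative \<Omega>
       (\<lambda>\<eta>. heat_kernel (x - \<eta>) (coeff_primitive a t - coeff_primitive a \<tau>)) \<xi> * \<phi> \<xi> \<tau> * a \<tau>"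

text \<open>The time integral runs over \<open>[0, s]\<close> only, where \<open>s \<le> t\<close>.\<close>

definition double_layer_upto ::
  "(real^'n) set \<Rightarrow> (real \<Rightarrow> real) \<Rightarrow> (real^'n \<Rightarrow> real \<Rightarrow> real) \<Rightarrow> real^'n \<Rightarrow> real \<Rightarrow> real \<Rightarrow> real"
where
  "double_layer_upto \<Omega> a \<phi> x t s =
     (LINT \<tau>:{0..s}|lebesgue. LINT \<xi>:frontier \<Omega>|surface_measure \<Omega>.
        double_layer_integrand \<Omega> a \<phi> x t \<tau> \<xi>)"

text \<open>Existence of both integrals above; the Bochner integral is \<open>0\<close> if it does not exist.\<close>

definition double_layer_upto_exists ::
  "(real^'n) set \<Rightarrow> (real \<Rightarrow> real) \<Rightarrow> (real^'n \<Rightarrow> real \<Rightarrow> real) \<Rightarrow> real^'n \<Rightarrow> real \<Rightarrow> real \<Rightarrow> bool"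
where
  "double_layer_upto_exists \<Omega> a \<phi> x t s \<longleftrightarrow>
     (\<forall>\<tau>\<in>{0..s}. set_integrable (surface_measure \<Omega>) (frontier \<Omega>)
        (double_layer_integrand \<Omega> a \<phi> x t \<tau>)) \<and>
     set_integrable lebesgue {0..s}
       (\<lambda>\<tau>. LINT \<xi>:frontier \<Omega>|surface_measure \<Omega>. double_layer_integrand \<Omega> a \<phi> x t \<tau> \<xi>)"

definition double_layer ::
  "(real^'n) set \<Rightarrow> (real \<Rightarrow> real) \<Rightarrow> (real^'n \<Rightarrow> real \<Rightarrow> real) \<Rightarrow> real^'n \<Rightarrow> real \<Rightarrow> real"
where
  "double_layer \<Omega> a \<phi> x t = double_layer_upto \<Omega> a \<phi> x t t"

text \<open>The same integral at a boundary point, as an improper integral in time.\<close>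

definition double_layer_boundary ::
  "(real^'n) set \<Rightarrow> (real \<Rightarrow> real) \<Rightarrow> (real^'n \<Rightarrow> real \<Rightarrow> real) \<Rightarrow> real^'n \<Rightarrow> real \<Rightarrow> real"
where
  "double_layer_boundary \<Omega> a \<phi> x\<^sub>0 t =
     Lim (at_right 0) (\<lambda>h. double_layer_upto \<Omega> a \<phi> x\<^sub>0 t (t - h))"

end

theory Submission
  imports Defs "HOL-Probability.Distributions" "HOL-Probability.Distribution_Functions"
begin

text \<open>
The time variable \<open>A \<tau> = coeff_primitive a \<tau>\<close> removes the coefficient: since the zeros of
\<open>a\<close> are isolated, \<open>A\<close> is strictly increasing and continuous, and it carries the measure
\<open>a d\<tau>\<close> to Lebesgue measure (\<open>distr_primitive\<close>). The potential at \<open>(x, t)\<close> becomes the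
potential of the ordinary heat equation at \<open>(x, A t)\<close>, with a density that is again continuous. In the
variable \<open>\<sigma> = A t - A \<tau>\<close> it is
\<open>\<integral>\<^sub>0\<^sup>t \<integral> K(x, \<xi>, \<sigma>) \<psi>(\<xi>, t - \<sigma>) dS d\<sigma>\<close> with the kernel
\<open>K = heat_kernel (x - \<xi>) \<sigma> * ((x - \<xi>) \<bullet> \<nu>) / (2 \<sigma>)\<close>.

Two facts about \<open>K\<close> give the theorem. The first is a uniform bound (\<open>double_layer_near_bound\<close>): the
integral of \<open>\<bar>K\<bar>\<close> over the part of the boundary near \<open>x\<^sub>0\<close> is bounded uniformly for \<open>x\<close> near
\<open>x\<^sub>0\<close>. If \<open>x\<close> has vertical distance \<open>d\<close> from the graph and horizontal distance \<open>\<rho>\<close> from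
\<open>\<xi>\<close>, then \<open>(x - \<xi>) \<bullet> \<nu>\<close> is at most \<open>d + C \<rho> powr (1 + \<alpha>)\<close>. After the Gaussian integration
over the tangential variables this leaves \<open>d \<sigma> powr (- 3 / 2) exp (- \<kappa> d\<^sup>2 / \<sigma>)\<close>, whose integral does not
depend on \<open>d\<close>, and the weak singularity \<open>\<sigma> powr (\<alpha> / 2 - 1)\<close>. Hence the integrals converge absolutely,
on the boundary as well, and a density that vanishes at \<open>(x\<^sub>0, t)\<close> has a potential that is continuous there.

The second fact is the jump for one density \<open>\<zeta>\<close> with \<open>\<zeta> x\<^sub>0 = 1\<close>, a bump function of the space variable
that is supported in one chart (\<open>extended_potential_bump\<close>). The divergence theorem for \<open>\<zeta> \<nabla>\<epsilon>\<close>, where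
\<open>\<epsilon>\<close> is the heat kernel, and the heat equation turn the surface integral of \<open>K \<zeta>\<close> into the time derivative of
\<open>p = \<integral>\<^bsub>\<Omega>\<^esub> \<zeta> \<epsilon>\<close> plus a term with \<open>\<nabla>\<zeta>\<close>, which is weakly singular and thus continuous everywhere.
Integrating in time leaves \<open>p(t) - p(0+)\<close>. The limit \<open>p(0+)\<close> is \<open>\<zeta> x\<close> inside \<open>\<Omega>\<close>, but only \<open>\<zeta> x / 2\<close> on the
boundary, since the blow-up of \<open>\<Omega>\<close> at a boundary point is a half space: this is the jump. A general density is a
multiple of \<open>\<zeta>\<close> plus a density that vanishes at \<open>(x\<^sub>0, t)\<close>.

Both facts need the surface measure inside one chart. There it is the area of the graph, because two
charts give the same area where they overlap (\<open>graph_areas_agree\<close>). The reason is that the flux of a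
continuous field \<open>f v\<close> through the graph is the limit of
\<open>k \<integral> f(x) (1\<^bsub>\<Omega>\<^esub>(x - v / k) - 1\<^bsub>\<Omega>\<^esub>(x)) dx\<close>, and this expression does not mention the chart (\<open>flux_limit\<close>).
The same limit gives the divergence theorem, by moving the translation to \<open>f\<close>.
\<close>

section \<open>Lebesgue measure foliated along a hyperplane\<close>

lemma hyperplane_measure_sets [simp, measurable_cong]:
  "sets (hyperplane_measure e) = sets borel"
  by (simp add: hyperplane_measure_def)

lemma hyperplane_measure_space [simp]: "space (hyperplane_measure e) = UNIV"
  by (simp add: hyperplane_measure_def)

lemma nn_integral_hyperplane_measure:
  fixes f :: "real^'n \<Rightarrow> ennreal"
  assumes [measurable]: "f \<in> borel_measurable borel"
  shows "(\<integral>\<^sup>+y. f y \<partial>hyperplane_measure e) =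
    (\<integral>\<^sup>+x. indicator {x. 0 \<le> x \<bullet> e \<and> x \<bullet> e \<le> 1} x * f (x - (x \<bullet> e) *\<^sub>R e) \<partial>lborel)"
  unfolding hyperplane_measure_def
  by (subst nn_integral_distr; simp add: nn_integral_density)

lemma nn_integral_lborel_shift:
  fixes f :: "'a::euclidean_space \<Rightarrow> ennreal"
  assumes [measurable]: "f \<in> borel_measurable borel"
  shows "(\<integral>\<^sup>+x. f (x + c) \<partial>lborel) = (\<integral>\<^sup>+x. f x \<partial>lborel)"
proof -
  have "(\<integral>\<^sup>+x. f x \<partial>lborel) = (\<integral>\<^sup>+x. f x \<partial>distr lborel borel ((+) c))"
    by (simp add: lborel_distr_plus)
  also have "\<dots> = (\<integral>\<^sup>+x. f (c + x) \<partial>lborel)" by (subst nn_integral_distr; simp)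
  finally show ?thesis by (simp add: add.commute)
qed

text \<open>
Moving the base point of a line along \<open>e\<close> does not change the integral over the line. Therefore the projection
in \<open>hyperplane_measure\<close> can be dropped, and after a translation by \<open>s e\<close> each point \<open>x\<close> is counted for those
\<open>s\<close> that bring it into the slab: an interval of length \<open>1\<close>.
\<close>

lemma nn_integral_foliation:
  fixes f :: "real^'n \<Rightarrow> ennreal"
  assumes e: "norm e = 1" and [measurable]: "f \<in> borel_measurable borel"
  shows "(\<integral>\<^sup>+y. (\<integral>\<^sup>+s. f (y + s *\<^sub>R e) \<partial>lborel) \<partial>hyperplane_measure e) = (\<integral>\<^sup>+x. f x \<partial>lborel)"
proof -
  let ?S = "{x. 0 \<le> x \<bullet> e \<and> x \<bullet> e \<le> 1}"
  have ee: "e \<bullet> e = 1" using e by (simp add: dot_square_norm)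
  have "(\<integral>\<^sup>+y. (\<integral>\<^sup>+s. f (y + s *\<^sub>R e) \<partial>lborel) \<partial>hyperplane_measure e)
     = (\<integral>\<^sup>+x. indicator ?S x * (\<integral>\<^sup>+s. f (x - (x \<bullet> e) *\<^sub>R e + s *\<^sub>R e) \<partial>lborel) \<partial>lborel)"
    by (rule nn_integral_hyperplane_measure) simp
  also have "\<dots> = (\<integral>\<^sup>+x. indicator ?S x * (\<integral>\<^sup>+s. f (x + s *\<^sub>R e) \<partial>lborel) \<partial>lborel)"
  proof (rule nn_integral_cong, rule arg_cong[where f="\<lambda>z. _ * z"])
    fix x
    show "(\<integral>\<^sup>+s. f (x - (x \<bullet> e) *\<^sub>R e + s *\<^sub>R e) \<partial>lborel) = (\<integral>\<^sup>+s. f (x + s *\<^sub>R e) \<partial>lborel)"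
      using nn_integral_lborel_shift[of "\<lambda>s. f (x + s *\<^sub>R e)" "- (x \<bullet> e)"]
      by (simp add: algebra_simps)
  qed
  also have "\<dots> = (\<integral>\<^sup>+x. (\<integral>\<^sup>+s. indicator ?S x * f (x + s *\<^sub>R e) \<partial>lborel) \<partial>lborel)"
    by (intro nn_integral_cong nn_integral_cmult[symmetric]) simp
  also have "\<dots> = (\<integral>\<^sup>+s. (\<integral>\<^sup>+x. indicator ?S x * f (x + s *\<^sub>R e) \<partial>lborel) \<partial>lborel)"
    by (intro lborel_pair.Fubini') measurable
  also have "\<dots> = (\<integral>\<^sup>+s. (\<integral>\<^sup>+x. indicator ?S (x - s *\<^sub>R e) * f x \<partial>lborel) \<partial>lborel)"
  proof (rule nn_integral_cong)
    fix s
    show "(\<integral>\<^sup>+x. indicator ?S x * f (x + s *\<^sub>R e) \<partial>lborel) = (\<integral>\<^sup>+x. indicator ?S (x - s *\<^sub>R e) * f x \<partial>lborel)"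
      using nn_integral_lborel_shift[of "\<lambda>x. indicator ?S (x - s *\<^sub>R e) * f x" "s *\<^sub>R e"] by simp
  qed
  also have "\<dots> = (\<integral>\<^sup>+x. (\<integral>\<^sup>+s. indicator ?S (x - s *\<^sub>R e) * f x \<partial>lborel) \<partial>lborel)"
    by (intro lborel_pair.Fubini') measurable
  also have "\<dots> = (\<integral>\<^sup>+x. f x \<partial>lborel)"
  proof (rule nn_integral_cong)
    fix x
    have "(\<integral>\<^sup>+s. indicator ?S (x - s *\<^sub>R e) * f x \<partial>lborel) = (\<integral>\<^sup>+s. f x * indicator {x \<bullet> e - 1 .. x \<bullet> e} s \<partial>lborel)"
      by (intro nn_integral_cong) (auto simp: indicator_def inner_diff_left ee)
    also have "\<dots> = f x" by (subst nn_integral_cmult_indicator; simp)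
    finally show "(\<integral>\<^sup>+s. indicator ?S (x - s *\<^sub>R e) * f x \<partial>lborel) = f x" .
  qed
  finally show ?thesis .
qed

lemma AE_hyperplane_measure:
  assumes e: "norm e = 1"
  shows "AE y in hyperplane_measure e. y \<bullet> e = 0"
proof -
  have ee: "e \<bullet> e = 1" using e by (simp add: dot_square_norm)
  show ?thesis unfolding hyperplane_measure_def
    by (subst AE_distr_iff) (auto simp: inner_diff_left ee)
qed

lemma nn_integral_gaussian_real:
  assumes c: "c > 0"
  shows "(\<integral>\<^sup>+s. ennreal (exp (- c * s\<^sup>2)) \<partial>lborel) = ennreal (sqrt (pi / c))"
proof -
  define \<sigma> where "\<sigma> = sqrt (1 / (2 * c))"
  have \<sigma>: "\<sigma> > 0" "\<sigma>\<^sup>2 = 1 / (2 * c)" using c by (auto simp: \<sigma>_def)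
  have "(\<integral>\<^sup>+s. ennreal (exp (- c * s\<^sup>2)) \<partial>lborel)
     = (\<integral>\<^sup>+s. ennreal (sqrt (pi / c)) * ennreal (normal_density 0 \<sigma> s) \<partial>lborel)"
  proof (intro nn_integral_cong)
    fix s :: real
    have "2 * pi * \<sigma>\<^sup>2 = pi / c" "s\<^sup>2 / (2 * \<sigma>\<^sup>2) = c * s\<^sup>2"
      using c by (simp_all add: \<sigma>(2) field_simps)
    then have "sqrt (pi / c) * normal_density 0 \<sigma> s = exp (- c * s\<^sup>2)"
      using c by (simp add: normal_density_def)
    then show "ennreal (exp (- c * s\<^sup>2)) = ennreal (sqrt (pi / c)) * ennreal (normal_density 0 \<sigma> s)"
      using c by (simp add: ennreal_mult[symmetric])
  qed
  also have "\<dots> = ennreal (sqrt (pi / c)) * (\<integral>\<^sup>+s. ennreal (normal_density 0 \<sigma> s) \<partial>lborel)"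
    by (rule nn_integral_cmult) simp
  also have "(\<integral>\<^sup>+s. ennreal (normal_density 0 \<sigma> s) \<partial>lborel) = 1"
    using \<sigma>(1) by (subst nn_integral_eq_integral) (auto simp: integral_normal_density)
  finally show ?thesis by simp
qed

lemma norm_sq_sum_Basis: "(norm (x::'a::euclidean_space))\<^sup>2 = (\<Sum>b\<in>Basis. (x \<bullet> b)\<^sup>2)"
  by (subst power2_norm_eq_inner, subst euclidean_inner) (simp add: power2_eq_square)

lemma nn_integral_gaussian:
  assumes c: "c > 0"
  shows "(\<integral>\<^sup>+x. ennreal (exp (- c * (norm (x - z :: real^'n))\<^sup>2)) \<partial>lborel) = ennreal ((pi / c) powr (real CARD('n) / 2))"
proof -
  have "(\<integral>\<^sup>+x. ennreal (exp (- c * (norm (x - z :: real^'n))\<^sup>2)) \<partial>lborel)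
     = (\<integral>\<^sup>+x. ennreal (exp (- c * (norm (x :: real^'n))\<^sup>2)) \<partial>lborel)"
    using nn_integral_lborel_shift[of "\<lambda>x. ennreal (exp (- c * (norm (x :: real^'n))\<^sup>2))" "-z"] by simp
  also have "\<dots> = (\<integral>\<^sup>+x. (\<Prod>b\<in>Basis. ennreal (exp (- c * ((x::real^'n) \<bullet> b)\<^sup>2))) \<partial>lborel)"
    by (simp add: norm_sq_sum_Basis exp_sum[symmetric] prod_ennreal sum_distrib_left sum_negf)
  also have "\<dots> = (\<Prod>b\<in>(Basis::(real^'n) set). ennreal (sqrt (pi / c)))"
    using c by (subst nn_integral_lborel_prod) (simp, simp, simp only: nn_integral_gaussian_real)
  also have "\<dots> = ennreal (sqrt (pi / c) ^ CARD('n))"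
    using c by (simp add: ennreal_power)
  also have "sqrt (pi / c) ^ CARD('n) = (pi / c) powr (real CARD('n) / 2)"
    using c by (simp add: powr_half_sqrt[symmetric] powr_powr flip: powr_realpow)
  finally show ?thesis .
qed

text \<open>
The Gaussian of the whole space factors along the foliation; dividing by the one-dimensional factor lowers the
dimension by one. This is the only integral over the hyperplane that has to be computed.
\<close>

lemma nn_integral_gaussian_hyperplane:
  fixes e x :: "real^'n"
  assumes e: "norm e = 1" and c: "c > 0"
  shows "(\<integral>\<^sup>+y. ennreal (exp (- c * (norm (y - (x - (x \<bullet> e) *\<^sub>R e)))\<^sup>2)) \<partial>hyperplane_measure e)
     = ennreal ((pi / c) powr ((real CARD('n) - 1) / 2))" (is "?I = _")
proof -
  have ee: "e \<bullet> e = 1" using e by (simp add: dot_square_norm)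
  define p where "p = x - (x \<bullet> e) *\<^sub>R e"
  have pe: "p \<bullet> e = 0" by (simp add: p_def inner_diff_left ee)
  have "ennreal ((pi / c) powr (real CARD('n) / 2)) = (\<integral>\<^sup>+x. ennreal (exp (- c * (norm (x - p))\<^sup>2)) \<partial>lborel)"
    using nn_integral_gaussian[OF c, of p] by simp
  also have "\<dots> = (\<integral>\<^sup>+y. (\<integral>\<^sup>+s. ennreal (exp (- c * (norm (y + s *\<^sub>R e - p))\<^sup>2)) \<partial>lborel) \<partial>hyperplane_measure e)"
    by (rule nn_integral_foliation[symmetric]) (simp_all add: e)
  also have "\<dots> = (\<integral>\<^sup>+y. ennreal (exp (- c * (norm (y - p))\<^sup>2)) * ennreal (sqrt (pi / c)) \<partial>hyperplane_measure e)"
  proof (rule nn_integral_cong_AE, rule AE_mp[OF AE_hyperplane_measure[OF e]], rule AE_I2, rule impI)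
    fix y assume y: "y \<bullet> e = 0"
    have "(norm (y + s *\<^sub>R e - p))\<^sup>2 = (norm (y - p))\<^sup>2 + s\<^sup>2" for s
      using y pe ee unfolding power2_norm_eq_inner
      by (simp add: inner_add_left inner_add_right inner_diff_left inner_diff_right inner_commute power2_eq_square)
    then have "(\<integral>\<^sup>+s. ennreal (exp (- c * (norm (y + s *\<^sub>R e - p))\<^sup>2)) \<partial>lborel)
       = (\<integral>\<^sup>+s. ennreal (exp (- c * (norm (y - p))\<^sup>2)) * ennreal (exp (- c * s\<^sup>2)) \<partial>lborel)"
      by (simp add: ennreal_mult[symmetric] exp_add[symmetric] algebra_simps)
    also have "\<dots> = ennreal (exp (- c * (norm (y - p))\<^sup>2)) * (\<integral>\<^sup>+s. ennreal (exp (- c * s\<^sup>2)) \<partial>lborel)"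
      by (rule nn_integral_cmult) simp
    finally show "(\<integral>\<^sup>+s. ennreal (exp (- c * (norm (y + s *\<^sub>R e - p))\<^sup>2)) \<partial>lborel)
       = ennreal (exp (- c * (norm (y - p))\<^sup>2)) * ennreal (sqrt (pi / c))"
      by (simp only: nn_integral_gaussian_real[OF c])
  qed
  also have "\<dots> = ?I * ennreal (sqrt (pi / c))"
    unfolding p_def by (rule nn_integral_multc) simp
  finally have *: "ennreal ((pi / c) powr (real CARD('n) / 2)) = ?I * ennreal (sqrt (pi / c))" .
  have s: "sqrt (pi / c) > 0" using c by simp
  then have "?I \<noteq> top"
    using * by (metis ennreal_mult_eq_top_iff ennreal_neq_top ennreal_top_mult ennreal_eq_0_iff less_le_not_le)
  then obtain r where r: "?I = ennreal r" "r \<ge> 0" by (cases ?I) auto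
  have "(pi / c) powr (real CARD('n) / 2) = r * sqrt (pi / c)"
    using * r s by (simp add: ennreal_mult[symmetric])
  moreover have "(pi / c) powr (real CARD('n) / 2) = (pi / c) powr ((real CARD('n) - 1) / 2) * sqrt (pi / c)"
    using c by (simp add: powr_half_sqrt[symmetric] powr_add[symmetric] diff_divide_distrib)
  ultimately have "r = (pi / c) powr ((real CARD('n) - 1) / 2)" using s c by auto
  then show ?thesis using r by simp
qed

lemma emeasure_hyperplane_ball:
  fixes e :: "real^'n"
  assumes e: "norm e = 1"
  shows "emeasure (hyperplane_measure e) (cball 0 R) < \<infinity>"
proof (cases "R \<ge> 0")
  case True
  have "emeasure (hyperplane_measure e) (cball 0 R) = (\<integral>\<^sup>+y. indicator (cball 0 R) y \<partial>hyperplane_measure e)"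
    by simp
  also have "\<dots> \<le> (\<integral>\<^sup>+y. ennreal (exp (R\<^sup>2)) * ennreal (exp (- 1 * (norm (y - (0 - (0 \<bullet> e) *\<^sub>R e)))\<^sup>2)) \<partial>hyperplane_measure e)"
  proof (rule nn_integral_mono)
    fix y :: "real^'n"
    have "norm y \<le> R \<Longrightarrow> (norm y)\<^sup>2 \<le> R\<^sup>2" by (intro power_mono) auto
    then show "indicator (cball 0 R) y \<le> ennreal (exp (R\<^sup>2)) * ennreal (exp (- 1 * (norm (y - (0 - (0 \<bullet> e) *\<^sub>R e)))\<^sup>2))"
      by (auto simp: indicator_def ennreal_mult[symmetric] exp_add[symmetric] simp flip: ennreal_1)
  qed
  also have "\<dots> = ennreal (exp (R\<^sup>2)) * ennreal ((pi / 1) powr ((real CARD('n) - 1) / 2))"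
    by (subst nn_integral_cmult, simp, subst nn_integral_gaussian_hyperplane[OF e]) auto
  also have "\<dots> < \<infinity>" by (simp add: ennreal_mult_less_top)
  finally show ?thesis .
qed simp

lemma sigma_finite_hyperplane_measure:
  fixes e :: "real^'n"
  assumes e: "norm e = 1"
  shows "sigma_finite_measure (hyperplane_measure e)"
proof
  show "\<exists>A. countable A \<and> A \<subseteq> sets (hyperplane_measure e) \<and> \<Union> A = space (hyperplane_measure e) \<and>
      (\<forall>a\<in>A. emeasure (hyperplane_measure e) a \<noteq> \<infinity>)"
  proof (intro exI[of _ "range (\<lambda>k. cball 0 (real k))"] conjI ballI)
    show "\<Union> (range (\<lambda>k. cball 0 (real k))) = space (hyperplane_measure e)"
      using real_arch_simple by (auto simp: subset_eq)
  qed (use emeasure_hyperplane_ball[OF e] in \<open>auto simp: less_top\<close>)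
qed

lemma lborel_eq_distr_foliation:
  fixes e :: "real^'n"
  assumes e: "norm e = 1"
  shows "distr (hyperplane_measure e \<Otimes>\<^sub>M lborel) borel (\<lambda>(y, s). y + s *\<^sub>R e) = lborel"
proof (rule measure_eqI)
  fix A assume "A \<in> sets (distr (hyperplane_measure e \<Otimes>\<^sub>M lborel) borel (\<lambda>(y, s). y + s *\<^sub>R e))"
  then have A[measurable]: "A \<in> sets borel" by simp
  have "emeasure (distr (hyperplane_measure e \<Otimes>\<^sub>M lborel) borel (\<lambda>(y, s). y + s *\<^sub>R e)) A
    = (\<integral>\<^sup>+z. indicator A z \<partial>distr (hyperplane_measure e \<Otimes>\<^sub>M lborel) borel (\<lambda>(y, s). y + s *\<^sub>R e))"
    by simp
  also have "\<dots> = (\<integral>\<^sup>+z. indicator A (fst z + snd z *\<^sub>R e) \<partial>(hyperplane_measure e \<Otimes>\<^sub>M lborel))"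
    by (subst nn_integral_distr) (auto simp: case_prod_beta')
  also have "\<dots> = (\<integral>\<^sup>+y. (\<integral>\<^sup>+s. indicator A (y + s *\<^sub>R e) \<partial>lborel) \<partial>hyperplane_measure e)"
    by (subst lborel.nn_integral_fst[symmetric]) auto
  also have "\<dots> = emeasure lborel A"
    by (subst nn_integral_foliation[OF e]) auto
  finally show "emeasure (distr (hyperplane_measure e \<Otimes>\<^sub>M lborel) borel (\<lambda>(y, s). y + s *\<^sub>R e)) A = emeasure lborel A" .
qed simp

lemma integral_foliation:
  fixes e :: "real^'n" and f :: "real^'n \<Rightarrow> real"
  assumes e: "norm e = 1" and f: "integrable lborel f"
  shows "(\<integral>x. f x \<partial>lborel) = (\<integral>y. (\<integral>s. f (y + s *\<^sub>R e) \<partial>lborel) \<partial>hyperplane_measure e)"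
proof -
  interpret H: sigma_finite_measure "hyperplane_measure e" by (rule sigma_finite_hyperplane_measure[OF e])
  interpret P: pair_sigma_finite "hyperplane_measure e" lborel ..
  have [measurable]: "f \<in> borel_measurable borel" using f by simp
  have i: "integrable (hyperplane_measure e \<Otimes>\<^sub>M lborel) (\<lambda>(y, s). f (y + s *\<^sub>R e))"
    using f by (subst (asm) lborel_eq_distr_foliation[OF e, symmetric], subst (asm) integrable_distr_eq)
      (auto simp: case_prod_beta')
  have "(\<integral>x. f x \<partial>lborel) = (\<integral>z. f (fst z + snd z *\<^sub>R e) \<partial>(hyperplane_measure e \<Otimes>\<^sub>M lborel))"
    by (subst lborel_eq_distr_foliation[OF e, symmetric], subst integral_distr) (auto simp: case_prod_beta')
  also have "\<dots> = (\<integral>y. (\<integral>s. f (y + s *\<^sub>R e) \<partial>lborel) \<partial>hyperplane_measure e)"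
    using P.integral_fst'[OF i] by (simp add: case_prod_beta')
  finally show ?thesis .
qed

section \<open>Flux through a graph and the divergence theorem\<close>

text \<open>
\<open>N\<close> is the gradient of the height \<open>x \<bullet> e - g x\<close>: an outward normal that is not normalised. Since \<open>G\<close> is
orthogonal to \<open>e\<close>, its length is the area factor \<open>sqrt (1 + (norm G)\<^sup>2)\<close> of the graph.
\<close>

locale boundary_graph =
  fixes \<Omega> :: "(real^'n) set" and e g G U
  assumes chart: "boundary_chart \<Omega> e g G U" and open_Omega: "open \<Omega>"
begin

abbreviation N :: "real^'n \<Rightarrow> real^'n" where "N x \<equiv> e - G x"

abbreviation lift :: "real^'n \<Rightarrow> real^'n" where "lift y \<equiv> y + g y *\<^sub>R e"

abbreviation H :: "(real^'n) measure" where "H \<equiv> hyperplane_measure e"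

lemma norm_e: "norm e = 1" and open_U: "open U"
  and g_shift: "g (x + s *\<^sub>R e) = g x"
  and g_deriv: "(g has_derivative (\<lambda>h. h \<bullet> G x)) (at x)"
  and G_cont: "continuous_on UNIV G"
  and Omega_iff: "x \<in> U \<Longrightarrow> x \<in> \<Omega> \<longleftrightarrow> x \<bullet> e < g x"
  using chart unfolding boundary_chart_def gderiv_def by auto

lemma e_e [simp]: "e \<bullet> e = 1"
  using norm_e by (simp add: dot_square_norm)

lemma g_cont: "continuous_on UNIV g"
  using g_deriv has_derivative_continuous continuous_at_imp_continuous_on by blast

lemma g_measurable [measurable]: "g \<in> borel_measurable borel"
  and G_measurable [measurable]: "G \<in> borel_measurable borel"
  using g_cont G_cont by (auto intro: borel_measurable_continuous_onI)

lemma U_measurable [measurable]: "U \<in> sets borel" "\<Omega> \<in> sets borel"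
  using open_U open_Omega by auto

lemma G_shift: "G (x + s *\<^sub>R e) = G x"
proof -
  have "((\<lambda>x. g (x + s *\<^sub>R e)) has_derivative (\<lambda>h. h \<bullet> G (x + s *\<^sub>R e))) (at x)"
    by (rule has_derivative_compose[OF _ g_deriv, of "\<lambda>x. x + s *\<^sub>R e" "\<lambda>h. h"])
      (auto intro!: derivative_eq_intros)
  then have "(g has_derivative (\<lambda>h. h \<bullet> G (x + s *\<^sub>R e))) (at x)" by (simp add: g_shift)
  then have "(\<lambda>h. h \<bullet> G (x + s *\<^sub>R e)) = (\<lambda>h. h \<bullet> G x)"
    using g_deriv has_derivative_unique by blast
  then show ?thesis by (metis vector_eq_ldot)
qed

lemma G_perp [simp]: "G x \<bullet> e = 0" "e \<bullet> G x = 0"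
proof -
  have "((\<lambda>s. g (x + s *\<^sub>R e)) has_derivative (\<lambda>h. (h *\<^sub>R e) \<bullet> G (x + 0 *\<^sub>R e))) (at 0)"
    by (rule has_derivative_compose[OF _ g_deriv, of "\<lambda>s. x + s *\<^sub>R e" "\<lambda>h. h *\<^sub>R e"])
      (auto intro!: derivative_eq_intros)
  then have "((\<lambda>s::real. g x) has_derivative (\<lambda>h. (h *\<^sub>R e) \<bullet> G x)) (at 0)" by (simp add: g_shift)
  moreover have "((\<lambda>s::real. g x) has_derivative (\<lambda>h. 0)) (at 0)" by simp
  ultimately have "(\<lambda>h. (h *\<^sub>R e) \<bullet> G x) = (\<lambda>h. 0)" by (rule has_derivative_unique)
  then have "(1 *\<^sub>R e) \<bullet> G x = 0" by (rule fun_cong)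
  then show "e \<bullet> G x = 0" "G x \<bullet> e = 0" by (simp_all add: inner_commute)
qed

lemma norm_N: "(norm (N x))\<^sup>2 = 1 + (norm (G x))\<^sup>2" "norm (N x) \<ge> 1" "sqrt (1 + (norm (G x))\<^sup>2) = norm (N x)"
proof -
  show a: "(norm (N x))\<^sup>2 = 1 + (norm (G x))\<^sup>2"
    unfolding power2_norm_eq_inner by (simp add: inner_diff_left inner_diff_right)
  show "norm (N x) \<ge> 1" using a by (intro power2_le_imp_le[of 1 "norm (N x)"]) auto
  show "sqrt (1 + (norm (G x))\<^sup>2) = norm (N x)" by (rule real_sqrt_unique) (simp_all only: a norm_ge_zero)
qed

lemma frontier_iff:
  assumes "x \<in> U" shows "x \<in> frontier \<Omega> \<longleftrightarrow> x \<bullet> e = g x"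
proof
  assume f: "x \<in> frontier \<Omega>"
  then have "x \<notin> \<Omega>" using open_Omega by (simp add: frontier_def interior_open)
  then have ge: "x \<bullet> e \<ge> g x" using Omega_iff[OF assms] by auto
  show "x \<bullet> e = g x"
  proof (rule ccontr)
    assume "x \<bullet> e \<noteq> g x"
    then have x: "x \<in> {x \<in> U. g x < x \<bullet> e}" using ge assms by auto
    have "{x \<in> U. g x < x \<bullet> e} = U \<inter> {x. g x < x \<bullet> e}" by auto
    then have "open {x \<in> U. g x < x \<bullet> e}"
      using open_U g_cont by (auto intro!: open_Int open_Collect_less continuous_intros)
    moreover have "{x \<in> U. g x < x \<bullet> e} \<inter> \<Omega> = {}" using Omega_iff by auto
    ultimately have "{x \<in> U. g x < x \<bullet> e} \<inter> closure \<Omega> = {}" by (simp add: open_Int_closure_eq_empty)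
    then show False using x f by (auto simp: frontier_def)
  qed
next
  assume eq: "x \<bullet> e = g x"
  have "x \<notin> \<Omega>" using eq Omega_iff[OF assms] by auto
  moreover have "x \<in> closure \<Omega>"
  proof (subst closure_approachable, intro allI impI)
    fix \<epsilon> :: real assume \<epsilon>: "\<epsilon> > 0"
    obtain d where d: "d > 0" "ball x d \<subseteq> U" using open_U assms open_contains_ball by blast
    define s where "s = min d \<epsilon> / 2"
    have s: "s > 0" "s < d" "s < \<epsilon>" using d \<epsilon> by (auto simp: s_def)
    define y where "y = x - s *\<^sub>R e"
    have dy: "dist y x = s" using s norm_e by (simp add: y_def dist_norm)
    then have "y \<in> U" using d s by (auto simp: dist_commute)
    moreover have "y \<bullet> e < g y" using g_shift[of x "-s"] s eq by (simp add: y_def inner_diff_left)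
    ultimately have "y \<in> \<Omega>" using Omega_iff by blast
    then show "\<exists>y\<in>\<Omega>. dist y x < \<epsilon>" using dy s by auto
  qed
  ultimately show "x \<in> frontier \<Omega>" using open_Omega by (simp add: frontier_def interior_open)
qed

lemma G_bounded: obtains L where "L \<ge> 0" "\<And>x. norm x \<le> R \<Longrightarrow> norm (G x) \<le> L"
proof -
  have "compact (G ` cball 0 R)"
    using G_cont by (intro compact_continuous_image) (auto intro: continuous_on_subset)
  then have "bounded (G ` cball 0 R)" by (rule compact_imp_bounded)
  then obtain L where "\<forall>z\<in>G ` cball 0 R. norm z \<le> L" by (auto simp: bounded_iff)
  then show ?thesis by (intro that[of "max L 0"]) force+
qed

lemma g_lipschitz:
  assumes "\<And>x. norm x \<le> R \<Longrightarrow> norm (G x) \<le> L" "norm x \<le> R" "norm y \<le> R"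
  shows "\<bar>g x - g y\<bar> \<le> L * norm (x - y)"
proof -
  have "norm (g x - g y) \<le> L * norm (x - y)"
  proof (rule differentiable_bound[of "cball 0 R"])
    fix z :: "real^'n" assume z: "z \<in> cball 0 R"
    show "(g has_derivative (\<lambda>h. h \<bullet> G z)) (at z within cball 0 R)"
      using g_deriv by (rule has_derivative_at_withinI)
    show "onorm (\<lambda>h. h \<bullet> G z) \<le> L"
    proof (rule onorm_le)
      fix h have "\<bar>h \<bullet> G z\<bar> \<le> norm h * norm (G z)" by (rule Cauchy_Schwarz_ineq2)
      also have "\<dots> \<le> norm h * L" using z assms(1) by (intro mult_left_mono) auto
      finally show "norm (h \<bullet> G z) \<le> L * norm h" by (simp add: mult.commute)
    qed
  qed (use assms in auto)
  then show ?thesis by simp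
qed

end

lemma continuous_compact_support_bounded:
  fixes f :: "'a::euclidean_space \<Rightarrow> 'b::real_normed_vector"
  assumes "continuous_on UNIV f" "compact S" "\<And>x. x \<notin> S \<Longrightarrow> f x = 0"
  obtains B where "B > 0" "\<And>x. norm (f x) \<le> B"
proof -
  have "bounded (f ` S)"
    using assms by (intro compact_imp_bounded compact_continuous_image) (auto intro: continuous_on_subset)
  then obtain B where "\<forall>z\<in>f ` S. norm z \<le> B" by (auto simp: bounded_iff)
  then have "norm (f x) \<le> max B 1" for x using assms(3)[of x] by (cases "x \<in> S") force+
  then show ?thesis by (intro that[of "max B 1"]) auto
qed

lemma integrable_bounded_support:
  fixes f :: "'a::euclidean_space \<Rightarrow> 'b::{banach, second_countable_topology}"
  assumes f: "f \<in> borel_measurable borel" and B: "\<And>x. norm (f x) \<le> B" and S: "bounded S" "\<And>x. x \<notin> S \<Longrightarrow> f x = 0"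
  shows "integrable lborel f"
proof -
  obtain R where R: "\<And>x. x \<in> S \<Longrightarrow> norm x \<le> R" using S(1) by (auto simp: bounded_iff)
  have B0: "B \<ge> 0" using order_trans[OF norm_ge_zero B] .
  show ?thesis
  proof (rule Bochner_Integration.integrable_bound)
    show "integrable lborel (\<lambda>x::'a. B * indicator (cball 0 R) x)"
      using emeasure_lborel_cball_finite[of "0::'a" R]
      by (intro integrable_mult_right integrable_real_indicator) auto
    show "AE x in lborel. norm (f x) \<le> norm (B * indicator (cball 0 R) x)"
    proof (rule AE_I2)
      fix x show "norm (f x) \<le> norm (B * indicator (cball 0 R) x)"
      proof (cases "x \<in> S")
        case True
        then show ?thesis using R[of x] B[of x] by (simp add: abs_of_nonneg B0)
      qed (simp add: S(2))
    qed
  qed (use f in simp)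
qed

text \<open>
The fundamental theorem of calculus on a half-line. With it the difference of two such integrals needs no
distinction of which upper limit is larger.
\<close>

lemma integral_below_has_derivative:
  fixes f :: "real \<Rightarrow> real"
  assumes f: "continuous_on UNIV f" and B: "\<And>s. \<bar>s\<bar> > B \<Longrightarrow> f s = 0"
  shows "((\<lambda>z. \<integral>s. f s * indicator {..<z} s \<partial>lborel) has_real_derivative f z) (at z)"
proof -
  define L where "L = - (\<bar>B\<bar> + \<bar>z\<bar> + 2)"
  have eq: "(\<integral>s. f s * indicator {..<w} s \<partial>lborel) = integral {L..w} f" if "w > L" for w
  proof -
    have "(\<integral>s. f s * indicator {..<w} s \<partial>lborel) = (\<integral>s. indicator {L..w} s *\<^sub>R f s \<partial>lborel)"
    proof (rule integral_cong_AE)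
      have [measurable]: "f \<in> borel_measurable borel" by (rule borel_measurable_continuous_onI[OF f])
      show "(\<lambda>s. f s * indicator {..<w} s) \<in> borel_measurable lborel" by simp
      show "(\<lambda>s. indicator {L..w} s *\<^sub>R f s) \<in> borel_measurable lborel" by simp
      show "AE s in lborel. f s * indicator {..<w} s = indicator {L..w} s *\<^sub>R f s"
      proof (rule AE_mp[OF AE_lborel_singleton[of w]], rule AE_I2, rule impI)
        fix s assume "s \<noteq> w"
        moreover have "s < L \<Longrightarrow> f s = 0" using B[of s] by (auto simp: L_def)
        ultimately show "f s * indicator {..<w} s = indicator {L..w} s *\<^sub>R f s"
          by (auto simp: indicator_def)
      qed
    qed
    also have "\<dots> = integral {L..w} f"
      using set_borel_integral_eq_integral(2)[of "{L..w}" f]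
        borel_integrable_atLeastAtMost'[of L w f] continuous_on_subset[OF f]
      by (simp add: set_lebesgue_integral_def)
    finally show ?thesis .
  qed
  have "((\<lambda>w. integral {L..w} f) has_real_derivative f z) (at z within {L..z+1})"
    using continuous_on_subset[OF f] by (intro integral_has_real_derivative) (auto simp: L_def)
  then have "((\<lambda>w. integral {L..w} f) has_real_derivative f z) (at z)"
    by (subst (asm) at_within_interior) (auto simp: L_def)
  then show ?thesis
    by (rule has_field_derivative_transform_within_open[of _ _ _ "{L<..}"]) (auto simp: L_def eq)
qed

context boundary_graph begin

text \<open>
Translating \<open>\<Omega>\<close> by \<open>t v\<close> moves the graph of \<open>g\<close> to that of \<open>\<gamma> t y = g (y - t v) + t (v \<bullet> e)\<close>. On each
vertical line the integral of \<open>f\<close> over the difference of the two regions, divided by \<open>t\<close>, tends to the value of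
\<open>f\<close> on the graph times the derivative of \<open>\<gamma>\<close>, which is \<open>v \<bullet> N y\<close>; dominated convergence does the rest. The
left-hand side depends on \<open>\<Omega>\<close> only.
\<close>

lemma flux_limit:
  fixes f :: "real^'n \<Rightarrow> real"
  assumes f: "continuous_on UNIV f" and S: "compact S" "S \<subseteq> U" "\<And>x. x \<notin> S \<Longrightarrow> f x = 0"
  shows "(\<lambda>k. real (Suc k) * (\<integral>x. f x * (indicator \<Omega> (x - inverse (real (Suc k)) *\<^sub>R v) - indicator \<Omega> x) \<partial>lborel))
     \<longlonglongrightarrow> (\<integral>y. f (lift y) * (v \<bullet> N y) \<partial>H)"
proof -
  have fm[measurable]: "f \<in> borel_measurable borel" by (rule borel_measurable_continuous_onI[OF f])
  obtain B where B: "B > 0" "\<And>x. \<bar>f x\<bar> \<le> B"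
    using continuous_compact_support_bounded[OF f S(1,3)] by (metis real_norm_def)
  obtain R where R: "R > 0" "\<And>x. x \<in> S \<Longrightarrow> norm x \<le> R"
    using compact_imp_bounded[OF S(1)] bounded_pos by metis
  have f0: "norm x > R \<Longrightarrow> f x = 0" for x using S(3) R(2) by force
  obtain L where L: "L \<ge> 0" "\<And>x. norm x \<le> R + norm v \<Longrightarrow> norm (G x) \<le> L" using G_bounded by blast
  obtain \<delta> where \<delta>: "\<delta> > 0" "\<And>x w. x \<in> S \<Longrightarrow> norm w < \<delta> \<Longrightarrow> x - w \<in> U"
  proof -
    obtain \<delta> where "\<delta> > 0" and *: "(\<Union>x\<in>S. ball x \<delta>) \<subseteq> U"
      using compact_subset_open_imp_ball_epsilon_subset[OF S(1) open_U S(2)] by blast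
    moreover have "x - w \<in> ball x \<delta>" if "norm w < \<delta>" for x w using that by (simp add: dist_norm)
    ultimately show ?thesis by (intro that[of \<delta>]) blast+
  qed
  define h where "h k = inverse (real (Suc k))" for k
  have h: "h k > 0" "h k \<le> 1" for k by (auto simp: h_def field_simps)
  have h0: "h \<longlonglongrightarrow> 0" unfolding h_def by (rule LIMSEQ_inverse_real_of_nat)
  define \<gamma> where "\<gamma> t y = g (y - t *\<^sub>R v) + t * (v \<bullet> e)" for t y
  have \<gamma>s: "\<gamma> t (y + s *\<^sub>R e) = \<gamma> t y" for t y s
    using g_shift[of "y - t *\<^sub>R v" s] by (simp add: \<gamma>_def algebra_simps)
  have \<gamma>0: "\<gamma> 0 y = g y" for y by (simp add: \<gamma>_def)
  have [measurable]: "\<gamma> t \<in> borel_measurable borel" for t unfolding \<gamma>_def by simp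
  define F where "F t x = f x * (indicator {z. z \<bullet> e < \<gamma> t z} x - indicator {z. z \<bullet> e < g z} x)" for t x
  have Fm[measurable]: "F t \<in> borel_measurable borel" for t unfolding F_def by measurable
  have Fi: "integrable lborel (F t)" for t
    using B f0 by (intro integrable_bounded_support[OF Fm, of t B "cball 0 R"]) (auto simp: F_def indicator_def)
  have ev: "eventually (\<lambda>k. h k * norm v < \<delta>) sequentially"
  proof -
    have "(\<lambda>k. h k * norm v) \<longlonglongrightarrow> 0 * norm v" by (intro tendsto_mult h0 tendsto_const)
    then show ?thesis using \<delta>(1) by (auto intro: order_tendstoD)
  qed
  define \<Phi> where "\<Phi> y z = (\<integral>s. f (y + s *\<^sub>R e) * indicator {..<z} s \<partial>lborel)" for y z
  have norm_ys: "norm y \<le> norm (y + s *\<^sub>R e)" "\<bar>s\<bar> \<le> norm (y + s *\<^sub>R e) " if "y \<bullet> e = 0" for y s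
  proof -
    have "(norm (y + s *\<^sub>R e))\<^sup>2 = (norm y)\<^sup>2 + s\<^sup>2"
      using that unfolding power2_norm_eq_inner
      by (simp add: inner_add_left inner_add_right inner_commute power2_eq_square)
    then show "norm y \<le> norm (y + s *\<^sub>R e)" "\<bar>s\<bar> \<le> norm (y + s *\<^sub>R e)"
      by (auto intro!: power2_le_imp_le[of "norm y"] power2_le_imp_le[of "\<bar>s\<bar>"])
  qed
  have fy_cont: "continuous_on UNIV (\<lambda>s. f (y + s *\<^sub>R e))" for y
    by (intro continuous_on_compose2[OF f]) (auto intro!: continuous_intros)
  have fyi: "integrable lborel (\<lambda>s. f (y + s *\<^sub>R e) * indicator {..<z} s)" if "y \<bullet> e = 0" for y z
  proof (rule Bochner_Integration.integrable_bound)
    show "integrable lborel (\<lambda>x. B * indicator {-R..R} x)"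
      by (intro integrable_mult_right integrable_real_indicator) (auto simp: emeasure_lborel_Icc_eq)
    show "AE s in lborel. norm (f (y + s *\<^sub>R e) * indicator {..<z} s) \<le> norm (B * indicator {-R..R} s)"
    proof (rule AE_I2)
      fix s show "norm (f (y + s *\<^sub>R e) * indicator {..<z} s) \<le> norm (B * indicator {-R..R} s)"
        using B(1) B(2)[of "y + s *\<^sub>R e"] f0[of "y + s *\<^sub>R e"] norm_ys(2)[OF that, of s] by (auto simp: indicator_def)
    qed
  qed simp
  have \<Phi>d: "(\<Phi> y has_real_derivative f (y + z *\<^sub>R e)) (at z)" if "y \<bullet> e = 0" for y z
    unfolding \<Phi>_def
  proof (rule integral_below_has_derivative[of "\<lambda>s. f (y + s *\<^sub>R e)" R z, OF fy_cont])
    fix s assume "\<bar>s\<bar> > R" then show "f (y + s *\<^sub>R e) = 0"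
      using f0[of "y + s *\<^sub>R e"] norm_ys(2)[OF that, of s] by linarith
  qed
  have J: "(\<integral>s. F t (y + s *\<^sub>R e) \<partial>lborel) = \<Phi> y (\<gamma> t y) - \<Phi> y (g y)" if "y \<bullet> e = 0" for y t
  proof -
    have "(\<integral>s. F t (y + s *\<^sub>R e) \<partial>lborel) = (\<integral>s. f (y + s *\<^sub>R e) * indicator {..<\<gamma> t y} s - f (y + s *\<^sub>R e) * indicator {..<g y} s \<partial>lborel)"
      using that by (intro Bochner_Integration.integral_cong)
        (auto simp: F_def \<gamma>s g_shift inner_add_left indicator_def)
    also have "\<dots> = \<Phi> y (\<gamma> t y) - \<Phi> y (g y)"
      unfolding \<Phi>_def by (intro Bochner_Integration.integral_diff fyi that)
    finally show ?thesis .
  qed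
  have lim: "(\<lambda>k. real (Suc k) * (\<integral>s. F (h k) (y + s *\<^sub>R e) \<partial>lborel)) \<longlonglongrightarrow> f (lift y) * (v \<bullet> N y)"
    if y: "y \<bullet> e = 0" for y
  proof -
    have "((\<lambda>t. g (y - t *\<^sub>R v)) has_derivative (\<lambda>t. (- t *\<^sub>R v) \<bullet> G (y - 0 *\<^sub>R v))) (at 0)"
      by (rule has_derivative_compose[OF _ g_deriv, of "\<lambda>t. y - t *\<^sub>R v" "\<lambda>t. - t *\<^sub>R v"])
        (auto intro!: derivative_eq_intros)
    moreover have "(\<lambda>t. (- t *\<^sub>R v) \<bullet> G (y - 0 *\<^sub>R v)) = (*) (- (v \<bullet> G y))"
      by (auto simp: fun_eq_iff)
    ultimately have "((\<lambda>t. g (y - t *\<^sub>R v)) has_real_derivative (- (v \<bullet> G y))) (at 0)"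
      by (simp only: has_field_derivative_def)
    then have "((\<lambda>t. \<gamma> t y) has_real_derivative (v \<bullet> N y)) (at 0)"
      unfolding \<gamma>_def by (auto intro!: derivative_eq_intros simp: inner_diff_right)
    moreover have "(\<Phi> y has_real_derivative f (lift y)) (at (\<gamma> 0 y))"
      using \<Phi>d[OF y] by (simp add: \<gamma>0)
    ultimately have "((\<lambda>t. \<Phi> y (\<gamma> t y)) has_real_derivative f (lift y) * (v \<bullet> N y)) (at 0)"
      by (rule DERIV_chain2[rotated])
    then have "((\<lambda>t. (\<Phi> y (\<gamma> t y) - \<Phi> y (g y)) / t) \<longlongrightarrow> f (lift y) * (v \<bullet> N y)) (at 0)"
      by (simp add: has_field_derivative_iff \<gamma>0)
    moreover have "filterlim h (at 0) sequentially"
      by (rule filterlim_atI[OF h0], rule always_eventually) (simp add: h_def)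
    ultimately have "((\<lambda>k. (\<Phi> y (\<gamma> (h k) y) - \<Phi> y (g y)) / h k) \<longlongrightarrow> f (lift y) * (v \<bullet> N y)) sequentially"
      by (rule filterlim_compose)
    then show ?thesis by (simp add: J[OF y] h_def field_simps)
  qed
  define C where "C = B * (norm v * L + norm v)"
  have C: "C \<ge> 0" using B L by (simp add: C_def)
  have bound: "\<bar>real (Suc k) * (\<integral>s. F (h k) (y + s *\<^sub>R e) \<partial>lborel)\<bar> \<le> C * indicator (cball 0 R) y"
    if y: "y \<bullet> e = 0" for y k
  proof (cases "norm y \<le> R")
    case True
    have "norm (\<Phi> y (\<gamma> (h k) y) - \<Phi> y (g y)) \<le> B * norm (\<gamma> (h k) y - g y)"
      using \<Phi>d[OF y] B by (intro field_differentiable_bound[of UNIV _ "\<lambda>z. f (y + z *\<^sub>R e)"])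
        (auto intro: has_field_derivative_at_within)
    also have "\<dots> \<le> B * (h k * (norm v * L + norm v))"
    proof (intro mult_left_mono)
      have "norm (y - h k *\<^sub>R v) \<le> norm y + norm (h k *\<^sub>R v)" by (rule norm_triangle_ineq4)
      also have "\<dots> \<le> R + norm v" using True h[of k] by (auto intro!: add_mono mult_left_le_one_le)
      finally have n: "norm (y - h k *\<^sub>R v) \<le> R + norm v" .
      have "norm y \<le> R + norm v" using True norm_ge_zero[of v] by linarith
      then have "\<bar>g (y - h k *\<^sub>R v) - g y\<bar> \<le> L * norm (y - h k *\<^sub>R v - y)"
        using L(2) n by (intro g_lipschitz[of "R + norm v" L]) simp_all
      also have "\<dots> = h k * (norm v * L)" using h[of k] by simp
      finally have 1: "\<bar>g (y - h k *\<^sub>R v) - g y\<bar> \<le> h k * (norm v * L)" .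
      have "\<bar>v \<bullet> e\<bar> \<le> norm v" using Cauchy_Schwarz_ineq2[of v e] norm_e by simp
      then have "\<bar>h k * (v \<bullet> e)\<bar> \<le> h k * norm v" using h[of k] by (simp add: abs_mult)
      then show "norm (\<gamma> (h k) y - g y) \<le> h k * (norm v * L + norm v)"
        using 1 by (simp add: \<gamma>_def distrib_left)
    qed (use B in auto)
    finally have "norm (\<Phi> y (\<gamma> (h k) y) - \<Phi> y (g y)) \<le> h k * C" by (simp add: C_def mult_ac)
    then have "real (Suc k) * norm (\<Phi> y (\<gamma> (h k) y) - \<Phi> y (g y)) \<le> real (Suc k) * (h k * C)"
      by (intro mult_left_mono) auto
    also have "\<dots> = C" by (simp add: h_def)
    finally show ?thesis using True by (simp add: J[OF y] abs_mult)
  next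
    case False
    then have "F (h k) (y + s *\<^sub>R e) = 0" for s using f0[of "y + s *\<^sub>R e"] norm_ys(1)[OF y, of s] by (auto simp: F_def)
    then show ?thesis using False by simp
  qed
  have AEe: "AE y in H. y \<bullet> e = 0" by (rule AE_hyperplane_measure[OF norm_e])
  have main: "(\<lambda>k. \<integral>y. real (Suc k) * (\<integral>s. F (h k) (y + s *\<^sub>R e) \<partial>lborel) \<partial>H)
      \<longlonglongrightarrow> (\<integral>y. f (lift y) * (v \<bullet> N y) \<partial>H)"
  proof (rule integral_dominated_convergence[where w="\<lambda>y. C * indicator (cball 0 R) y"])
    show "integrable H (\<lambda>y. C * indicator (cball 0 R) y)"
      using emeasure_hyperplane_ball[OF norm_e]
      by (intro integrable_mult_right integrable_real_indicator) auto
    show "AE y in H. (\<lambda>k. real (Suc k) * (\<integral>s. F (h k) (y + s *\<^sub>R e) \<partial>lborel)) \<longlonglongrightarrow> f (lift y) * (v \<bullet> N y)"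
      using AEe by eventually_elim (rule lim)
    show "AE y in H. norm (real (Suc k) * (\<integral>s. F (h k) (y + s *\<^sub>R e) \<partial>lborel)) \<le> C * indicator (cball 0 R) y" for k
      using AEe by eventually_elim (use bound in simp)
  qed measurable
  \<comment> \<open>For small translations the support of \<open>f\<close> stays in \<open>U\<close>, where \<open>\<Omega>\<close> is the region below the graph.\<close>
  have eq: "(\<integral>x. f x * (indicator \<Omega> (x - h k *\<^sub>R v) - indicator \<Omega> x) \<partial>lborel) = (\<integral>y. (\<integral>s. F (h k) (y + s *\<^sub>R e) \<partial>lborel) \<partial>H)"
    if k: "h k * norm v < \<delta>" for k
  proof -
    have "f x * (indicator \<Omega> (x - h k *\<^sub>R v) - indicator \<Omega> x) = F (h k) x" for x
    proof (cases "x \<in> S")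
      case True
      then have "x - h k *\<^sub>R v \<in> U" "x \<in> U" using \<delta>(2)[of x "h k *\<^sub>R v"] k h[of k] S(2) by auto
      then show ?thesis by (auto simp: F_def Omega_iff \<gamma>_def indicator_def inner_diff_left)
    qed (simp add: F_def S(3))
    then show ?thesis using integral_foliation[OF norm_e Fi] by simp
  qed
  show ?thesis unfolding h_def[symmetric]
  proof (rule Lim_transform_eventually[OF main])
    show "\<forall>\<^sub>F k in sequentially. (\<integral>y. real (Suc k) * (\<integral>s. F (h k) (y + s *\<^sub>R e) \<partial>lborel) \<partial>H) =
       real (Suc k) * (\<integral>x. f x * (indicator \<Omega> (x - h k *\<^sub>R v) - indicator \<Omega> x) \<partial>lborel)"
      using ev by eventually_elim (simp add: eq)
  qed
qed

end

lemma integral_lborel_shift: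
  fixes f :: "'a::euclidean_space \<Rightarrow> real"
  assumes [measurable]: "f \<in> borel_measurable borel"
  shows "(\<integral>x. f (x + c) \<partial>lborel) = (\<integral>x. f x \<partial>lborel)"
proof -
  have "(\<integral>x. f x \<partial>lborel) = (\<integral>x. f x \<partial>distr lborel borel ((+) c))" by (simp add: lborel_distr_plus)
  also have "\<dots> = (\<integral>x. f (c + x) \<partial>lborel)" by (subst integral_distr) auto
  finally show ?thesis by (simp add: add.commute)
qed

lemma integrable_lborel_shift:
  fixes f :: "'a::euclidean_space \<Rightarrow> real"
  assumes "integrable lborel f"
  shows "integrable lborel (\<lambda>x. f (x + c))"
proof -
  have "integrable (distr lborel borel ((+) c)) f" using assms by (simp add: lborel_distr_plus)
  then show ?thesis by (subst (asm) integrable_distr_eq) (use assms in \<open>auto simp: add.commute\<close>)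
qed

context boundary_graph begin

text \<open>
The divergence theorem for the field \<open>f v\<close>: after a translation of the variable, the difference quotient in
\<open>flux_limit\<close> is a difference quotient of \<open>f\<close> over \<open>\<Omega>\<close>, which converges to the directional derivative.
\<close>

lemma divergence_below_graph:
  fixes f :: "real^'n \<Rightarrow> real"
  assumes f: "\<And>x. (f has_derivative (\<lambda>w. w \<bullet> Df x)) (at x)" and Df: "continuous_on UNIV Df"
    and S: "compact S" "S \<subseteq> U" "\<And>x. x \<notin> S \<Longrightarrow> f x = 0"
  shows "(\<integral>x. indicator \<Omega> x * (v \<bullet> Df x) \<partial>lborel)
     = (\<integral>y. f (lift y) * (v \<bullet> N y) \<partial>H)"
proof -
  have fc: "continuous_on UNIV f"
    by (intro continuous_at_imp_continuous_on ballI has_derivative_continuous[OF f])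
  have fm[measurable]: "f \<in> borel_measurable borel" by (rule borel_measurable_continuous_onI[OF fc])
  have [measurable]: "Df \<in> borel_measurable borel" by (rule borel_measurable_continuous_onI[OF Df])
  obtain B where B: "B > 0" "\<And>x. \<bar>f x\<bar> \<le> B"
    using continuous_compact_support_bounded[OF fc S(1,3)] by (metis real_norm_def)
  obtain R where R: "R > 0" "\<And>x. x \<in> S \<Longrightarrow> norm x \<le> R"
    using compact_imp_bounded[OF S(1)] bounded_pos by metis
  have f0: "norm x > R \<Longrightarrow> f x = 0" for x using S(3) R(2) by force
  define h where "h k = inverse (real (Suc k))" for k
  have h: "h k > 0" "h k \<le> 1" for k by (auto simp: h_def field_simps)
  have h0: "h \<longlonglongrightarrow> 0" unfolding h_def by (rule LIMSEQ_inverse_real_of_nat)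
  have "compact (Df ` cball 0 (R + 2 * norm v))"
    using Df by (intro compact_continuous_image) (auto intro: continuous_on_subset)
  then have "bounded (Df ` cball 0 (R + 2 * norm v))" by (rule compact_imp_bounded)
  then obtain L where L': "\<forall>x\<in>cball 0 (R + 2 * norm v). norm (Df x) \<le> L"
    by (auto simp: bounded_iff)
  have L: "norm x \<le> R + 2 * norm v \<Longrightarrow> norm (Df x) \<le> L" for x using L' by simp
  have L0: "L \<ge> 0" using order_trans[OF norm_ge_zero L[of 0]] R(1) by simp
  have fi: "integrable lborel (\<lambda>x. f x * indicator A x)" if [measurable]: "A \<in> sets borel" for A
    using B f0 by (intro integrable_bounded_support[of _ B "cball 0 R"]) (auto simp: indicator_def)
  have swap: "(\<integral>x. f x * (indicator \<Omega> (x - h k *\<^sub>R v) - indicator \<Omega> x) \<partial>lborel)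
     = (\<integral>x. indicator \<Omega> x * (f (x + h k *\<^sub>R v) - f x) \<partial>lborel)" for k
  proof -
    have i1: "integrable lborel (\<lambda>x. f x * indicator \<Omega> (x - h k *\<^sub>R v))"
    proof -
      have "integrable lborel (\<lambda>x. f x * indicator ((\<lambda>x. x - h k *\<^sub>R v) -` \<Omega>) x)"
        by (rule fi) (intro measurable_sets_borel[of _ borel]; simp)
      then show ?thesis by (simp add: indicator_def vimage_def)
    qed
    have i2: "integrable lborel (\<lambda>x. f (x + h k *\<^sub>R v) * indicator \<Omega> x)"
      using integrable_lborel_shift[OF i1, of "h k *\<^sub>R v"] by simp
    have "(\<integral>x. f x * (indicator \<Omega> (x - h k *\<^sub>R v) - indicator \<Omega> x) \<partial>lborel)
      = (\<integral>x. f x * indicator \<Omega> (x - h k *\<^sub>R v) \<partial>lborel) - (\<integral>x. f x * indicator \<Omega> x \<partial>lborel)"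
      by (simp add: right_diff_distrib Bochner_Integration.integral_diff[OF i1 fi])
    also have "(\<integral>x. f x * indicator \<Omega> (x - h k *\<^sub>R v) \<partial>lborel) = (\<integral>x. f (x + h k *\<^sub>R v) * indicator \<Omega> x \<partial>lborel)"
      using integral_lborel_shift[of "\<lambda>x. f x * indicator \<Omega> (x - h k *\<^sub>R v)" "h k *\<^sub>R v"] by simp
    also have "\<dots> - (\<integral>x. f x * indicator \<Omega> x \<partial>lborel) = (\<integral>x. f (x + h k *\<^sub>R v) * indicator \<Omega> x - f x * indicator \<Omega> x \<partial>lborel)"
      by (rule Bochner_Integration.integral_diff[symmetric, OF i2 fi]) simp
    finally show ?thesis by (simp add: algebra_simps)
  qed
  have "(\<lambda>k. \<integral>x. real (Suc k) * (indicator \<Omega> x * (f (x + h k *\<^sub>R v) - f x)) \<partial>lborel)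
      \<longlonglongrightarrow> (\<integral>x. indicator \<Omega> x * (v \<bullet> Df x) \<partial>lborel)"
  proof (rule integral_dominated_convergence[where w="\<lambda>x. L * norm v * indicator (cball 0 (R + norm v)) x"])
    show "integrable lborel (\<lambda>x::real^'n. L * norm v * indicator (cball 0 (R + norm v)) x)"
      using emeasure_lborel_cball_finite[of "0::real^'n" "R + norm v"]
      by (intro integrable_mult_right integrable_real_indicator) auto
    show "AE x in lborel. (\<lambda>k. real (Suc k) * (indicator \<Omega> x * (f (x + h k *\<^sub>R v) - f x))) \<longlonglongrightarrow> indicator \<Omega> x * (v \<bullet> Df x)"
    proof (rule AE_I2)
      fix x
      have "((\<lambda>t. f (x + t *\<^sub>R v)) has_derivative (\<lambda>t. (t *\<^sub>R v) \<bullet> Df (x + 0 *\<^sub>R v))) (at 0)"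
        by (rule has_derivative_compose[OF _ f, of "\<lambda>t. x + t *\<^sub>R v" "\<lambda>t. t *\<^sub>R v"])
          (auto intro!: derivative_eq_intros)
      moreover have "(\<lambda>t. (t *\<^sub>R v) \<bullet> Df (x + 0 *\<^sub>R v)) = (*) (v \<bullet> Df x)"
        by (auto simp: fun_eq_iff)
      ultimately have "((\<lambda>t. f (x + t *\<^sub>R v)) has_real_derivative (v \<bullet> Df x)) (at 0)"
        by (simp only: has_field_derivative_def)
      then have "((\<lambda>t. (f (x + t *\<^sub>R v) - f x) / t) \<longlongrightarrow> v \<bullet> Df x) (at 0)"
        by (simp add: has_field_derivative_iff)
      moreover have "filterlim h (at 0) sequentially"
        by (rule filterlim_atI[OF h0], rule always_eventually) (simp add: h_def)
      ultimately have "((\<lambda>k. (f (x + h k *\<^sub>R v) - f x) / h k) \<longlongrightarrow> v \<bullet> Df x) sequentially"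
        by (rule filterlim_compose)
      then have "((\<lambda>k. indicator \<Omega> x * ((f (x + h k *\<^sub>R v) - f x) / h k)) \<longlongrightarrow> indicator \<Omega> x * (v \<bullet> Df x)) sequentially"
        by (intro tendsto_mult tendsto_const)
      then show "(\<lambda>k. real (Suc k) * (indicator \<Omega> x * (f (x + h k *\<^sub>R v) - f x))) \<longlonglongrightarrow> indicator \<Omega> x * (v \<bullet> Df x)"
        by (simp add: h_def field_simps)
    qed
    fix k
    show "AE x in lborel. norm (real (Suc k) * (indicator \<Omega> x * (f (x + h k *\<^sub>R v) - f x))) \<le> L * norm v * indicator (cball 0 (R + norm v)) x"
    proof (rule AE_I2)
      fix x
      have hv: "norm (h k *\<^sub>R v) \<le> norm v" using h[of k] by (simp add: mult_left_le_one_le)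
      show "norm (real (Suc k) * (indicator \<Omega> x * (f (x + h k *\<^sub>R v) - f x))) \<le> L * norm v * indicator (cball 0 (R + norm v)) x"
      proof (cases "norm x \<le> R + norm v")
        case True
        have "norm (f (x + h k *\<^sub>R v) - f x) \<le> L * norm (x + h k *\<^sub>R v - x)"
        proof (rule differentiable_bound[of "cball 0 (R + 2 * norm v)"])
          fix z :: "real^'n" assume z: "z \<in> cball 0 (R + 2 * norm v)"
          show "(f has_derivative (\<lambda>w. w \<bullet> Df z)) (at z within cball 0 (R + 2 * norm v))"
            using f by (rule has_derivative_at_withinI)
          show "onorm (\<lambda>w. w \<bullet> Df z) \<le> L"
          proof (rule onorm_le)
            fix w have "\<bar>w \<bullet> Df z\<bar> \<le> norm w * norm (Df z)" by (rule Cauchy_Schwarz_ineq2)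
            also have "\<dots> \<le> norm w * L" using z L by (intro mult_left_mono) auto
            finally show "norm (w \<bullet> Df z) \<le> L * norm w" by (simp add: mult.commute)
          qed
        next
          show "x + h k *\<^sub>R v \<in> cball 0 (R + 2 * norm v)"
            using norm_triangle_ineq[of x "h k *\<^sub>R v"] hv True unfolding mem_cball_0 by linarith
          show "x \<in> cball 0 (R + 2 * norm v)" using True by (auto intro: order_trans)
        qed simp
        then have "\<bar>f (x + h k *\<^sub>R v) - f x\<bar> \<le> h k * (L * norm v)" using h[of k] by (simp add: mult_ac)
        then have "real (Suc k) * \<bar>f (x + h k *\<^sub>R v) - f x\<bar> \<le> real (Suc k) * (h k * (L * norm v))"
          by (intro mult_left_mono) auto
        also have "\<dots> = L * norm v" by (simp add: h_def)
        finally show ?thesis using True L0 by (auto simp: abs_mult indicator_def)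
      next
        case False
        then have "R < norm x" by (smt (verit) norm_ge_zero)
        moreover have "R < norm (x + h k *\<^sub>R v)" using norm_diff_ineq[of x "h k *\<^sub>R v"] hv False by linarith
        ultimately show ?thesis using f0 False by simp
      qed
    qed
  qed measurable
  moreover have "(\<lambda>k. \<integral>x. real (Suc k) * (indicator \<Omega> x * (f (x + h k *\<^sub>R v) - f x)) \<partial>lborel)
     \<longlonglongrightarrow> (\<integral>y. f (lift y) * (v \<bullet> N y) \<partial>H)"
    using flux_limit[OF fc S, of v] unfolding h_def[symmetric] swap by simp
  ultimately show ?thesis by (rule LIMSEQ_unique)
qed

end

section \<open>The outward normal and the surface measure\<close>

lemma boundary_graphI: "boundary_chart \<Omega> e g G U \<Longrightarrow> open \<Omega> \<Longrightarrow> boundary_graph \<Omega> e g G U"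
  by (simp add: boundary_graph_def)

context boundary_graph begin

lemma height_has_derivative:
  "((\<lambda>t. (x + t *\<^sub>R v) \<bullet> e - g (x + t *\<^sub>R v)) has_real_derivative v \<bullet> N x) (at 0)"
proof -
  have "((\<lambda>t. g (x + t *\<^sub>R v)) has_derivative (\<lambda>t. (t *\<^sub>R v) \<bullet> G (x + 0 *\<^sub>R v))) (at 0)"
    by (rule has_derivative_compose[OF _ g_deriv, of "\<lambda>t. x + t *\<^sub>R v" "\<lambda>t. t *\<^sub>R v"])
      (auto intro!: derivative_eq_intros)
  moreover have "(\<lambda>t. (t *\<^sub>R v) \<bullet> G (x + 0 *\<^sub>R v)) = (*) (v \<bullet> G x)" by (auto simp: fun_eq_iff)
  ultimately have "((\<lambda>t. g (x + t *\<^sub>R v)) has_real_derivative (v \<bullet> G x)) (at 0)"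
    by (simp only: has_field_derivative_def)
  then show ?thesis
    by (auto intro!: derivative_eq_intros simp: inner_add_left inner_diff_right)
qed

end

text \<open>
A direction along which the height over one chart decreases leads into \<open>\<Omega>\<close>, so the height over the other chart
cannot increase. If the unit normals differ, their difference is a direction that violates this.
\<close>

lemma unit_normal_unique:
  assumes 1: "boundary_graph \<Omega> e1 g1 G1 U1" and 2: "boundary_graph \<Omega> e2 g2 G2 U2"
    and \<xi>: "\<xi> \<in> U1" "\<xi> \<in> U2" "\<xi> \<in> frontier \<Omega>"
  shows "(e1 - G1 \<xi>) /\<^sub>R norm (e1 - G1 \<xi>) = (e2 - G2 \<xi>) /\<^sub>R norm (e2 - G2 \<xi>)"
proof (rule ccontr)
  interpret A: boundary_graph \<Omega> e1 g1 G1 U1 by (rule 1)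
  interpret B: boundary_graph \<Omega> e2 g2 G2 U2 by (rule 2)
  define n1 where "n1 = A.N \<xi> /\<^sub>R norm (A.N \<xi>)"
  define n2 where "n2 = B.N \<xi> /\<^sub>R norm (B.N \<xi>)"
  have p1: "norm (A.N \<xi>) > 0" and p2: "norm (B.N \<xi>) > 0"
    using A.norm_N(2)[of \<xi>] B.norm_N(2)[of \<xi>] by linarith+
  have nn: "n1 \<bullet> n1 = 1" "n2 \<bullet> n2 = 1"
    using p1 p2 by (auto simp: n1_def n2_def dot_square_norm)
  assume "(e1 - G1 \<xi>) /\<^sub>R norm (e1 - G1 \<xi>) \<noteq> (e2 - G2 \<xi>) /\<^sub>R norm (e2 - G2 \<xi>)"
  then have "(n1 - n2) \<bullet> (n1 - n2) > 0" by (simp add: n1_def n2_def)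
  then have lt: "n1 \<bullet> n2 < 1"
    using nn by (simp add: inner_diff_left inner_diff_right inner_commute)
  define v where "v = n2 - n1"
  have "v \<bullet> n1 < 0" "v \<bullet> n2 > 0" using lt nn by (simp_all add: v_def inner_diff_left inner_commute[of n2 n1])
  then have v1: "v \<bullet> A.N \<xi> < 0" and v2: "v \<bullet> B.N \<xi> > 0"
    using p1 p2 by (simp_all only: n1_def n2_def inner_scaleR_right zero_less_mult_iff mult_less_0_iff) auto
  obtain d1 where d1: "d1 > 0" "\<And>t. 0 < t \<Longrightarrow> t < d1 \<Longrightarrow> (\<xi> + t *\<^sub>R v) \<bullet> e1 - g1 (\<xi> + t *\<^sub>R v) < \<xi> \<bullet> e1 - g1 \<xi>"
    using DERIV_neg_dec_right[OF A.height_has_derivative v1] by auto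
  obtain d2 where d2: "d2 > 0" "\<And>t. 0 < t \<Longrightarrow> t < d2 \<Longrightarrow> (\<xi> + t *\<^sub>R v) \<bullet> e2 - g2 (\<xi> + t *\<^sub>R v) > \<xi> \<bullet> e2 - g2 \<xi>"
    using DERIV_pos_inc_right[OF B.height_has_derivative v2] by auto
  have "open (U1 \<inter> U2)" using A.open_U B.open_U by auto
  then obtain r where r: "r > 0" "ball \<xi> r \<subseteq> U1 \<inter> U2" using \<xi> open_contains_ball by blast
  define q where "q = r / (norm v + 1)"
  define t where "t = min (min d1 d2) q / 2"
  have "q > 0" using r by (simp add: q_def add_nonneg_pos)
  then have t: "t > 0" "t < d1" "t < d2" "t < q" using d1(1) d2(1) by (auto simp: t_def)
  have "t * norm v \<le> t * (norm v + 1)" using t(1) by simp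
  also have "\<dots> < r" using t(4) by (simp add: q_def pos_less_divide_eq add_nonneg_pos)
  finally have "\<xi> + t *\<^sub>R v \<in> ball \<xi> r" using t(1) by (simp add: dist_norm)
  then have U: "\<xi> + t *\<^sub>R v \<in> U1" "\<xi> + t *\<^sub>R v \<in> U2" using r by auto
  have "\<xi> + t *\<^sub>R v \<in> \<Omega>" using d1(2)[OF t(1,2)] A.Omega_iff[OF U(1)] A.frontier_iff[OF \<xi>(1)] \<xi>(3) by simp
  moreover have "\<xi> + t *\<^sub>R v \<notin> \<Omega>" using d2(2)[OF t(1,3)] B.Omega_iff[OF U(2)] B.frontier_iff[OF \<xi>(2)] \<xi>(3) by simp
  ultimately show False by simp
qed

context boundary_graph begin

lemma outward_normal_eq:
  assumes "\<xi> \<in> U" "\<xi> \<in> frontier \<Omega>"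
  shows "outward_normal \<Omega> \<xi> = N \<xi> /\<^sub>R norm (N \<xi>)"
  unfolding outward_normal_def
proof (rule the_equality)
  show "\<exists>e' g' G' U'. boundary_chart \<Omega> e' g' G' U' \<and> \<xi> \<in> U' \<and> N \<xi> /\<^sub>R norm (N \<xi>) = (e' - G' \<xi>) /\<^sub>R norm (e' - G' \<xi>)"
    using chart assms by blast
next
  fix \<nu> assume "\<exists>e' g' G' U'. boundary_chart \<Omega> e' g' G' U' \<and> \<xi> \<in> U' \<and> \<nu> = (e' - G' \<xi>) /\<^sub>R norm (e' - G' \<xi>)"
  then obtain e' g' G' U' where c: "boundary_chart \<Omega> e' g' G' U'" "\<xi> \<in> U'" "\<nu> = (e' - G' \<xi>) /\<^sub>R norm (e' - G' \<xi>)" by blast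
  show "\<nu> = N \<xi> /\<^sub>R norm (N \<xi>)"
    using unit_normal_unique[OF boundary_graphI[OF c(1) open_Omega] boundary_graph_axioms c(2) assms] c(3) by simp
qed

lemma sets_graph_area [simp, measurable_cong]: "sets (graph_area_measure e g G U) = sets borel"
  by (simp add: graph_area_measure_def)

lemma nn_integral_graph_area:
  assumes [measurable]: "u \<in> borel_measurable borel"
  shows "(\<integral>\<^sup>+x. u x \<partial>graph_area_measure e g G U)
    = (\<integral>\<^sup>+y. indicator U (lift y) * ennreal (norm (N y)) * u (lift y) \<partial>H)"
  unfolding graph_area_measure_def norm_N(3)
  by (subst nn_integral_distr; simp add: nn_integral_density)

lemma graph_point:
  assumes "y \<bullet> e = 0"
  shows "(lift y) \<bullet> e = g (lift y)" "norm y \<le> norm (lift y)"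
    "G (lift y) = G y" "lift y \<in> U \<Longrightarrow> lift y \<in> frontier \<Omega>"
proof -
  show 1: "(lift y) \<bullet> e = g (lift y)"
    using assms by (simp add: g_shift inner_add_left)
  have "(norm (lift y))\<^sup>2 = (norm y)\<^sup>2 + (g y)\<^sup>2"
    using assms unfolding power2_norm_eq_inner
    by (simp add: inner_add_left inner_add_right inner_commute power2_eq_square)
  then show "norm y \<le> norm (lift y)" by (intro power2_le_imp_le[of "norm y"]) auto
  show "G (lift y) = G y" by (rule G_shift)
  show "lift y \<in> U \<Longrightarrow> lift y \<in> frontier \<Omega>" using 1 frontier_iff by blast
qed

lemma AE_e: "AE y in H. y \<bullet> e = 0"
  by (rule AE_hyperplane_measure[OF norm_e])

lemma emeasure_graph_area_bounded: 
  assumes [measurable]: "A \<in> sets borel" and b: "bounded A"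
  shows "emeasure (graph_area_measure e g G U) A < \<infinity>"
proof -
  obtain R where R: "\<And>x. x \<in> A \<Longrightarrow> norm x \<le> R" using b bounded_iff by blast
  obtain L where L: "L \<ge> 0" "\<And>x. norm x \<le> R \<Longrightarrow> norm (G x) \<le> L" using G_bounded by blast
  have "emeasure (graph_area_measure e g G U) A = (\<integral>\<^sup>+x. indicator A x \<partial>graph_area_measure e g G U)" by simp
  also have "\<dots> = (\<integral>\<^sup>+y. indicator U (lift y) * ennreal (norm (N y)) * indicator A (lift y) \<partial>H)"
    by (rule nn_integral_graph_area) simp
  also have "\<dots> \<le> (\<integral>\<^sup>+y. ennreal (1 + L) * indicator (cball 0 R) y \<partial>H)"
  proof (rule nn_integral_mono_AE, rule AE_mp[OF AE_e], rule AE_I2, rule impI)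
    fix y assume y: "y \<bullet> e = 0"
    show "indicator U (lift y) * ennreal (norm (N y)) * indicator A (lift y) \<le> ennreal (1 + L) * indicator (cball 0 R) y"
    proof (cases "lift y \<in> A")
      case True
      then have yR: "norm y \<le> R" using R graph_point(2)[OF y] order_trans by blast
      have "norm (N y) \<le> norm e + norm (G y)" by (rule norm_triangle_ineq4)
      also have "\<dots> \<le> 1 + L" using L(2)[OF yR] norm_e by simp
      finally show ?thesis using yR True by (auto simp: indicator_def ennreal_leI)
    qed simp
  qed
  also have "\<dots> = ennreal (1 + L) * emeasure H (cball 0 R)"
    by (rule nn_integral_cmult_indicator) simp
  also have "\<dots> < \<infinity>" using emeasure_hyperplane_ball[OF norm_e, of R] by (simp add: ennreal_mult_less_top)
  finally show ?thesis .
qed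

lemma integrable_over_graph:
  fixes f :: "real^'n \<Rightarrow> real"
  assumes f: "continuous_on UNIV f" and S: "compact S" "\<And>x. x \<notin> S \<Longrightarrow> f x = 0"
    and n: "continuous_on UNIV n"
  shows "integrable H (\<lambda>y. f (lift y) * n y)"
proof -
  have [measurable]: "f \<in> borel_measurable borel" by (rule borel_measurable_continuous_onI[OF f])
  have [measurable]: "n \<in> borel_measurable borel" by (rule borel_measurable_continuous_onI[OF n])
  obtain B where B: "B > 0" "\<And>x. \<bar>f x\<bar> \<le> B"
    using continuous_compact_support_bounded[OF f S] by (metis real_norm_def)
  obtain R where R: "R > 0" "\<And>x. x \<in> S \<Longrightarrow> norm x \<le> R"
    using compact_imp_bounded[OF S(1)] bounded_pos by metis
  have "compact (n ` cball 0 R)"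
    using n by (intro compact_continuous_image) (auto intro: continuous_on_subset)
  then have "bounded (n ` cball 0 R)" by (rule compact_imp_bounded)
  then obtain C where C: "\<forall>x\<in>cball 0 R. norm (n x) \<le> C" by (auto simp: bounded_iff)
  show ?thesis
  proof (rule Bochner_Integration.integrable_bound)
    show "integrable H (\<lambda>y. B * C * indicator (cball 0 R) y)"
      using emeasure_hyperplane_ball[OF norm_e, of R]
      by (intro integrable_mult_right integrable_real_indicator) (auto simp: less_top)
    show "AE y in H. norm (f (lift y) * n y) \<le> norm (B * C * indicator (cball 0 R) y)"
    proof (rule AE_mp[OF AE_e], rule AE_I2, rule impI)
      fix y assume y: "y \<bullet> e = 0"
      show "norm (f (lift y) * n y) \<le> norm (B * C * indicator (cball 0 R) y)"
      proof (cases "lift y \<in> S")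
        case True
        then have yR: "norm y \<le> R" using R(2) graph_point(2)[OF y] order_trans by blast
        then have "\<bar>n y\<bar> \<le> C" using C by simp
        then have "\<bar>f (lift y)\<bar> * \<bar>n y\<bar> \<le> B * C" using B by (intro mult_mono) (auto simp: less_imp_le)
        then have "\<bar>f (lift y) * n y\<bar> \<le> B * C" by (simp add: abs_mult)
        then have "\<bar>f (lift y) * n y\<bar> \<le> \<bar>B * C\<bar>" by linarith
        then show ?thesis using yR by simp
      qed (simp add: S(2))
    qed
  qed simp
qed

text \<open>
If \<open>n\<close> is the unit normal on the graph, then \<open>n \<bullet> N\<close> is the area factor. So the integral of \<open>f\<close> for the area
measure is a sum over the coordinates \<open>b\<close> of fluxes of \<open>f (n \<bullet> b)\<close> in direction \<open>b\<close>.
\<close>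

lemma area_integral_as_flux:
  fixes f :: "real^'n \<Rightarrow> real"
  assumes f: "continuous_on UNIV f" and S: "compact S" "\<And>x. x \<notin> S \<Longrightarrow> f x = 0"
    and n: "continuous_on UNIV n" and eq: "\<And>x. x \<in> S \<Longrightarrow> x \<in> frontier \<Omega> \<Longrightarrow> n x = N x /\<^sub>R norm (N x)" and SU: "S \<subseteq> U"
  shows "(\<Sum>b\<in>Basis. \<integral>y. (f (lift y) * (n (lift y) \<bullet> b)) * (b \<bullet> N y) \<partial>H)
    = (\<integral>y. f (lift y) * norm (N y) \<partial>H)"
proof -
  have i: "integrable H (\<lambda>y. (f (lift y) * (n (lift y) \<bullet> b)) * (b \<bullet> N y))" for b
    using S f n G_cont
    by (intro integrable_over_graph[of "\<lambda>x. f x * (n x \<bullet> b)" S]) (auto intro!: continuous_intros)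
  have "(\<Sum>b\<in>Basis. \<integral>y. (f (lift y) * (n (lift y) \<bullet> b)) * (b \<bullet> N y) \<partial>H)
    = (\<integral>y. (\<Sum>b\<in>Basis. (f (lift y) * (n (lift y) \<bullet> b)) * (b \<bullet> N y)) \<partial>H)"
    by (rule Bochner_Integration.integral_sum[symmetric]) (rule i)
  also have "\<dots> = (\<integral>y. f (lift y) * norm (N y) \<partial>H)"
  proof (rule integral_cong_AE)
    have [measurable]: "f \<in> borel_measurable borel" by (rule borel_measurable_continuous_onI[OF f])
    have [measurable]: "n \<in> borel_measurable borel" by (rule borel_measurable_continuous_onI[OF n])
    show "(\<lambda>y. \<Sum>b\<in>Basis. f (lift y) * (n (lift y) \<bullet> b) * (b \<bullet> N y)) \<in> borel_measurable H"
      by measurable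
    show "(\<lambda>y. f (lift y) * norm (N y)) \<in> borel_measurable H" by measurable
    show "AE y in H. (\<Sum>b\<in>Basis. f (lift y) * (n (lift y) \<bullet> b) * (b \<bullet> N y)) = f (lift y) * norm (N y)"
    proof (rule AE_mp[OF AE_e], rule AE_I2, rule impI)
      fix y assume y: "y \<bullet> e = 0"
      let ?Y = "lift y"
      have "(\<Sum>b\<in>Basis. f ?Y * (n ?Y \<bullet> b) * (b \<bullet> N y)) = f ?Y * (n ?Y \<bullet> N y)"
        by (simp only: mult.assoc sum_distrib_left[symmetric] euclidean_inner[of "n ?Y" "N y"] inner_commute[of "N y"])
      also have "\<dots> = f ?Y * norm (N y)"
      proof (cases "?Y \<in> S")
        case True
        then have "?Y \<in> frontier \<Omega>" using SU graph_point(4)[OF y] by blast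
        then have "n ?Y = N y /\<^sub>R norm (N y)" using eq[OF True] graph_point(3)[OF y] by simp
        moreover have "norm (N y) \<noteq> 0" using norm_N(2)[of y] by linarith
        ultimately have "n ?Y \<bullet> N y = norm (N y)"
          by (simp add: dot_square_norm power2_eq_square)
        then show ?thesis by simp
      qed (simp add: S(2))
      finally show "(\<Sum>b\<in>Basis. f ?Y * (n ?Y \<bullet> b) * (b \<bullet> N y)) = f ?Y * norm (N y)" .
    qed
  qed
  finally show ?thesis .
qed

lemma nn_integral_graph_area_continuous:
  fixes f :: "real^'n \<Rightarrow> real"
  assumes f: "continuous_on UNIV f" "\<And>x. f x \<ge> 0" and S: "compact S" "\<And>x. x \<notin> S \<Longrightarrow> f x = 0" and SU: "S \<subseteq> U"
  shows "(\<integral>\<^sup>+x. ennreal (f x) \<partial>graph_area_measure e g G U) = ennreal (\<integral>y. f (lift y) * norm (N y) \<partial>H)"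
proof -
  have [measurable]: "f \<in> borel_measurable borel" by (rule borel_measurable_continuous_onI[OF f(1)])
  have "(\<integral>\<^sup>+x. ennreal (f x) \<partial>graph_area_measure e g G U)
    = (\<integral>\<^sup>+y. indicator U (lift y) * ennreal (norm (N y)) * ennreal (f (lift y)) \<partial>H)"
    by (rule nn_integral_graph_area) simp
  also have "\<dots> = (\<integral>\<^sup>+y. ennreal (f (lift y) * norm (N y)) \<partial>H)"
  proof (rule nn_integral_cong)
    fix y
    have "f (lift y) = 0" if "lift y \<notin> U" using that S(2) SU by blast
    then show "indicator U (lift y) * ennreal (norm (N y)) * ennreal (f (lift y)) = ennreal (f (lift y) * norm (N y))"
      using f(2)[of "lift y"] by (auto simp: indicator_def ennreal_mult mult.commute)
  qed
  also have "\<dots> = ennreal (\<integral>y. f (lift y) * norm (N y) \<partial>H)"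
    using f(2) G_cont by (intro nn_integral_eq_integral integrable_over_graph[OF f(1) S] AE_I2)
      (auto intro!: continuous_intros)
  finally show ?thesis .
qed

end

text \<open>
Both sides are sums of the flux limits of \<open>\<Omega>\<close>, with the normal field of the first chart as \<open>n\<close>; on the
support of \<open>f\<close> it is the normal field of the second chart too.
\<close>

lemma area_integrals_agree:
  fixes \<Omega> :: "(real^'n) set" and f :: "real^'n \<Rightarrow> real"
  assumes 1: "boundary_graph \<Omega> e1 g1 G1 U1" and 2: "boundary_graph \<Omega> e2 g2 G2 U2"
    and f: "continuous_on UNIV f" "\<And>x. f x \<ge> 0" and S: "compact S" "\<And>x. x \<notin> S \<Longrightarrow> f x = 0"
    and SU: "S \<subseteq> U1" "S \<subseteq> U2"
  shows "(\<integral>\<^sup>+x. ennreal (f x) \<partial>graph_area_measure e1 g1 G1 U1) = (\<integral>\<^sup>+x. ennreal (f x) \<partial>graph_area_measure e2 g2 G2 U2)"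
proof -
  interpret A: boundary_graph \<Omega> e1 g1 G1 U1 by (rule 1)
  interpret B: boundary_graph \<Omega> e2 g2 G2 U2 by (rule 2)
  define n where "n x = A.N x /\<^sub>R norm (A.N x)" for x
  have pos: "norm (A.N x) \<noteq> 0" for x using A.norm_N(2)[of x] by auto
  have n: "continuous_on UNIV n"
    unfolding n_def using pos A.G_cont by (auto intro!: continuous_intros)
  have eq2: "n x = B.N x /\<^sub>R norm (B.N x)" if "x \<in> S" "x \<in> frontier \<Omega>" for x
    unfolding n_def using unit_normal_unique[OF 1 2, of x] that SU by blast
  have "(\<integral>y. (f (y + g1 y *\<^sub>R e1) * (n (y + g1 y *\<^sub>R e1) \<bullet> b)) * (b \<bullet> A.N y) \<partial>hyperplane_measure e1)
      = (\<integral>y. (f (y + g2 y *\<^sub>R e2) * (n (y + g2 y *\<^sub>R e2) \<bullet> b)) * (b \<bullet> B.N y) \<partial>hyperplane_measure e2)" for b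
  proof (rule LIMSEQ_unique)
    have c: "continuous_on UNIV (\<lambda>x. f x * (n x \<bullet> b))" using f n by (auto intro!: continuous_intros)
    have z: "x \<notin> S \<Longrightarrow> f x * (n x \<bullet> b) = 0" for x by (simp add: S(2))
    show "(\<lambda>k. real (Suc k) * (\<integral>x. f x * (n x \<bullet> b) * (indicator \<Omega> (x - inverse (real (Suc k)) *\<^sub>R b) - indicator \<Omega> x) \<partial>lborel))
     \<longlonglongrightarrow> (\<integral>y. (f (y + g1 y *\<^sub>R e1) * (n (y + g1 y *\<^sub>R e1) \<bullet> b)) * (b \<bullet> A.N y) \<partial>hyperplane_measure e1)"
      by (rule A.flux_limit[OF c S(1) SU(1) z])
    show "(\<lambda>k. real (Suc k) * (\<integral>x. f x * (n x \<bullet> b) * (indicator \<Omega> (x - inverse (real (Suc k)) *\<^sub>R b) - indicator \<Omega> x) \<partial>lborel))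
     \<longlonglongrightarrow> (\<integral>y. (f (y + g2 y *\<^sub>R e2) * (n (y + g2 y *\<^sub>R e2) \<bullet> b)) * (b \<bullet> B.N y) \<partial>hyperplane_measure e2)"
      by (rule B.flux_limit[OF c S(1) SU(2) z])
  qed
  then have "(\<integral>y. f (y + g1 y *\<^sub>R e1) * norm (A.N y) \<partial>hyperplane_measure e1) = (\<integral>y. f (y + g2 y *\<^sub>R e2) * norm (B.N y) \<partial>hyperplane_measure e2)"
    using A.area_integral_as_flux[OF f(1) S n _ SU(1)] B.area_integral_as_flux[OF f(1) S n _ SU(2)] eq2
    by (simp add: n_def)
  then show ?thesis
    by (simp add: A.nn_integral_graph_area_continuous[OF f S SU(1)] B.nn_integral_graph_area_continuous[OF f S SU(2)])
qed

text \<open>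
The functions are cut off in terms of the distance to the complement of \<open>W \<inter> ball 0 k\<close>, which is never empty.
\<close>

lemma open_exhaustion_by_continuous:
  fixes W :: "'a::euclidean_space set"
  assumes "open W"
  obtains f :: "nat \<Rightarrow> 'a \<Rightarrow> real" where "\<And>k. continuous_on UNIV (f k)" "\<And>k x. f k x \<ge> 0"
    "\<And>k. \<exists>S. compact S \<and> S \<subseteq> W \<and> (\<forall>x. x \<notin> S \<longrightarrow> f k x = 0)"
    "\<And>k x. f k x \<le> f (Suc k) x" "\<And>x. (\<lambda>k. f k x) \<longlonglongrightarrow> indicator W x"
proof -
  define C where "C k = - (W \<inter> ball 0 (real k))" for k
  have Cc: "closed (C k)" for k using assms unfolding C_def by (intro closed_Compl open_Int open_ball)
  have Cn: "C k \<noteq> {}" for k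
  proof
    assume "C k = {}"
    then have "ball (0::'a) (real k) = UNIV" by (auto simp: C_def)
    then show False using not_bounded_UNIV bounded_ball by metis
  qed
  define d where "d k x = infdist x (C k)" for k x
  have dc: "continuous_on UNIV (d k)" for k unfolding d_def by (intro continuous_intros)
  have d0: "d k x \<ge> 0" for k x by (simp add: d_def infdist_nonneg)
  have dmono: "d k x \<le> d m x" if "k \<le> m" for k m x
    unfolding d_def using that by (intro infdist_mono Cn) (auto simp: C_def)
  define f where "f k x = min 1 (max 0 (real k * d k x - 1))" for k x
  show ?thesis
  proof (rule that[of f])
    show "continuous_on UNIV (f k)" for k unfolding f_def using dc by (intro continuous_intros)
    show "f k x \<ge> 0" for k x by (simp add: f_def)
    show "f k x \<le> f (Suc k) x" for k x
    proof -
      have "real k * d k x \<le> real (Suc k) * d (Suc k) x"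
        using dmono[of k "Suc k" x] d0 by (intro mult_mono) auto
      then show ?thesis by (auto simp: f_def)
    qed
    show "\<exists>S. compact S \<and> S \<subseteq> W \<and> (\<forall>x. x \<notin> S \<longrightarrow> f k x = 0)" for k
    proof (intro exI conjI allI impI)
      let ?S = "{x. 1 \<le> real k * d k x}"
      have sub: "?S \<subseteq> W \<inter> ball 0 (real k)"
      proof
        fix x assume "x \<in> ?S"
        then have "d k x \<noteq> 0" by auto
        then have "x \<notin> C k" by (auto simp: d_def)
        then show "x \<in> W \<inter> ball 0 (real k)" by (simp add: C_def)
      qed
      then show "?S \<subseteq> W" by auto
      have "closed ?S" using dc by (intro closed_Collect_le continuous_intros)
      moreover have "bounded ?S" using sub by (meson bounded_ball bounded_subset le_inf_iff)
      ultimately show "compact ?S" by (simp add: compact_eq_bounded_closed)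
      show "f k x = 0" if "x \<notin> ?S" for x using that by (auto simp: f_def)
    qed
    show "(\<lambda>k. f k x) \<longlonglongrightarrow> indicator W x" for x
    proof (cases "x \<in> W")
      case True
      obtain m where m: "norm x < real m" using reals_Archimedean2 by blast
      then have "x \<notin> C m" using True by (simp add: C_def)
      then have dm: "d m x > 0" using in_closed_iff_infdist_zero[OF Cc Cn, of x m] d0[of m x] by (simp add: d_def less_le)
      obtain p where p: "2 / d m x < real p" using reals_Archimedean2 by blast
      have "f k x = 1" if k: "k \<ge> max m p" for k
      proof -
        have "2 < real p * d m x" using p dm by (simp add: pos_divide_less_eq)
        also have "\<dots> \<le> real k * d k x" using k dmono[of m k x] d0 by (intro mult_mono) auto
        finally show ?thesis by (simp add: f_def)
      qed
      then have "eventually (\<lambda>k. f k x = 1) sequentially" 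
        unfolding eventually_sequentially by (intro exI[of _ "max m p"]) blast
      then show ?thesis using True by (simp add: tendsto_eventually)
    next
      case False
      then have "d k x = 0" for k by (simp add: d_def C_def)
      then show ?thesis using False by (simp add: f_def)
    qed
  qed
qed

lemma graph_areas_agree_open:
  fixes \<Omega> :: "(real^'n) set"
  assumes 1: "boundary_graph \<Omega> e1 g1 G1 U1" and 2: "boundary_graph \<Omega> e2 g2 G2 U2"
    and W: "open W" "W \<subseteq> U1 \<inter> U2"
  shows "emeasure (graph_area_measure e1 g1 G1 U1) W = emeasure (graph_area_measure e2 g2 G2 U2) W"
proof -
  interpret A: boundary_graph \<Omega> e1 g1 G1 U1 by (rule 1)
  interpret B: boundary_graph \<Omega> e2 g2 G2 U2 by (rule 2)
  obtain f :: "nat \<Rightarrow> real^'n \<Rightarrow> real" where f: "\<And>k. continuous_on UNIV (f k)" "\<And>k x. f k x \<ge> 0"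
    "\<And>k. \<exists>S. compact S \<and> S \<subseteq> W \<and> (\<forall>x. x \<notin> S \<longrightarrow> f k x = 0)"
    "\<And>k x. f k x \<le> f (Suc k) x" "\<And>x. (\<lambda>k. f k x) \<longlonglongrightarrow> indicator W x"
    using open_exhaustion_by_continuous[OF W(1)] by blast
  have fm[measurable]: "f k \<in> borel_measurable borel" for k by (rule borel_measurable_continuous_onI[OF f(1)])
  have eq: "(\<integral>\<^sup>+x. ennreal (f k x) \<partial>graph_area_measure e1 g1 G1 U1) = (\<integral>\<^sup>+x. ennreal (f k x) \<partial>graph_area_measure e2 g2 G2 U2)" for k
  proof -
    obtain S where S: "compact S" "S \<subseteq> W" "\<And>x. x \<notin> S \<Longrightarrow> f k x = 0" using f(3) by blast
    show ?thesis
      using S W by (intro area_integrals_agree[OF 1 2 f(1) f(2) S(1,3)]) auto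
  qed
  have lim: "(\<lambda>k. \<integral>\<^sup>+x. ennreal (f k x) \<partial>M) \<longlonglongrightarrow> emeasure M W" if [measurable_cong]: "sets M = sets borel" for M :: "(real^'n) measure"
  proof -
    have "(\<lambda>k. \<integral>\<^sup>+x. ennreal (f k x) \<partial>M) \<longlonglongrightarrow> (\<integral>\<^sup>+x. indicator W x \<partial>M)"
    proof (rule nn_integral_LIMSEQ)
      show "incseq (\<lambda>k x. ennreal (f k x))" using f(4) by (intro incseq_SucI le_funI ennreal_leI)
      show "(\<lambda>k. ennreal (f k x)) \<longlonglongrightarrow> indicator W x" for x
        using tendsto_ennrealI[OF f(5)[of x]] by (auto simp: indicator_def split: if_splits)
    qed simp
    then show ?thesis using W(1) by simp
  qed
  show ?thesis
    using lim[OF A.sets_graph_area] lim[OF B.sets_graph_area] LIMSEQ_unique unfolding eq by blast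
qed

lemma graph_areas_agree:
  fixes \<Omega> :: "(real^'n) set"
  assumes 1: "boundary_graph \<Omega> e1 g1 G1 U1" and 2: "boundary_graph \<Omega> e2 g2 G2 U2"
    and B: "B \<in> sets borel" "B \<subseteq> U1 \<inter> U2"
  shows "emeasure (graph_area_measure e1 g1 G1 U1) B = emeasure (graph_area_measure e2 g2 G2 U2) B"
proof -
  interpret A: boundary_graph \<Omega> e1 g1 G1 U1 by (rule 1)
  interpret B: boundary_graph \<Omega> e2 g2 G2 U2 by (rule 2)
  let ?W = "U1 \<inter> U2"
  let ?M = "density (graph_area_measure e1 g1 G1 U1) (indicator ?W)"
  let ?N = "density (graph_area_measure e2 g2 G2 U2) (indicator ?W)"
  have em: "emeasure ?M X = emeasure (graph_area_measure e1 g1 G1 U1) (?W \<inter> X)"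
    "emeasure ?N X = emeasure (graph_area_measure e2 g2 G2 U2) (?W \<inter> X)" if [measurable]: "X \<in> sets borel" for X
    by (subst emeasure_density; simp add: indicator_inter_arith[symmetric])+
  have opW: "open ?W" using A.open_U B.open_U by auto
  have "?M = ?N"
  proof (rule measure_eqI_generator_eq[of "{X. open X}" UNIV _ _ "\<lambda>k. ball 0 (real k)"])
    show "Int_stable {X::(real^'n) set. open X}" by (auto simp: Int_stable_def)
    show "emeasure ?M X = emeasure ?N X" if "X \<in> {X. open X}" for X
    proof -
      have "open X" using that by simp
      then have "open (?W \<inter> X)" using opW by auto
      then have "emeasure (graph_area_measure e1 g1 G1 U1) (?W \<inter> X) = emeasure (graph_area_measure e2 g2 G2 U2) (?W \<inter> X)"
        by (rule graph_areas_agree_open[OF 1 2]) auto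
      then show ?thesis using \<open>open X\<close> by (simp add: em)
    qed
    show "sets ?M = sigma_sets UNIV {X. open X}" "sets ?N = sigma_sets UNIV {X. open X}"
      by (simp_all add: borel_def)
    show "(\<Union>k. ball 0 (real k)) = UNIV" using reals_Archimedean2 by auto
    show "emeasure ?M (ball 0 (real k)) \<noteq> \<infinity>" for k
    proof -
      have "emeasure ?M (ball 0 (real k)) \<le> emeasure (graph_area_measure e1 g1 G1 U1) (ball 0 (real k))"
        by (subst em) (auto intro: emeasure_mono)
      then show ?thesis using A.emeasure_graph_area_bounded[of "ball 0 (real k)"] by (auto simp: less_top)
    qed
  qed auto
  moreover have "?W \<inter> B = B" using B(2) by auto
  ultimately show ?thesis using em[OF B(1)] by simp
qed

context boundary_graph begin

lemma graph_area_carrier: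
  assumes [measurable]: "B \<in> sets borel"
  shows "emeasure (graph_area_measure e g G U) B = emeasure (graph_area_measure e g G U) (B \<inter> U)"
proof -
  have *: "emeasure (graph_area_measure e g G U) X = (\<integral>\<^sup>+x. indicator X x \<partial>graph_area_measure e g G U)"
    if "X \<in> sets borel" for X using that by simp
  have [measurable]: "B \<inter> U \<in> sets borel" by simp
  show ?thesis
    by (subst (1 2) *, simp, simp, subst (1 2) nn_integral_graph_area, simp, simp, rule nn_integral_cong)
      (auto simp: indicator_def)
qed

text \<open>
The supremum is bounded below by the area measure of the given chart. An upper bound of the area measures of all
charts is obtained by giving the measure \<open>\<infinity>\<close> to every set that is not contained in \<open>U\<close>; on subsets of \<open>U\<close> the
two bounds coincide.
\<close>

lemma surface_measure_eq:
  assumes B: "B \<in> sets borel" "B \<subseteq> U"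
  shows "emeasure (surface_measure \<Omega>) B = emeasure (graph_area_measure e g G U) B"
    and sets_surface_measure: "sets (surface_measure \<Omega>) = sets borel"
proof -
  let ?C = "{graph_area_measure e g G U | e g G U. boundary_chart \<Omega> e g G U}"
  let ?m = "graph_area_measure e g G U"
  have mem: "?m \<in> ?C" using chart by blast
  have sp: "space M = UNIV" "sets M = sets borel" if "M \<in> ?C" for M
    using that by (auto simp: graph_area_measure_def)
  define f where "f A = (if A \<subseteq> U then emeasure ?m A else \<infinity>)" for A
  define \<nu> where "\<nu> = measure_of UNIV (sets borel) f"
  have \<nu>s: "sets \<nu> = sets borel" "space \<nu> = UNIV"
    by (simp_all add: \<nu>_def) (metis sets.sigma_sets_eq space_borel)
  have \<nu>e: "emeasure \<nu> A = f A" if "A \<in> sets borel" for A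
    unfolding \<nu>_def
  proof (rule emeasure_measure_of_sigma)
    show "sigma_algebra UNIV (sets borel)" by (metis sets.sigma_algebra_axioms space_borel)
    show "positive (sets borel) f" by (simp add: positive_def f_def)
    show "countably_additive (sets borel) f"
    proof (rule countably_additiveI)
      fix A :: "nat \<Rightarrow> (real^'n) set"
      assume A: "range A \<subseteq> sets borel" "disjoint_family A" "\<Union> (range A) \<in> sets borel"
      show "(\<Sum>i. f (A i)) = f (\<Union> (range A))"
      proof (cases "\<Union> (range A) \<subseteq> U")
        case True
        then have "f (A i) = emeasure ?m (A i)" for i by (auto simp: f_def)
        then show ?thesis using True A by (simp add: f_def suminf_emeasure)
      next
        case False
        then obtain j where "\<not> A j \<subseteq> U" by blast
        then have "f (A j) = \<infinity>" by (simp add: f_def)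
        moreover have "sum (\<lambda>i. f (A i)) {j} \<le> (\<Sum>i. f (A i))" by (rule sum_le_suminf) auto
        ultimately show ?thesis using False by (simp add: f_def top_unique)
      qed
    qed
  qed (use that in auto)
  have "M \<le> \<nu>" if Mem: "M \<in> ?C" for M
  proof -
    obtain e' g' G' U' where M: "M = graph_area_measure e' g' G' U'" "boundary_chart \<Omega> e' g' G' U'"
      using Mem by blast
    have b: "boundary_graph \<Omega> e' g' G' U'" by (rule boundary_graphI[OF M(2) open_Omega])
    interpret B: boundary_graph \<Omega> e' g' G' U' by (rule b)
    have "emeasure M A \<le> emeasure \<nu> A" if A: "A \<in> sets borel" for A
    proof (cases "A \<subseteq> U")
      case True
      have "emeasure M A = emeasure M (A \<inter> U')" using B.graph_area_carrier[OF A] M by simp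
      also have "\<dots> = emeasure ?m (A \<inter> U')"
        using True A unfolding M(1) by (intro graph_areas_agree[OF b boundary_graph_axioms]) auto
      also have "\<dots> \<le> emeasure ?m A" using A by (intro emeasure_mono) auto
      finally show ?thesis using True A by (simp add: \<nu>e f_def)
    qed (simp add: \<nu>e[OF A] f_def)
    then show ?thesis using sp[OF Mem] \<nu>s by (subst le_measure) auto
  qed
  then have "surface_measure \<Omega> \<le> \<nu>" unfolding surface_measure_def by (rule Sup_least)
  moreover have "?m \<le> surface_measure \<Omega>" unfolding surface_measure_def by (rule Sup_upper[OF mem])
  moreover show s: "sets (surface_measure \<Omega>) = sets borel"
  proof -
    have "sets (surface_measure \<Omega>) = sigma_sets UNIV (\<Union>M\<in>?C. sets M)"
      unfolding surface_measure_def using sp(1) mem by (intro sets_Sup_eq) blast+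
    also have "(\<Union>M\<in>?C. sets M) = sets borel" using sp(2) mem by blast
    also have "sigma_sets UNIV (sets borel) = sets borel" by (metis sets.sigma_sets_eq space_borel)
    finally show ?thesis .
  qed
  ultimately have "emeasure ?m B \<le> emeasure (surface_measure \<Omega>) B" "emeasure (surface_measure \<Omega>) B \<le> emeasure \<nu> B"
    using \<nu>s by (auto intro: le_measureD3)
  then show "emeasure (surface_measure \<Omega>) B = emeasure ?m B"
    using B by (simp add: \<nu>e f_def)
qed

end

text \<open>
Restricting the surface measure to the boundary turns the set integrals over \<open>frontier \<Omega>\<close> into plain integrals.
\<close>

definition boundary_measure :: "(real^'n) set \<Rightarrow> (real^'n) measure" where
  "boundary_measure \<Omega> = density (surface_measure \<Omega>) (indicator (frontier \<Omega>))"

context boundary_graph begin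

lemma sets_boundary_measure: "sets (boundary_measure \<Omega>) = sets borel"
  using sets_surface_measure[of "{}"] by (simp add: boundary_measure_def)

lemma emeasure_boundary_measure:
  assumes B: "B \<in> sets borel"
  shows "emeasure (boundary_measure \<Omega>) B = emeasure (surface_measure \<Omega>) (B \<inter> frontier \<Omega>)"
proof -
  have [measurable]: "frontier \<Omega> \<in> sets borel" by (simp add: frontier_closed borel_closed)
  have [measurable_cong]: "sets (surface_measure \<Omega>) = sets borel" using sets_surface_measure[of "{}"] by simp
  note B[measurable]
  show ?thesis unfolding boundary_measure_def
    by (subst emeasure_density) (simp_all add: indicator_inter_arith[symmetric] Int_commute)
qed

lemma nn_integral_boundary_measure:
  assumes u[measurable]: "u \<in> borel_measurable borel" and z: "\<And>x. x \<notin> U \<Longrightarrow> u x = 0"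
  shows "(\<integral>\<^sup>+x. u x \<partial>boundary_measure \<Omega>)
    = (\<integral>\<^sup>+y. u (lift y) * ennreal (norm (N y)) \<partial>H)"
proof -
  let ?m = "graph_area_measure e g G U" and ?s = "surface_measure \<Omega>"
  have F[measurable]: "frontier \<Omega> \<in> sets borel" by (simp add: frontier_closed borel_closed)
  have s[measurable_cong]: "sets ?s = sets borel" using sets_surface_measure[of "{}"] by simp
  have eq: "density ?s (indicator U) = density ?m (indicator U)"
  proof (rule measure_eqI)
    fix A assume "A \<in> sets (density ?s (indicator U))"
    then have [measurable]: "A \<in> sets borel" using s by simp
    show "emeasure (density ?s (indicator U)) A = emeasure (density ?m (indicator U)) A"
      using surface_measure_eq[of "U \<inter> A"]
      by (subst (1 2) emeasure_density) (simp_all add: indicator_inter_arith[symmetric])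
  qed (use s in simp)
  have "(\<integral>\<^sup>+x. u x \<partial>boundary_measure \<Omega>) = (\<integral>\<^sup>+x. indicator (frontier \<Omega>) x * u x \<partial>?s)"
    unfolding boundary_measure_def by (rule nn_integral_density) simp_all
  also have "\<dots> = (\<integral>\<^sup>+x. indicator U x * (indicator (frontier \<Omega>) x * u x) \<partial>?s)"
    by (rule nn_integral_cong) (auto simp: indicator_def z)
  also have "\<dots> = (\<integral>\<^sup>+x. indicator (frontier \<Omega>) x * u x \<partial>density ?s (indicator U))"
    by (rule nn_integral_density[symmetric]) simp_all
  also have "\<dots> = (\<integral>\<^sup>+x. indicator U x * (indicator (frontier \<Omega>) x * u x) \<partial>?m)"
    unfolding eq by (rule nn_integral_density) simp_all
  also have "\<dots> = (\<integral>\<^sup>+y. indicator U (lift y) * ennreal (norm (N y)) * (indicator U (lift y) * (indicator (frontier \<Omega>) (lift y) * u (lift y))) \<partial>H)"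
    by (rule nn_integral_graph_area) simp
  also have "\<dots> = (\<integral>\<^sup>+y. u (lift y) * ennreal (norm (N y)) \<partial>H)"
  proof (rule nn_integral_cong_AE, rule AE_mp[OF AE_e], rule AE_I2, rule impI)
    fix y assume "y \<bullet> e = 0"
    then show "indicator U (lift y) * ennreal (norm (N y)) * (indicator U (lift y) * (indicator (frontier \<Omega>) (lift y) * u (lift y)))
       = u (lift y) * ennreal (norm (N y))"
      using graph_point(4) z by (cases "lift y \<in> U") (auto simp: mult.commute)
  qed
  finally show ?thesis .
qed

lemma boundary_measure_eq_distr:
  "density (boundary_measure \<Omega>) (indicator U)
    = distr (density H (\<lambda>y. indicator U (lift y) * ennreal (norm (N y)))) borel (\<lambda>y. lift y)"
  (is "?L = ?R")
proof (rule measure_eqI)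
  have s[measurable_cong]: "sets (boundary_measure \<Omega>) = sets borel" by (rule sets_boundary_measure)
  show "sets ?L = sets ?R" using s by simp
  fix A assume "A \<in> sets ?L"
  then have [measurable]: "A \<in> sets borel" using s by simp
  have "emeasure ?L A = (\<integral>\<^sup>+x. indicator U x * indicator A x \<partial>boundary_measure \<Omega>)"
    by (subst emeasure_density) simp_all
  also have "\<dots> = (\<integral>\<^sup>+y. indicator U (lift y) * indicator A (lift y) * ennreal (norm (N y)) \<partial>H)"
    by (rule nn_integral_boundary_measure) simp_all
  also have "\<dots> = (\<integral>\<^sup>+x. indicator A x \<partial>?R)"
    by (subst nn_integral_distr, simp, simp, subst nn_integral_density, simp, simp) (simp add: mult_ac)
  finally show "emeasure ?L A = emeasure ?R A" by simp
qed

lemma integral_boundary_measure: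
  fixes u :: "real^'n \<Rightarrow> real"
  assumes u[measurable]: "u \<in> borel_measurable borel" and z: "\<And>x. x \<notin> U \<Longrightarrow> u x = 0"
  shows "(\<integral>x. u x \<partial>boundary_measure \<Omega>)
    = (\<integral>y. u (lift y) * norm (N y) \<partial>H)"
proof -
  have s[measurable_cong]: "sets (boundary_measure \<Omega>) = sets borel" by (rule sets_boundary_measure)
  have "(\<integral>x. u x \<partial>boundary_measure \<Omega>) = (\<integral>x. indicator U x *\<^sub>R u x \<partial>boundary_measure \<Omega>)"
    by (rule Bochner_Integration.integral_cong) (auto simp: indicator_def z)
  also have "\<dots> = (\<integral>x. u x \<partial>density (boundary_measure \<Omega>) (\<lambda>x. ennreal (indicator U x)))"
    by (rule integral_density[symmetric]) auto
  also have "(\<lambda>x. ennreal (indicator U x)) = indicator U" by (auto simp: indicator_def fun_eq_iff)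
  also have "(\<integral>x. u x \<partial>density (boundary_measure \<Omega>) (indicator U))
    = (\<integral>y. u (lift y) \<partial>density H (\<lambda>y. indicator U (lift y) * ennreal (norm (N y))))"
    unfolding boundary_measure_eq_distr by (subst integral_distr) simp_all
  also have "(\<lambda>y. indicator U (lift y) * ennreal (norm (N y))) = (\<lambda>y. ennreal (indicator U (lift y) * norm (N y)))"
    by (auto simp: indicator_def fun_eq_iff)
  also have "(\<integral>y. u (lift y) \<partial>density H (\<lambda>y. ennreal (indicator U (lift y) * norm (N y))))
     = (\<integral>y. (indicator U (lift y) * norm (N y)) *\<^sub>R u (lift y) \<partial>H)"
    by (rule integral_density) auto
  also have "\<dots> = (\<integral>y. u (lift y) * norm (N y) \<partial>H)"
    by (rule Bochner_Integration.integral_cong) (auto simp: indicator_def z)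
  finally show ?thesis .
qed

end

lemma set_lebesgue_boundary:
  fixes u :: "real^'n \<Rightarrow> real"
  assumes s: "sets (surface_measure \<Omega>) = sets borel" and u: "u \<in> borel_measurable borel"
  shows "set_integrable (surface_measure \<Omega>) (frontier \<Omega>) u \<longleftrightarrow> integrable (boundary_measure \<Omega>) u"
    "(LINT x:frontier \<Omega>|surface_measure \<Omega>. u x) = (LINT x|boundary_measure \<Omega>. u x)"
proof -
  have [measurable]: "frontier \<Omega> \<in> sets borel" by (simp add: frontier_closed borel_closed)
  note s[measurable_cong] u[measurable]
  have e: "boundary_measure \<Omega> = density (surface_measure \<Omega>) (\<lambda>x. ennreal (indicator (frontier \<Omega>) x))"
    unfolding boundary_measure_def by (rule arg_cong[where f="density _"]) (auto simp: indicator_def fun_eq_iff)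
  show "set_integrable (surface_measure \<Omega>) (frontier \<Omega>) u \<longleftrightarrow> integrable (boundary_measure \<Omega>) u"
    unfolding e set_integrable_def by (subst integrable_density) auto
  show "(LINT x:frontier \<Omega>|surface_measure \<Omega>. u x) = (LINT x|boundary_measure \<Omega>. u x)"
    unfolding e set_lebesgue_integral_def by (subst integral_density) auto
qed

section \<open>The kernel near the boundary\<close>

text \<open>
The derivative of \<open>\<lambda>\<xi>. heat_kernel (x - \<xi>) \<sigma>\<close> in direction \<open>n\<close>, at \<open>z = x - \<xi>\<close>. It is used with unit
normals, with the vectors \<open>N\<close>, and with gradients as \<open>n\<close>.
\<close>

definition normal_kernel :: "real^'n \<Rightarrow> real^'n \<Rightarrow> real \<Rightarrow> real" where
  "normal_kernel n z \<sigma> = heat_kernel z \<sigma> * (z \<bullet> n) / (2 * \<sigma>)"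

lemma heat_kernel_nonneg [simp]: "heat_kernel z \<sigma> \<ge> 0"
  by (simp add: heat_kernel_def)

lemma heat_kernel_nonpos [simp]: "\<sigma> \<le> 0 \<Longrightarrow> heat_kernel z \<sigma> = 0" "\<sigma> \<le> 0 \<Longrightarrow> normal_kernel n z \<sigma> = 0"
  by (simp_all add: heat_kernel_def normal_kernel_def)

lemma heat_kernel_measurable [measurable]:
  assumes [measurable]: "f \<in> borel_measurable M" "g \<in> borel_measurable M"
  shows "(\<lambda>x. heat_kernel (f x :: real^'n) (g x)) \<in> borel_measurable M"
  unfolding heat_kernel_def by measurable

lemma normal_kernel_measurable [measurable]:
  assumes [measurable]: "f \<in> borel_measurable M" "g \<in> borel_measurable M" "h \<in> borel_measurable M"
  shows "(\<lambda>x. normal_kernel (h x) (f x :: real^'n) (g x)) \<in> borel_measurable M"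
  unfolding normal_kernel_def by measurable

lemma heat_kernel_tendsto:
  assumes "(f \<longlongrightarrow> z) F" "(g \<longlongrightarrow> \<sigma>) F" "\<sigma> > 0"
  shows "((\<lambda>x. heat_kernel (f x :: real^'n) (g x)) \<longlongrightarrow> heat_kernel z \<sigma>) F"
proof -
  have "eventually (\<lambda>x. g x > 0) F" using assms(2,3) by (rule order_tendstoD)
  then have "eventually (\<lambda>x. (4 * pi * g x) powr (- real CARD('n) / 2) * exp (- (norm (f x))\<^sup>2 / (4 * g x)) = heat_kernel (f x) (g x)) F"
    by eventually_elim (simp add: heat_kernel_def)
  moreover have "((\<lambda>x. (4 * pi * g x) powr (- real CARD('n) / 2) * exp (- (norm (f x))\<^sup>2 / (4 * g x)))
     \<longlongrightarrow> (4 * pi * \<sigma>) powr (- real CARD('n) / 2) * exp (- (norm z)\<^sup>2 / (4 * \<sigma>))) F"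
    using assms by (intro tendsto_intros) auto
  ultimately show ?thesis using assms(3) by (auto simp: heat_kernel_def elim: Lim_transform_eventually[rotated])
qed

lemma normal_kernel_tendsto:
  assumes "(f \<longlongrightarrow> z) F" "(g \<longlongrightarrow> \<sigma>) F" "\<sigma> > 0" "(h \<longlongrightarrow> n) F"
  shows "((\<lambda>x. normal_kernel (h x) (f x :: real^'n) (g x)) \<longlongrightarrow> normal_kernel n z \<sigma>) F"
  unfolding normal_kernel_def using assms by (intro tendsto_intros heat_kernel_tendsto) auto

lemma normal_derivative_heat_kernel:
  "normal_derivative \<Omega> (\<lambda>\<eta>. heat_kernel (x - \<eta>) \<sigma>) \<xi> = normal_kernel (outward_normal \<Omega> \<xi>) (x - \<xi> :: real^'n) \<sigma>"
proof (cases "\<sigma> > 0")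
  case False
  then show ?thesis by (simp add: normal_derivative_def)
next
  case True
  define n where "n = outward_normal \<Omega> \<xi>"
  define z where "z = x - \<xi>"
  have "(norm (x - (\<xi> + s *\<^sub>R n)))\<^sup>2 = z \<bullet> z - 2 * s * (z \<bullet> n) + s\<^sup>2 * (n \<bullet> n)" for s
    unfolding power2_norm_eq_inner z_def
    by (simp add: inner_diff_left inner_diff_right inner_add_left inner_add_right inner_commute power2_eq_square algebra_simps)
  then have "(\<lambda>s. heat_kernel (x - (\<xi> + s *\<^sub>R n)) \<sigma>)
     = (\<lambda>s. (4 * pi * \<sigma>) powr (- real CARD('n) / 2) * exp (- (z \<bullet> z - 2 * s * (z \<bullet> n) + s\<^sup>2 * (n \<bullet> n)) / (4 * \<sigma>)))"
    using True by (auto simp: heat_kernel_def fun_eq_iff)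
  moreover have "((\<lambda>s. (4 * pi * \<sigma>) powr (- real CARD('n) / 2) * exp (- (z \<bullet> z - 2 * s * (z \<bullet> n) + s\<^sup>2 * (n \<bullet> n)) / (4 * \<sigma>)))
     has_real_derivative (4 * pi * \<sigma>) powr (- real CARD('n) / 2) * (exp (- (z \<bullet> z) / (4 * \<sigma>)) * ((z \<bullet> n) / (2 * \<sigma>)))) (at 0)"
    using True by (auto intro!: derivative_eq_intros simp: field_simps)
  ultimately have "((\<lambda>s. heat_kernel (x - (\<xi> + s *\<^sub>R n)) \<sigma>) has_real_derivative
     (4 * pi * \<sigma>) powr (- real CARD('n) / 2) * (exp (- (z \<bullet> z) / (4 * \<sigma>)) * ((z \<bullet> n) / (2 * \<sigma>)))) (at 0)" by simp
  then have "deriv (\<lambda>s. heat_kernel (x - (\<xi> + s *\<^sub>R n)) \<sigma>) 0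
     = (4 * pi * \<sigma>) powr (- real CARD('n) / 2) * (exp (- (z \<bullet> z) / (4 * \<sigma>)) * ((z \<bullet> n) / (2 * \<sigma>)))"
    by (rule DERIV_imp_deriv)
  then show ?thesis using True
    by (simp add: normal_derivative_def normal_kernel_def heat_kernel_def n_def[symmetric] z_def[symmetric] power2_norm_eq_inner)
qed

lemma powr_times_exp_bound:
  fixes p u :: real
  assumes "p > 0" "u \<ge> 0"
  shows "u powr p * exp (- u) \<le> p powr p"
proof -
  have "u / p \<le> exp (u / p)" using exp_ge_add_one_self[of "u / p"] by linarith
  then have "(u / p) powr p \<le> exp (u / p) powr p" using assms by (intro powr_mono2) auto
  also have "\<dots> = exp u" using assms by (simp add: powr_def)
  finally have "u powr p \<le> p powr p * exp u" using assms by (simp add: powr_divide pos_divide_le_eq mult.commute)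
  then have "u powr p * exp (- u) \<le> p powr p * exp u * exp (- u)" by (intro mult_right_mono) auto
  then show ?thesis by (simp add: mult.assoc exp_add[symmetric])
qed

text \<open>
The gradient of the heat kernel is singular only at \<open>z = 0\<close>, \<open>\<sigma> = 0\<close>. For \<open>norm z\<close> bounded below, the powers of
\<open>\<sigma>\<close> are expressed by \<open>u = (norm z)\<^sup>2 / (4 \<sigma>)\<close> and absorbed by \<open>exp (- u)\<close>; for \<open>\<sigma>\<close> bounded below, the factor
\<open>norm z\<close> is absorbed by the exponential function.
\<close>

lemma heat_gradient_bounded_far:
  assumes \<delta>: "\<delta> > 0"
  obtains C where "C > 0" "\<And>(z::real^'n) \<sigma>. \<delta> \<le> norm z \<or> \<delta> \<le> \<sigma> \<Longrightarrow> heat_kernel z \<sigma> * norm z / (2 * \<sigma>) \<le> C"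
proof -
  define m where "m = real CARD('n)"
  define p where "p = m / 2 + 1"
  have p: "p > 0" by (simp add: p_def m_def add_nonneg_pos)
  define A where "A = (4 * pi) powr (- m / 2) / 2"
  have A: "A > 0" by (simp add: A_def)
  define C1 where "C1 = A * (4 powr p * p powr p / \<delta> powr (2 * p - 1))"
  define C2 where "C2 = A * (2 * \<delta> powr (1 / 2 - p))"
  have rew: "heat_kernel z \<sigma> * norm z / (2 * \<sigma>) = A * (norm z * (\<sigma> powr (- p) * exp (- (norm z)\<^sup>2 / (4 * \<sigma>))))"
    if "\<sigma> > 0" for z :: "real^'n" and \<sigma>
  proof -
    have "- p = - m / 2 + - 1" by (simp add: p_def)
    then have "\<sigma> powr (- p) = \<sigma> powr (- m / 2) * \<sigma> powr (- 1)" by (simp only: powr_add)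
    then have "\<sigma> powr (- p) = \<sigma> powr (- m / 2) / \<sigma>" using that by (simp add: powr_neg_one)
    then show ?thesis using that
      by (simp add: heat_kernel_def A_def m_def powr_mult field_simps)
  qed
  have b1: "heat_kernel z \<sigma> * norm z / (2 * \<sigma>) \<le> C1" if s: "\<sigma> > 0" and z: "\<delta> \<le> norm z" for z :: "real^'n" and \<sigma>
  proof -
    define u where "u = (norm z)\<^sup>2 / (4 * \<sigma>)"
    have nz: "norm z > 0" using z \<delta> by linarith
    have u: "u > 0" using s nz unfolding u_def by (intro divide_pos_pos) auto
    have \<sigma>: "\<sigma> = (norm z)\<^sup>2 / (4 * u)" using s nz by (simp add: u_def)
    have "\<sigma> powr (- p) = 4 powr p * u powr p / norm z powr (2 * p)"
    proof -
      have "(norm z)\<^sup>2 powr p = norm z powr (2 * p)" using nz by (simp add: powr_powr flip: powr_numeral)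
      then show ?thesis using nz u by (subst \<sigma>) (simp add: powr_minus_divide powr_divide powr_mult)
    qed
    then have "norm z * (\<sigma> powr (- p) * exp (- (norm z)\<^sup>2 / (4 * \<sigma>))) = (norm z / norm z powr (2 * p)) * (4 powr p * (u powr p * exp (- u)))"
      by (simp add: u_def)
    also have "\<dots> \<le> (norm z / norm z powr (2 * p)) * (4 powr p * p powr p)"
      using powr_times_exp_bound[OF p less_imp_le[OF u]] by (intro mult_left_mono) auto
    also have "norm z / norm z powr (2 * p) = 1 / norm z powr (2 * p - 1)"
      using nz by (simp add: powr_diff field_simps)
    also have "1 / norm z powr (2 * p - 1) * (4 powr p * p powr p) \<le> 1 / \<delta> powr (2 * p - 1) * (4 powr p * p powr p)"
      using \<delta> z by (intro mult_right_mono divide_left_mono powr_mono2 mult_pos_pos) (auto simp: p_def m_def)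
    finally show ?thesis unfolding rew[OF s] C1_def using A by (intro mult_left_mono) auto
  qed
  have b2: "heat_kernel z \<sigma> * norm z / (2 * \<sigma>) \<le> C2" if s: "\<delta> \<le> \<sigma>" for z :: "real^'n" and \<sigma>
  proof -
    have s0: "\<sigma> > 0" using s \<delta> by linarith
    define w where "w = norm z / (2 * sqrt \<sigma>)"
    have w: "w \<ge> 0" "norm z = 2 * sqrt \<sigma> * w" "(norm z)\<^sup>2 / (4 * \<sigma>) = w\<^sup>2"
      using s0 by (simp_all add: w_def power_divide power_mult_distrib)
    have "w \<le> exp (w\<^sup>2)"
    proof -
      have "0 \<le> (w - 1/2)\<^sup>2" by simp
      then have "w \<le> 1 + w\<^sup>2" by (simp add: power2_eq_square algebra_simps)
      then show ?thesis using exp_ge_add_one_self[of "w\<^sup>2"] by linarith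
    qed
    then have we: "w * exp (- w\<^sup>2) \<le> 1" by (simp add: exp_minus field_simps)
    have "norm z * (\<sigma> powr (- p) * exp (- (norm z)\<^sup>2 / (4 * \<sigma>))) = 2 * (sqrt \<sigma> * \<sigma> powr (- p)) * (w * exp (- w\<^sup>2))"
      using w(2,3) by simp
    also have "\<dots> \<le> 2 * (sqrt \<sigma> * \<sigma> powr (- p)) * 1" using we s0 by (intro mult_left_mono) auto
    also have "sqrt \<sigma> * \<sigma> powr (- p) = \<sigma> powr (1 / 2 - p)" using s0 by (simp add: powr_half_sqrt[symmetric] powr_add[symmetric])
    also have "2 * \<sigma> powr (1 / 2 - p) * 1 \<le> 2 * \<delta> powr (1 / 2 - p)"
    proof -
      have "\<sigma> powr (1 / 2 - p) \<le> \<delta> powr (1 / 2 - p)" using \<delta> s by (intro powr_mono2') (auto simp: p_def m_def)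
      then show ?thesis by simp
    qed
    finally show ?thesis unfolding rew[OF s0] C2_def using A by (intro mult_left_mono) auto
  qed
  show ?thesis
  proof (rule that[of "max C1 C2 + 1"])
    have "C1 \<ge> 0" using A by (simp add: C1_def)
    then show "max C1 C2 + 1 > 0" by linarith
    show "heat_kernel z \<sigma> * norm z / (2 * \<sigma>) \<le> max C1 C2 + 1" if d: "\<delta> \<le> norm z \<or> \<delta> \<le> \<sigma>" for z :: "real^'n" and \<sigma>
    proof (cases "\<sigma> > 0")
      case True
      then show ?thesis using d b1[of \<sigma> z] b2[of \<sigma> z] by linarith
    next
      case False
      then show ?thesis using \<open>C1 \<ge> 0\<close> by simp
    qed
  qed
qed

lemma abs_normal_kernel_le:
  assumes "norm n \<le> 1"
  shows "\<bar>normal_kernel n z \<sigma>\<bar> \<le> heat_kernel z \<sigma> * norm z / (2 * \<sigma>)"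
proof (cases "\<sigma> > 0")
  case True
  have "\<bar>z \<bullet> n\<bar> \<le> norm z * norm n" by (rule Cauchy_Schwarz_ineq2)
  also have "\<dots> \<le> norm z" using assms by (simp add: mult_left_le)
  finally have "heat_kernel z \<sigma> * \<bar>z \<bullet> n\<bar> \<le> heat_kernel z \<sigma> * norm z" by (intro mult_left_mono) auto
  then show ?thesis using True by (simp add: normal_kernel_def abs_mult divide_right_mono)
qed simp

lemma nn_integral_powr_Ioo:
  assumes "p > 0" "S \<ge> 0"
  shows "(\<integral>\<^sup>+\<sigma>. ennreal (\<sigma> powr (p - 1)) * indicator {0<..<S} \<sigma> \<partial>lborel) \<le> ennreal (S powr p / p)"
proof -
  have "((\<lambda>\<sigma>. \<sigma> powr (p - 1)) has_integral (S powr (p - 1 + 1) / (p - 1 + 1))) {0..S}"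
    using assms by (intro has_integral_powr_from_0) auto
  then have "(\<integral>\<^sup>+\<sigma>. ennreal (\<sigma> powr (p - 1)) * indicator {0..S} \<sigma> \<partial>lborel) = ennreal (S powr p / p)"
    by (subst nn_integral_has_integral_lebesgue') auto
  moreover have "(\<integral>\<^sup>+\<sigma>. ennreal (\<sigma> powr (p - 1)) * indicator {0<..<S} \<sigma> \<partial>lborel) \<le> (\<integral>\<^sup>+\<sigma>. ennreal (\<sigma> powr (p - 1)) * indicator {0..S} \<sigma> \<partial>lborel)"
    by (intro nn_integral_mono) (auto simp: indicator_def)
  ultimately show ?thesis by simp
qed

text \<open>
The integral is invariant under the scaling \<open>\<sigma> = d\<^sup>2 s\<close>, so the bound does not involve \<open>d\<close>. It is split at
\<open>\<sigma> = d\<^sup>2\<close>: below, the exponential function is at most \<open>\<sigma> / (\<kappa> d\<^sup>2)\<close>; above, it is at most \<open>1\<close>.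
\<close>

lemma nn_integral_distance_kernel:
  assumes k: "\<kappa> > 0" and d: "d \<ge> 0"
  shows "(\<integral>\<^sup>+\<sigma>. ennreal (d * \<sigma> powr (- 3 / 2) * exp (- \<kappa> * d\<^sup>2 / \<sigma>)) * indicator {0<..} \<sigma> \<partial>lborel) \<le> ennreal (2 / \<kappa> + 2)"
proof (cases "d = 0")
  case False
  then have d: "d > 0" using d by simp
  have pw: "ennreal (d * \<sigma> powr (- 3 / 2) * exp (- \<kappa> * d\<^sup>2 / \<sigma>)) * indicator {0<..} \<sigma>
     \<le> ennreal (\<sigma> powr (- 1 / 2) / (\<kappa> * d)) * indicator {0..d\<^sup>2} \<sigma> + ennreal (d * \<sigma> powr (- 3 / 2)) * indicator {d\<^sup>2..} \<sigma>" for \<sigma>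
  proof (cases "\<sigma> > 0")
    case True
    show ?thesis
    proof (cases "\<sigma> \<le> d\<^sup>2")
      case le: True
      define u where "u = \<kappa> * d\<^sup>2 / \<sigma>"
      have u: "u > 0" using True d k by (simp add: u_def)
      have "u \<le> exp u" using exp_ge_add_one_self[of u] by linarith
      then have "u * exp (- u) \<le> 1" by (simp add: exp_minus field_simps)
      then have "exp (- u) \<le> 1 / u" using u by (simp add: field_simps)
      then have "d * \<sigma> powr (- 3 / 2) * exp (- \<kappa> * d\<^sup>2 / \<sigma>) \<le> d * \<sigma> powr (- 3 / 2) * (1 / u)"
        using d by (intro mult_left_mono) (auto simp: u_def)
      also have "\<dots> = (\<sigma> powr (- 3 / 2) * \<sigma>) / (\<kappa> * d)" using True d k by (simp add: u_def power2_eq_square field_simps)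
      also have "\<sigma> powr (- 3 / 2) * \<sigma> = \<sigma> powr (- 1 / 2)" using True powr_add[of \<sigma> "- 3 / 2" 1] by simp
      finally have "ennreal (d * \<sigma> powr (- 3 / 2) * exp (- \<kappa> * d\<^sup>2 / \<sigma>)) \<le> ennreal (\<sigma> powr (- 1 / 2) / (\<kappa> * d))"
        by (rule ennreal_leI)
      then show ?thesis using True le by (simp add: add_increasing2)
    next
      case False
      have "d * \<sigma> powr (- 3 / 2) * exp (- \<kappa> * d\<^sup>2 / \<sigma>) \<le> d * \<sigma> powr (- 3 / 2) * 1"
        using d k True by (intro mult_left_mono) auto
      then show ?thesis using False by (auto simp: indicator_def intro: ennreal_leI)
    qed
  qed simp
  have "((\<lambda>\<sigma>. \<sigma> powr (- 1 / 2)) has_integral ((d\<^sup>2) powr (- 1 / 2 + 1) / (- 1 / 2 + 1))) {0..d\<^sup>2}"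
    by (intro has_integral_powr_from_0) auto
  then have "((\<lambda>\<sigma>. \<sigma> powr (- 1 / 2) / (\<kappa> * d)) has_integral ((d\<^sup>2) powr (- 1 / 2 + 1) / (- 1 / 2 + 1)) / (\<kappa> * d)) {0..d\<^sup>2}"
    by (rule has_integral_divide)
  then have "(\<integral>\<^sup>+\<sigma>. ennreal (\<sigma> powr (- 1 / 2) / (\<kappa> * d)) * indicator {0..d\<^sup>2} \<sigma> \<partial>lborel) = ennreal (((d\<^sup>2) powr (- 1 / 2 + 1) / (- 1 / 2 + 1)) / (\<kappa> * d))"
    using d k by (intro nn_integral_has_integral_lebesgue') auto
  also have "((d\<^sup>2) powr (- 1 / 2 + 1) / (- 1 / 2 + 1)) / (\<kappa> * d) = 2 / \<kappa>"
    using d by (simp add: powr_half_sqrt real_sqrt_abs field_simps)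
  finally have i1: "(\<integral>\<^sup>+\<sigma>. ennreal (\<sigma> powr (- 1 / 2) / (\<kappa> * d)) * indicator {0..d\<^sup>2} \<sigma> \<partial>lborel) = ennreal (2 / \<kappa>)" .
  have "((\<lambda>\<sigma>. \<sigma> powr (- 3 / 2)) has_integral - ((d\<^sup>2) powr (- 3 / 2 + 1)) / (- 3 / 2 + 1)) {d\<^sup>2..}"
    using d by (intro has_integral_powr_to_inf) auto
  then have "((\<lambda>\<sigma>. d * \<sigma> powr (- 3 / 2)) has_integral d * (- ((d\<^sup>2) powr (- 3 / 2 + 1)) / (- 3 / 2 + 1))) {d\<^sup>2..}"
    by (rule has_integral_mult_right)
  then have "(\<integral>\<^sup>+\<sigma>. ennreal (d * \<sigma> powr (- 3 / 2)) * indicator {d\<^sup>2..} \<sigma> \<partial>lborel) = ennreal (d * (- ((d\<^sup>2) powr (- 3 / 2 + 1)) / (- 3 / 2 + 1)))"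
    using d by (intro nn_integral_has_integral_lebesgue') auto
  also have "d * (- ((d\<^sup>2) powr (- 3 / 2 + 1)) / (- 3 / 2 + 1)) = 2"
    using d by (simp add: powr_minus_divide powr_half_sqrt real_sqrt_abs field_simps)
  finally have i2: "(\<integral>\<^sup>+\<sigma>. ennreal (d * \<sigma> powr (- 3 / 2)) * indicator {d\<^sup>2..} \<sigma> \<partial>lborel) = ennreal 2" .
  have "(\<integral>\<^sup>+\<sigma>. ennreal (d * \<sigma> powr (- 3 / 2) * exp (- \<kappa> * d\<^sup>2 / \<sigma>)) * indicator {0<..} \<sigma> \<partial>lborel)
    \<le> (\<integral>\<^sup>+\<sigma>. (ennreal (\<sigma> powr (- 1 / 2) / (\<kappa> * d)) * indicator {0..d\<^sup>2} \<sigma> + ennreal (d * \<sigma> powr (- 3 / 2)) * indicator {d\<^sup>2..} \<sigma>) \<partial>lborel)"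
    by (intro nn_integral_mono pw)
  also have "\<dots> = ennreal (2 / \<kappa>) + ennreal 2"
    by (subst nn_integral_add, simp, simp, simp only: i1 i2)
  also have "\<dots> = ennreal (2 / \<kappa> + 2)" using k by (simp add: ennreal_plus)
  finally show ?thesis .
qed simp

text \<open>
The total mass of the kernel at \<open>x\<close>, over times up to \<open>T\<close> and the part of the boundary in \<open>ball x0 r\<close>.
\<close>

abbreviation near_mass :: "(real^'n) measure \<Rightarrow> (real^'n \<Rightarrow> real^'n) \<Rightarrow> real^'n \<Rightarrow> real \<Rightarrow> real \<Rightarrow> real^'n \<Rightarrow> ennreal" where
  "near_mass \<mu> n x0 r T x \<equiv>
    (\<integral>\<^sup>+\<sigma>. (\<integral>\<^sup>+\<xi>. indicator (ball x0 r) \<xi> * ennreal \<bar>normal_kernel (n \<xi>) (x - \<xi>) \<sigma>\<bar> \<partial>\<mu>)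
       * indicator {0<..<T} \<sigma> \<partial>lborel)"

context boundary_graph begin

text \<open>
The component of \<open>x - lift y\<close> along \<open>N y\<close> is the vertical distance of \<open>x\<close> from the graph plus the error of the
first order Taylor expansion of \<open>g\<close> at \<open>y\<close>, and the latter is controlled by the Hoelder continuity of the gradient.
\<close>

lemma normal_component_bound:
  assumes C: "\<And>x y. norm (G x - G y) \<le> C * dist x y powr \<alpha>" "C \<ge> 0" and \<alpha>: "\<alpha> > 0" and y: "y \<bullet> e = 0"
  shows "\<bar>(x - (lift y)) \<bullet> N y\<bar> \<le> \<bar>x \<bullet> e - g x\<bar> + C * norm (y - (x - (x \<bullet> e) *\<^sub>R e)) powr (1 + \<alpha>)"
proof -
  define p where "p = x - (x \<bullet> e) *\<^sub>R e"
  define \<rho> where "\<rho> = norm (y - p)"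
  have gp: "g p = g x" using g_shift[of x "- (x \<bullet> e)"] by (simp add: p_def)
  have pe: "p \<bullet> e = 0" by (simp add: p_def inner_diff_left)
  have dec: "x - (lift y) = (p - y) + (x \<bullet> e - g y) *\<^sub>R e" by (simp add: p_def algebra_simps)
  have "(x - (lift y)) \<bullet> N y = (x \<bullet> e - g x) + (g p - g y - (p - y) \<bullet> G y)"
    unfolding dec using y pe by (simp add: gp inner_diff_left inner_diff_right inner_add_left)
  moreover have "norm ((g p - p \<bullet> G y) - (g y - y \<bullet> G y)) \<le> (C * \<rho> powr \<alpha>) * norm (p - y)"
  proof (rule differentiable_bound[of "closed_segment y p"])
    fix z assume z: "z \<in> closed_segment y p"
    have "norm (z - y) \<le> norm (p - y)" by (rule segment_bound(1)[OF z])
    then have zy: "dist z y \<le> \<rho>" by (simp add: dist_norm \<rho>_def norm_minus_commute)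
    show "((\<lambda>z. g z - z \<bullet> G y) has_derivative (\<lambda>h. h \<bullet> (G z - G y))) (at z within closed_segment y p)"
      by (rule has_derivative_at_withinI) (auto intro!: derivative_eq_intros g_deriv simp: inner_diff_right)
    show "onorm (\<lambda>h. h \<bullet> (G z - G y)) \<le> C * \<rho> powr \<alpha>"
    proof (rule onorm_le)
      fix h
      have "\<bar>h \<bullet> (G z - G y)\<bar> \<le> norm h * norm (G z - G y)" by (rule Cauchy_Schwarz_ineq2)
      also have "\<dots> \<le> norm h * (C * \<rho> powr \<alpha>)"
        using C(1)[of z y] C(2) powr_mono2[OF less_imp_le[OF \<alpha>] zero_le_dist zy]
        by (intro mult_left_mono) (auto intro: order_trans mult_left_mono)
      finally show "norm (h \<bullet> (G z - G y)) \<le> C * \<rho> powr \<alpha> * norm h" by (simp add: mult.commute)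
    qed
  qed auto
  moreover have "norm (p - y) = \<rho>" by (simp add: \<rho>_def norm_minus_commute)
  moreover have "\<rho> powr \<alpha> * \<rho> = \<rho> powr (1 + \<alpha>)"
    by (cases "\<rho> = 0") (auto simp: powr_add \<rho>_def)
  ultimately show ?thesis unfolding p_def[symmetric] \<rho>_def[symmetric]
    by (simp add: inner_diff_left mult.assoc)
qed

text \<open>
Since \<open>g\<close> is Lipschitz on bounded sets, the distance from \<open>x\<close> to a point of the graph dominates both the horizontal
distance and the vertical distance of \<open>x\<close> from the graph.
\<close>

lemma distance_to_graph_bound:
  assumes L: "\<And>x. norm x \<le> R \<Longrightarrow> norm (G x) \<le> L" "L \<ge> 0" and y: "y \<bullet> e = 0" "norm y \<le> R" and x: "norm x \<le> R"
  shows "((norm (y - (x - (x \<bullet> e) *\<^sub>R e)))\<^sup>2 + (x \<bullet> e - g x)\<^sup>2) / (4 * (L\<^sup>2 + 1)) \<le> (norm (x - (lift y)))\<^sup>2"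
proof -
  define p where "p = x - (x \<bullet> e) *\<^sub>R e"
  define \<rho> where "\<rho> = norm (y - p)"
  define d where "d = x \<bullet> e - g x"
  define \<delta> where "\<delta> = g x - g y"
  have gp: "g p = g x" using g_shift[of x "- (x \<bullet> e)"] by (simp add: p_def)
  have pe: "p \<bullet> e = 0" by (simp add: p_def inner_diff_left)
  have "(norm p)\<^sup>2 + (x \<bullet> e)\<^sup>2 = (norm x)\<^sup>2"
    unfolding power2_norm_eq_inner p_def
    by (simp add: inner_diff_left inner_diff_right inner_commute power2_eq_square)
  then have "(norm p)\<^sup>2 \<le> (norm x)\<^sup>2" by (metis le_add_same_cancel1 zero_le_power2)
  then have "norm p \<le> norm x" by (rule power2_le_imp_le) simp
  then have pR: "norm p \<le> R" using x by simp
  have "\<bar>\<delta>\<bar> \<le> L * \<rho>"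
    using g_lipschitz[OF L(1) pR y(2)] by (simp add: \<delta>_def gp \<rho>_def norm_minus_commute)
  then have "\<bar>\<delta>\<bar>\<^sup>2 \<le> (L * \<rho>)\<^sup>2" by (rule power_mono) simp
  then have \<delta>2: "\<delta>\<^sup>2 \<le> L\<^sup>2 * \<rho>\<^sup>2" by (simp add: power_mult_distrib)
  have dec: "x - (lift y) = (p - y) + (d + \<delta>) *\<^sub>R e"
    by (simp add: p_def d_def \<delta>_def algebra_simps)
  then have nn: "(norm (x - (lift y)))\<^sup>2 = \<rho>\<^sup>2 + (d + \<delta>)\<^sup>2"
    unfolding dec power2_norm_eq_inner \<rho>_def using pe y(1)
    by (simp add: inner_diff_left inner_diff_right inner_add_left inner_add_right inner_commute power2_eq_square)
  have "d\<^sup>2 \<le> 2 * (d + \<delta>)\<^sup>2 + 2 * \<delta>\<^sup>2"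
  proof -
    have "0 \<le> (d + 2 * \<delta>)\<^sup>2" by simp
    then show ?thesis by (simp add: power2_eq_square algebra_simps)
  qed
  then have "\<rho>\<^sup>2 + d\<^sup>2 \<le> \<rho>\<^sup>2 + 2 * (d + \<delta>)\<^sup>2 + 2 * (L\<^sup>2 * \<rho>\<^sup>2)" using \<delta>2 by linarith
  also have "\<dots> \<le> (4 * (L\<^sup>2 + 1)) * (\<rho>\<^sup>2 + (d + \<delta>)\<^sup>2)"
    by (simp add: algebra_simps)
  finally show ?thesis unfolding p_def[symmetric] \<rho>_def[symmetric] d_def[symmetric] nn
    by (simp add: pos_divide_le_eq add_nonneg_pos mult.commute)
qed

text \<open>
With the two preceding bounds the kernel is dominated, up to constants, by
\<open>(d + \<rho> powr (1 + \<alpha>)) \<sigma> powr (- n / 2 - 1) exp (- \<kappa> (\<rho>\<^sup>2 + d\<^sup>2) / \<sigma>)\<close>, where \<open>d\<close> is the vertical distance of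
\<open>x\<close> from the graph and \<open>\<rho>\<close> the horizontal distance of the two points. Half of the exponent in \<open>\<rho>\<close> turns
\<open>\<rho> powr (1 + \<alpha>)\<close> into \<open>\<sigma> powr ((1 + \<alpha>) / 2)\<close>, and the remaining Gaussian contributes
\<open>\<sigma> powr ((n - 1) / 2)\<close>. Here \<open>n\<close> is the dimension of the space.
\<close>

lemma surface_integral_kernel_bound:
  assumes C: "\<And>x y. norm (G x - G y) \<le> C * dist x y powr \<alpha>" "C \<ge> 0" and \<alpha>: "\<alpha> > 0"
  obtains A1 A2 \<kappa> where "A1 \<ge> 0" "A2 \<ge> 0" "\<kappa> > 0"
    "\<forall>x \<sigma>. norm x \<le> R \<and> \<sigma> > 0 \<longrightarrow>
      (\<integral>\<^sup>+y. indicator (cball 0 R) (lift y) * ennreal \<bar>normal_kernel (N y) (x - (lift y)) \<sigma>\<bar> \<partial>H)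
      \<le> ennreal (A1 * (\<bar>x \<bullet> e - g x\<bar> * \<sigma> powr (- 3 / 2) * exp (- \<kappa> * \<bar>x \<bullet> e - g x\<bar>\<^sup>2 / \<sigma>)) + A2 * \<sigma> powr (\<alpha> / 2 - 1))"
proof -
  define m where "m = real CARD('n)"
  obtain L where L: "L \<ge> 0" "\<And>x. norm x \<le> R \<Longrightarrow> norm (G x) \<le> L" using G_bounded by blast
  define W where "W = L\<^sup>2 + 1"
  have W: "W > 0" by (simp add: W_def add_nonneg_pos)
  \<comment> \<open>A quarter of the constant in \<open>distance_to_graph_bound\<close>, from the denominator \<open>4 \<sigma>\<close> of the heat kernel.\<close>
  define \<kappa> where "\<kappa> = 1 / (16 * W)"
  have \<kappa>: "\<kappa> > 0" using W by (simp add: \<kappa>_def)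
  define q where "q = (1 + \<alpha>) / 2"
  have q: "q > 0" using \<alpha> by (simp add: q_def)
  define B where "B = (4 * pi) powr (- m / 2) / 2"
  have B: "B > 0" by (simp add: B_def)
  define A1 where "A1 = B * (pi / \<kappa>) powr ((m - 1) / 2)"
  define A2 where "A2 = B * (C * ((2 / \<kappa>) powr q * q powr q)) * (2 * pi / \<kappa>) powr ((m - 1) / 2)"
  have A: "A1 \<ge> 0" "A2 \<ge> 0" using B C(2) by (auto simp: A1_def A2_def)
  show ?thesis
  proof (rule that[OF A \<kappa>], intro allI impI, elim conjE)
    fix x :: "real^'n" and \<sigma> :: real
    assume x: "norm x \<le> R" and \<sigma>: "\<sigma> > 0"
    define p where "p = x - (x \<bullet> e) *\<^sub>R e"
    define d where "d = \<bar>x \<bullet> e - g x\<bar>"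
    define b where "b = B * \<sigma> powr (- m / 2 - 1)"
    have b: "b \<ge> 0" using B by (simp add: b_def)
    define c1 where "c1 = b * d * exp (- \<kappa> * d\<^sup>2 / \<sigma>)"
    define c2 where "c2 = b * (C * ((2 * \<sigma> / \<kappa>) powr q * q powr q))"
    have c: "c1 \<ge> 0" "c2 \<ge> 0" using b C(2) by (auto simp: c1_def c2_def d_def)
    have pw: "indicator (cball 0 R) (lift y) * ennreal \<bar>normal_kernel (N y) (x - (lift y)) \<sigma>\<bar>
      \<le> ennreal c1 * ennreal (exp (- (\<kappa> / \<sigma>) * (norm (y - p))\<^sup>2)) + ennreal c2 * ennreal (exp (- (\<kappa> / (2 * \<sigma>)) * (norm (y - p))\<^sup>2))"
      if y: "y \<bullet> e = 0" for y
    proof (cases "norm (lift y) \<le> R")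
      case True
      define Y where "Y = lift y"
      define \<rho> where "\<rho> = norm (y - p)"
      have \<rho>0: "\<rho> \<ge> 0" by (simp add: \<rho>_def)
      have yR: "norm y \<le> R" using graph_point(2)[OF y] True by linarith
      have n: "\<bar>(x - Y) \<bullet> N y\<bar> \<le> d + C * \<rho> powr (1 + \<alpha>)"
        using normal_component_bound[OF C \<alpha> y, of x] by (simp add: Y_def d_def \<rho>_def p_def)
      have "4 * \<kappa> * (\<rho>\<^sup>2 + d\<^sup>2) \<le> (norm (x - Y))\<^sup>2"
        using distance_to_graph_bound[OF L(2,1) y yR x] W
        unfolding W_def[symmetric] Y_def d_def \<rho>_def p_def \<kappa>_def by (simp add: field_simps)
      then have "- ((norm (x - Y))\<^sup>2) / (4 * \<sigma>) \<le> - (4 * \<kappa> * (\<rho>\<^sup>2 + d\<^sup>2)) / (4 * \<sigma>)"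
        using \<sigma> by (intro divide_right_mono) auto
      also have "\<dots> = - \<kappa> * d\<^sup>2 / \<sigma> + - (\<kappa> / \<sigma>) * \<rho>\<^sup>2" using \<sigma> by (simp add: field_simps)
      finally have ex: "exp (- (norm (x - Y))\<^sup>2 / (4 * \<sigma>)) \<le> exp (- \<kappa> * d\<^sup>2 / \<sigma>) * exp (- (\<kappa> / \<sigma>) * \<rho>\<^sup>2)"
        by (simp only: exp_add[symmetric] exp_le_cancel_iff)
      have "\<sigma> powr (- m / 2 - 1) = \<sigma> powr (- m / 2) / \<sigma>" using \<sigma> by (simp add: powr_diff)
      then have "\<bar>normal_kernel (N y) (x - Y) \<sigma>\<bar> = b * exp (- (norm (x - Y))\<^sup>2 / (4 * \<sigma>)) * \<bar>(x - Y) \<bullet> N y\<bar>"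
        using \<sigma> by (simp add: normal_kernel_def heat_kernel_def b_def B_def m_def powr_mult abs_mult)
      also have "\<dots> \<le> b * (exp (- \<kappa> * d\<^sup>2 / \<sigma>) * exp (- (\<kappa> / \<sigma>) * \<rho>\<^sup>2)) * (d + C * \<rho> powr (1 + \<alpha>))"
        using n ex b by (intro mult_mono mult_left_mono) auto
      also have "\<dots> = c1 * exp (- (\<kappa> / \<sigma>) * \<rho>\<^sup>2) + b * C * exp (- \<kappa> * d\<^sup>2 / \<sigma>) * (\<rho> powr (1 + \<alpha>) * exp (- (\<kappa> / \<sigma>) * \<rho>\<^sup>2))"
        by (simp add: c1_def algebra_simps)
      also have "b * C * exp (- \<kappa> * d\<^sup>2 / \<sigma>) * (\<rho> powr (1 + \<alpha>) * exp (- (\<kappa> / \<sigma>) * \<rho>\<^sup>2))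
        \<le> b * C * 1 * ((2 * \<sigma> / \<kappa>) powr q * q powr q * exp (- (\<kappa> / (2 * \<sigma>)) * \<rho>\<^sup>2))"
      proof (rule mult_mono)
        have "exp (- \<kappa> * d\<^sup>2 / \<sigma>) \<le> 1" using \<sigma> \<kappa> by simp
        then show "b * C * exp (- \<kappa> * d\<^sup>2 / \<sigma>) \<le> b * C * 1" using b C(2) by (intro mult_left_mono) auto
        define u where "u = \<kappa> * \<rho>\<^sup>2 / (2 * \<sigma>)"
        have u: "u \<ge> 0" using \<sigma> \<kappa> by (simp add: u_def)
        have "\<rho>\<^sup>2 = (2 * \<sigma> / \<kappa>) * u" using \<sigma> \<kappa> by (simp add: u_def)
        moreover have "\<rho> powr (1 + \<alpha>) = (\<rho>\<^sup>2) powr q"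
        proof (cases "\<rho> = 0")
          case False
          then have "(\<rho>\<^sup>2) powr q = \<rho> powr (2 * q)" using \<rho>0 by (simp add: powr_powr flip: powr_numeral)
          moreover have "2 * q = 1 + \<alpha>" by (simp add: q_def)
          ultimately show ?thesis by simp
        qed simp
        ultimately have "\<rho> powr (1 + \<alpha>) = (2 * \<sigma> / \<kappa>) powr q * u powr q"
          using \<sigma> \<kappa> u by (simp only: powr_mult)
        moreover have "exp (- (\<kappa> / \<sigma>) * \<rho>\<^sup>2) = exp (- u) * exp (- u)"
          by (simp add: u_def exp_add[symmetric])
        moreover have "exp (- (\<kappa> / (2 * \<sigma>)) * \<rho>\<^sup>2) = exp (- u)" by (simp add: u_def)
        ultimately have "\<rho> powr (1 + \<alpha>) * exp (- (\<kappa> / \<sigma>) * \<rho>\<^sup>2) = (2 * \<sigma> / \<kappa>) powr q * (u powr q * exp (- u)) * exp (- (\<kappa> / (2 * \<sigma>)) * \<rho>\<^sup>2)"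
          by simp
        also have "\<dots> \<le> (2 * \<sigma> / \<kappa>) powr q * q powr q * exp (- (\<kappa> / (2 * \<sigma>)) * \<rho>\<^sup>2)"
          using powr_times_exp_bound[OF q u] by (intro mult_right_mono mult_left_mono) auto
        finally show "\<rho> powr (1 + \<alpha>) * exp (- (\<kappa> / \<sigma>) * \<rho>\<^sup>2) \<le> (2 * \<sigma> / \<kappa>) powr q * q powr q * exp (- (\<kappa> / (2 * \<sigma>)) * \<rho>\<^sup>2)" .
      qed (use b C(2) in auto)
      also have "b * C * 1 * ((2 * \<sigma> / \<kappa>) powr q * q powr q * exp (- (\<kappa> / (2 * \<sigma>)) * \<rho>\<^sup>2)) = c2 * exp (- (\<kappa> / (2 * \<sigma>)) * \<rho>\<^sup>2)"
        by (simp add: c2_def)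
      finally have "\<bar>normal_kernel (N y) (x - Y) \<sigma>\<bar> \<le> c1 * exp (- (\<kappa> / \<sigma>) * \<rho>\<^sup>2) + c2 * exp (- (\<kappa> / (2 * \<sigma>)) * \<rho>\<^sup>2)" by simp
      then have "ennreal \<bar>normal_kernel (N y) (x - Y) \<sigma>\<bar> \<le> ennreal c1 * ennreal (exp (- (\<kappa> / \<sigma>) * \<rho>\<^sup>2)) + ennreal c2 * ennreal (exp (- (\<kappa> / (2 * \<sigma>)) * \<rho>\<^sup>2))"
        using c by (simp add: ennreal_mult[symmetric] ennreal_plus[symmetric] ennreal_leI del: ennreal_plus)
      then show ?thesis using True by (simp add: Y_def \<rho>_def)
    qed simp
    have p1: "\<kappa> / \<sigma> > 0" "\<kappa> / (2 * \<sigma>) > 0" using \<sigma> \<kappa> by auto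
    have "(\<integral>\<^sup>+y. indicator (cball 0 R) (lift y) * ennreal \<bar>normal_kernel (N y) (x - (lift y)) \<sigma>\<bar> \<partial>H)
      \<le> (\<integral>\<^sup>+y. ennreal c1 * ennreal (exp (- (\<kappa> / \<sigma>) * (norm (y - p))\<^sup>2)) + ennreal c2 * ennreal (exp (- (\<kappa> / (2 * \<sigma>)) * (norm (y - p))\<^sup>2)) \<partial>H)"
      by (rule nn_integral_mono_AE, rule AE_mp[OF AE_e], rule AE_I2, rule impI, rule pw)
    also have "\<dots> = ennreal c1 * ennreal ((pi / (\<kappa> / \<sigma>)) powr ((m - 1) / 2)) + ennreal c2 * ennreal ((pi / (\<kappa> / (2 * \<sigma>))) powr ((m - 1) / 2))"
      unfolding p_def m_def
      by (subst nn_integral_add, simp, simp, subst (1 2) nn_integral_cmult, simp, simp,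
        simp only: nn_integral_gaussian_hyperplane[OF norm_e p1(1), of x] nn_integral_gaussian_hyperplane[OF norm_e p1(2), of x])
    also have "\<dots> = ennreal (c1 * (pi / (\<kappa> / \<sigma>)) powr ((m - 1) / 2) + c2 * (pi / (\<kappa> / (2 * \<sigma>))) powr ((m - 1) / 2))"
      using c by (simp add: ennreal_mult)
    also have "c1 * (pi / (\<kappa> / \<sigma>)) powr ((m - 1) / 2) = A1 * (d * \<sigma> powr (- 3 / 2) * exp (- \<kappa> * d\<^sup>2 / \<sigma>))"
    proof -
      have "(pi / (\<kappa> / \<sigma>)) powr ((m - 1) / 2) = (pi / \<kappa>) powr ((m - 1) / 2) * \<sigma> powr ((m - 1) / 2)"
        using \<sigma> \<kappa> by (simp add: powr_mult[symmetric])
      moreover have "\<sigma> powr (- m / 2 - 1) * \<sigma> powr ((m - 1) / 2) = \<sigma> powr (- 3 / 2)"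
        by (simp add: powr_add[symmetric] field_simps)
      ultimately show ?thesis by (simp add: c1_def A1_def b_def mult_ac)
    qed
    also have "c2 * (pi / (\<kappa> / (2 * \<sigma>))) powr ((m - 1) / 2) = A2 * \<sigma> powr (\<alpha> / 2 - 1)"
    proof -
      have "(pi / (\<kappa> / (2 * \<sigma>))) powr ((m - 1) / 2) = (2 * pi / \<kappa>) powr ((m - 1) / 2) * \<sigma> powr ((m - 1) / 2)"
        using \<sigma> \<kappa> by (simp add: powr_mult[symmetric] mult_ac)
      moreover have "(2 * \<sigma> / \<kappa>) powr q = (2 / \<kappa>) powr q * \<sigma> powr q"
        using \<sigma> \<kappa> by (simp add: powr_mult[symmetric])
      moreover have "\<sigma> powr (- m / 2 - 1) * (\<sigma> powr q * \<sigma> powr ((m - 1) / 2)) = \<sigma> powr (\<alpha> / 2 - 1)"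
      proof -
        have "- m / 2 - 1 + (q + (m - 1) / 2) = \<alpha> / 2 - 1" by (simp add: q_def field_simps)
        then show ?thesis by (simp only: powr_add[symmetric])
      qed
      ultimately show ?thesis by (simp add: c2_def A2_def b_def mult_ac)
    qed
    finally show "(\<integral>\<^sup>+y. indicator (cball 0 R) (lift y) * ennreal \<bar>normal_kernel (N y) (x - (lift y)) \<sigma>\<bar> \<partial>H)
      \<le> ennreal (A1 * (\<bar>x \<bullet> e - g x\<bar> * \<sigma> powr (- 3 / 2) * exp (- \<kappa> * \<bar>x \<bullet> e - g x\<bar>\<^sup>2 / \<sigma>)) + A2 * \<sigma> powr (\<alpha> / 2 - 1))"
      unfolding d_def .
  qed
qed

text \<open>
The bound is uniform in \<open>x\<close>, on both sides of the boundary and on it. This makes the potential absolutely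
convergent everywhere and its near part small when the density is.
\<close>

lemma double_layer_near_bound:
  assumes C: "\<And>x y. norm (G x - G y) \<le> C * dist x y powr \<alpha>" and \<alpha>: "\<alpha> > 0" and x0: "x0 \<in> U"
    and n[measurable]: "n \<in> borel_measurable borel" and neq: "\<And>\<xi>. \<xi> \<in> frontier \<Omega> \<Longrightarrow> n \<xi> = outward_normal \<Omega> \<xi>" and T: "T \<ge> 0"
  obtains r M where "r > 0" "ball x0 r \<subseteq> U"
    "\<And>x. x \<in> ball x0 r \<Longrightarrow>
      near_mass (boundary_measure \<Omega>) n x0 r T x \<le> ennreal M"
proof -
  have C': "norm (G x - G y) \<le> \<bar>C\<bar> * dist x y powr \<alpha>" for x y
    using C[of x y] by (meson abs_ge_self mult_right_mono order_trans powr_ge_zero)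
  obtain r where r: "r > 0" "ball x0 r \<subseteq> U" using open_U x0 open_contains_ball by blast
  define R where "R = norm x0 + r"
  have R: "norm x \<le> R" if "x \<in> ball x0 r" for x
    using that norm_triangle_sub[of x x0] by (simp add: R_def dist_norm norm_minus_commute)
  obtain A1 A2 \<kappa> where A: "A1 \<ge> 0" "A2 \<ge> 0" "\<kappa> > 0"
    "\<forall>x \<sigma>. norm x \<le> R \<and> \<sigma> > 0 \<longrightarrow>
      (\<integral>\<^sup>+y. indicator (cball 0 R) (lift y) * ennreal \<bar>normal_kernel (N y) (x - (lift y)) \<sigma>\<bar> \<partial>H)
      \<le> ennreal (A1 * (\<bar>x \<bullet> e - g x\<bar> * \<sigma> powr (- 3 / 2) * exp (- \<kappa> * \<bar>x \<bullet> e - g x\<bar>\<^sup>2 / \<sigma>)) + A2 * \<sigma> powr (\<alpha> / 2 - 1))"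
    by (rule surface_integral_kernel_bound[OF C' abs_ge_zero \<alpha>, of R])
  define M where "M = A1 * (2 / \<kappa> + 2) + A2 * (T powr (\<alpha> / 2) / (\<alpha> / 2))"
  show ?thesis
  proof (rule that[OF r])
    fix x assume x: "x \<in> ball x0 r"
    define d where "d = \<bar>x \<bullet> e - g x\<bar>"
    have inner: "(\<integral>\<^sup>+\<xi>. indicator (ball x0 r) \<xi> * ennreal \<bar>normal_kernel (n \<xi>) (x - \<xi>) \<sigma>\<bar> \<partial>boundary_measure \<Omega>)
      \<le> ennreal (A1 * (d * \<sigma> powr (- 3 / 2) * exp (- \<kappa> * d\<^sup>2 / \<sigma>)) + A2 * \<sigma> powr (\<alpha> / 2 - 1))" if \<sigma>: "\<sigma> > 0" for \<sigma>
    proof -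
      have "(\<integral>\<^sup>+\<xi>. indicator (ball x0 r) \<xi> * ennreal \<bar>normal_kernel (n \<xi>) (x - \<xi>) \<sigma>\<bar> \<partial>boundary_measure \<Omega>)
        = (\<integral>\<^sup>+y. indicator (ball x0 r) (lift y) * ennreal \<bar>normal_kernel (n (lift y)) (x - (lift y)) \<sigma>\<bar> * ennreal (norm (N y)) \<partial>H)"
        using r(2) by (intro nn_integral_boundary_measure) (auto simp: indicator_def)
      also have "\<dots> \<le> (\<integral>\<^sup>+y. indicator (cball 0 R) (lift y) * ennreal \<bar>normal_kernel (N y) (x - (lift y)) \<sigma>\<bar> \<partial>H)"
      proof (rule nn_integral_mono_AE, rule AE_mp[OF AE_e], rule AE_I2, rule impI)
        fix y assume y: "y \<bullet> e = 0"
        let ?Y = "lift y"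
        show "indicator (ball x0 r) ?Y * ennreal \<bar>normal_kernel (n ?Y) (x - ?Y) \<sigma>\<bar> * ennreal (norm (N y))
          \<le> indicator (cball 0 R) ?Y * ennreal \<bar>normal_kernel (N y) (x - ?Y) \<sigma>\<bar>"
        proof (cases "?Y \<in> ball x0 r")
          case True
          then have YU: "?Y \<in> U" using r(2) by blast
          then have "n ?Y = N y /\<^sub>R norm (N y)"
            using neq[of ?Y] outward_normal_eq[of ?Y] graph_point(3,4)[OF y] by simp
          moreover have "norm (N y) > 0" using norm_N(2)[of y] by linarith
          ultimately have "\<bar>normal_kernel (n ?Y) (x - ?Y) \<sigma>\<bar> * norm (N y) = \<bar>normal_kernel (N y) (x - ?Y) \<sigma>\<bar>"
            by (simp add: normal_kernel_def abs_mult)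
          then show ?thesis using True R[OF True] by (simp add: ennreal_mult[symmetric])
        qed simp
      qed
      also have "\<dots> \<le> ennreal (A1 * (d * \<sigma> powr (- 3 / 2) * exp (- \<kappa> * d\<^sup>2 / \<sigma>)) + A2 * \<sigma> powr (\<alpha> / 2 - 1))"
        unfolding d_def by (rule A(4)[rule_format, OF conjI[OF R[OF x] \<sigma>]])
      finally show ?thesis .
    qed
    have "near_mass (boundary_measure \<Omega>) n x0 r T x
      \<le> (\<integral>\<^sup>+\<sigma>. ennreal A1 * (ennreal (d * \<sigma> powr (- 3 / 2) * exp (- \<kappa> * d\<^sup>2 / \<sigma>)) * indicator {0<..} \<sigma>)
           + ennreal A2 * (ennreal (\<sigma> powr (\<alpha> / 2 - 1)) * indicator {0<..<T} \<sigma>) \<partial>lborel)"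
    proof (rule nn_integral_mono)
      fix \<sigma> :: real
      show "(\<integral>\<^sup>+\<xi>. indicator (ball x0 r) \<xi> * ennreal \<bar>normal_kernel (n \<xi>) (x - \<xi>) \<sigma>\<bar> \<partial>boundary_measure \<Omega>) * indicator {0<..<T} \<sigma>
        \<le> ennreal A1 * (ennreal (d * \<sigma> powr (- 3 / 2) * exp (- \<kappa> * d\<^sup>2 / \<sigma>)) * indicator {0<..} \<sigma>)
           + ennreal A2 * (ennreal (\<sigma> powr (\<alpha> / 2 - 1)) * indicator {0<..<T} \<sigma>)"
      proof (cases "\<sigma> \<in> {0<..<T}")
        case True
        have "d \<ge> 0" by (simp add: d_def)
        then show ?thesis using inner[of \<sigma>] True A(1,2) by (simp add: ennreal_mult)
      qed simp
    qed
    also have "\<dots> = ennreal A1 * (\<integral>\<^sup>+\<sigma>. ennreal (d * \<sigma> powr (- 3 / 2) * exp (- \<kappa> * d\<^sup>2 / \<sigma>)) * indicator {0<..} \<sigma> \<partial>lborel)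
           + ennreal A2 * (\<integral>\<^sup>+\<sigma>. ennreal (\<sigma> powr (\<alpha> / 2 - 1)) * indicator {0<..<T} \<sigma> \<partial>lborel)"
      by (subst nn_integral_add, simp, simp, subst (1 2) nn_integral_cmult, simp, simp) simp
    also have "\<dots> \<le> ennreal A1 * ennreal (2 / \<kappa> + 2) + ennreal A2 * ennreal (T powr (\<alpha> / 2) / (\<alpha> / 2))"
      using \<alpha> T by (intro add_mono mult_left_mono nn_integral_distance_kernel nn_integral_powr_Ioo A(3)) (auto simp: d_def)
    also have "\<dots> = ennreal M"
    proof -
      have m: "2 / \<kappa> + 2 \<ge> 0" "T powr (\<alpha> / 2) / (\<alpha> / 2) \<ge> 0" using A(3) \<alpha> by auto
      show ?thesis
        by (simp only: M_def ennreal_plus[OF mult_nonneg_nonneg[OF A(1) m(1)] mult_nonneg_nonneg[OF A(2) m(2)]]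
          ennreal_mult[OF A(1) m(1)] ennreal_mult[OF A(2) m(2)])
    qed
    finally show "near_mass (boundary_measure \<Omega>) n x0 r T x \<le> ennreal M" .
  qed
qed

end

section \<open>Potentials with a weak singularity\<close>

lemma dominated_convergence_at:
  fixes f :: "'p::metric_space \<Rightarrow> 'a \<Rightarrow> real" and w :: "'a \<Rightarrow> real"
  assumes meas: "\<And>p. f p \<in> borel_measurable M" "f0 \<in> borel_measurable M" and w: "integrable M w"
    and lim: "AE a in M. ((\<lambda>p. f p a) \<longlongrightarrow> f0 a) (at p0 within s)"
    and bound: "eventually (\<lambda>p. AE a in M. \<bar>f p a\<bar> \<le> w a) (at p0 within s)"
  shows "((\<lambda>p. \<integral>a. f p a \<partial>M) \<longlongrightarrow> (\<integral>a. f0 a \<partial>M)) (at p0 within s)"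
  unfolding tendsto_at_iff_sequentially
proof (intro allI impI)
  fix X :: "nat \<Rightarrow> 'p"
  assume X: "\<forall>i. X i \<in> s - {p0}" "X \<longlonglongrightarrow> p0"
  then have X': "filterlim X (at p0 within s) sequentially" by (auto simp: filterlim_at)
  then have "eventually (\<lambda>i. AE a in M. \<bar>f (X i) a\<bar> \<le> w a) sequentially"
    by (rule eventually_compose_filterlim[OF bound])
  then obtain k where k: "\<And>i. i \<ge> k \<Longrightarrow> AE a in M. \<bar>f (X i) a\<bar> \<le> w a"
    by (auto simp: eventually_sequentially)
  have "(\<lambda>i. \<integral>a. f (X (i + k)) a \<partial>M) \<longlonglongrightarrow> (\<integral>a. f0 a \<partial>M)"
  proof (rule integral_dominated_convergence[OF _ _ w])
    show "AE a in M. (\<lambda>i. f (X (i + k)) a) \<longlonglongrightarrow> f0 a"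
      using lim
    proof eventually_elim
      case (elim a)
      have "(\<lambda>i. f (X i) a) \<longlonglongrightarrow> f0 a" by (rule filterlim_compose[OF elim X'])
      then show ?case by (rule LIMSEQ_ignore_initial_segment)
    qed
    show "AE a in M. norm (f (X (i + k)) a) \<le> w a" for i using k[of "i + k"] by simp
  qed (use meas in auto)
  then show "((\<lambda>p. \<integral>a. f p a \<partial>M) \<circ> X) \<longlonglongrightarrow> (\<integral>a. f0 a \<partial>M)"
    using LIMSEQ_offset[of "\<lambda>i. \<integral>a. f (X i) a \<partial>M" k] by (simp add: o_def)
qed

lemma indicator_Ioo_tendsto:
  fixes \<sigma> t0 :: real
  assumes g: "(g \<longlongrightarrow> t0) F" and \<sigma>: "\<sigma> \<noteq> t0"
  shows "((\<lambda>q. indicator {0<..<g q} \<sigma> :: real) \<longlongrightarrow> indicator {0<..<t0} \<sigma>) F"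
proof (cases "\<sigma> < t0")
  case True
  have "eventually (\<lambda>q. \<sigma> < g q) F" by (rule order_tendstoD(1)[OF g True])
  then have "eventually (\<lambda>q. (indicator {0<..<g q} \<sigma> :: real) = indicator {0<..<t0} \<sigma>) F"
    by eventually_elim (use True in \<open>auto simp: indicator_def\<close>)
  then show ?thesis by (rule tendsto_eventually)
next
  case False
  then have "\<sigma> > t0" using \<sigma> by simp
  then have "eventually (\<lambda>q. g q < \<sigma>) F" by (rule order_tendstoD(2)[OF g])
  then have "eventually (\<lambda>q. (indicator {0<..<g q} \<sigma> :: real) = indicator {0<..<t0} \<sigma>) F"
    by eventually_elim (use False in \<open>auto simp: indicator_def\<close>)
  then show ?thesis by (rule tendsto_eventually)
qed

text \<open>
Continuity of the potential depends on the geometry only through a finite measure \<open>\<mu>\<close>, a bounded field \<open>n\<close> of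
normals and the uniform bound \<open>near_bound\<close>.
\<close>

locale double_layer_kernel = finite_measure \<mu> for \<mu> :: "(real^'n) measure" +
  fixes n :: "real^'n \<Rightarrow> real^'n"
  assumes sets_mu [simp, measurable_cong]: "sets \<mu> = sets borel"
    and n_measurable [measurable]: "n \<in> borel_measurable borel"
    and norm_n: "norm (n \<xi>) \<le> 1"
    and near_bound: "\<exists>r>0. \<exists>M\<ge>0. \<forall>x\<in>ball x0 r.
      near_mass \<mu> n x0 r T x \<le> ennreal M"
begin

sublocale P: pair_sigma_finite "lborel :: real measure" \<mu> ..

abbreviation PM :: "(real \<times> (real^'n)) measure" where "PM \<equiv> lborel \<Otimes>\<^sub>M \<mu>"

definition density_ok :: "(real^'n \<Rightarrow> real \<Rightarrow> real) \<Rightarrow> bool" where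
  "density_ok \<psi> \<longleftrightarrow> continuous_on UNIV (\<lambda>(\<xi>, t). \<psi> \<xi> t) \<and> (\<exists>B. \<forall>\<xi> t. \<bar>\<psi> \<xi> t\<bar> \<le> B)"

definition integrand :: "(real^'n \<Rightarrow> real \<Rightarrow> real) \<Rightarrow> real^'n \<Rightarrow> real \<Rightarrow> real \<times> (real^'n) \<Rightarrow> real" where
  "integrand \<psi> x t = (\<lambda>(\<sigma>, \<xi>). indicator {0<..<t} \<sigma> * normal_kernel (n \<xi>) (x - \<xi>) \<sigma> * \<psi> \<xi> (t - \<sigma>))"

definition potential :: "(real^'n \<Rightarrow> real \<Rightarrow> real) \<Rightarrow> real^'n \<Rightarrow> real \<Rightarrow> real" where
  "potential \<psi> x t = (\<integral>p. integrand \<psi> x t p \<partial>PM)"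

lemma density_bound:
  assumes "density_ok \<psi>" obtains B where "B > 0" "\<And>\<xi> t. \<bar>\<psi> \<xi> t\<bar> \<le> B"
proof -
  obtain B where b: "\<And>\<xi> t. \<bar>\<psi> \<xi> t\<bar> \<le> B" using assms by (auto simp: density_ok_def)
  have "\<bar>\<psi> \<xi> t\<bar> \<le> \<bar>B\<bar> + 1" for \<xi> t using b[of \<xi> t] by linarith
  then show ?thesis by (intro that[of "\<bar>B\<bar> + 1"]) auto
qed

lemma density_measurable:
  assumes "density_ok \<psi>" and [measurable]: "f \<in> borel_measurable M" "g \<in> borel_measurable M"
  shows "(\<lambda>x. \<psi> (f x) (g x)) \<in> borel_measurable M"
proof -
  have "(\<lambda>(\<xi>, t). \<psi> \<xi> t) \<in> borel_measurable borel"
    using assms(1) unfolding density_ok_def by (intro borel_measurable_continuous_onI) auto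
  then have "(\<lambda>(\<xi>, t). \<psi> \<xi> t) \<circ> (\<lambda>x. (f x, g x)) \<in> borel_measurable M"
    by (intro measurable_comp[where N=borel] borel_measurable_Pair) auto
  then show ?thesis by (simp add: o_def)
qed

lemma density_tendsto:
  assumes "density_ok \<psi>" "(f \<longlongrightarrow> \<xi>) F" "(g \<longlongrightarrow> t) F"
  shows "((\<lambda>x. \<psi> (f x) (g x)) \<longlongrightarrow> \<psi> \<xi> t) F"
proof -
  have "((\<lambda>x. (f x, g x)) \<longlongrightarrow> (\<xi>, t)) F" using assms by (intro tendsto_Pair)
  moreover have "isCont (\<lambda>(\<xi>, t). \<psi> \<xi> t) (\<xi>, t)"
    using assms(1) by (auto simp: density_ok_def continuous_on_eq_continuous_at)
  ultimately show ?thesis using isCont_tendsto_compose[of "(\<xi>, t)" "\<lambda>(\<xi>, t). \<psi> \<xi> t"] by fastforce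
qed

lemma integrand_measurable:
  assumes \<psi>: "density_ok \<psi>"
  shows "integrand \<psi> x t \<in> borel_measurable PM"
proof -
  have [measurable]: "(\<lambda>p. \<psi> (snd p) (t - fst p)) \<in> borel_measurable PM"
    by (rule density_measurable[OF \<psi>]) measurable
  show ?thesis unfolding integrand_def case_prod_beta' by measurable
qed

lemma AE_time_neq: "AE p in PM. fst p \<noteq> t"
proof (rule P.AE_pair_measure)
  have "{p \<in> space PM. fst p \<noteq> t} = fst -` (- {t}) \<inter> space PM" by auto
  also have "\<dots> \<in> sets PM" by (intro measurable_sets[OF measurable_fst]) auto
  finally show "{p \<in> space PM. fst p \<noteq> t} \<in> sets PM" .
  show "AE \<sigma> in lborel. AE \<xi> in \<mu>. fst (\<sigma>, \<xi>) \<noteq> t"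
    using AE_lborel_singleton[of t] by eventually_elim simp
qed

lemma integrable_time_slab: "integrable PM (\<lambda>p. c * indicator {0<..<T} (fst p) :: real)"
proof (intro integrable_mult_right)
  have "(\<lambda>p. indicator {0<..<T} (fst p) :: real) = (indicator ({0<..<T} \<times> UNIV) :: real \<times> (real^'n) \<Rightarrow> real)"
    by (auto simp: indicator_def fun_eq_iff)
  moreover have "emeasure PM ({0<..<T} \<times> UNIV) < \<infinity>"
  proof -
    have "emeasure lborel {0<..<T} \<le> emeasure lborel {0..T}" by (rule emeasure_mono) auto
    also have "\<dots> < top" by (simp add: emeasure_lborel_Icc_eq)
    finally have "emeasure lborel {0<..<T} < top" .
    moreover have "emeasure \<mu> UNIV < top" using emeasure_finite[of UNIV] by (simp only: top.not_eq_extremum[symmetric]) simp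
    ultimately have "emeasure lborel {0<..<T} * emeasure \<mu> UNIV < top" by (simp only: ennreal_mult_less_top) simp
    then show ?thesis by (subst emeasure_pair_measure_Times) auto
  qed
  ultimately show "integrable PM (\<lambda>p. indicator {0<..<T} (fst p) :: real)"
    by (simp add: integrable_real_indicator pair_measureI)
qed

lemma far_kernel_bound:
  assumes \<delta>: "\<delta> > 0"
  obtains C where "C > 0" "\<And>x \<xi> \<sigma>. \<delta> \<le> norm (x - \<xi>) \<or> \<delta> \<le> \<sigma> \<Longrightarrow> \<bar>normal_kernel (n \<xi>) (x - \<xi>) \<sigma>\<bar> \<le> C"
proof -
  obtain C where C: "C > 0" "\<And>(z::real^'n) \<sigma>. \<delta> \<le> norm z \<or> \<delta> \<le> \<sigma> \<Longrightarrow> heat_kernel z \<sigma> * norm z / (2 * \<sigma>) \<le> C"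
    using heat_gradient_bounded_far[OF \<delta>] by blast
  show ?thesis
    by (rule that[of C], rule C(1), rule order_trans[OF abs_normal_kernel_le[OF norm_n] C(2)])
qed

lemma near_measurable:
  fixes B :: real
  assumes [measurable]: "A \<in> sets borel"
  shows "(\<lambda>p. B * (indicator {0<..<T} (fst p) * indicator A (snd p) * \<bar>normal_kernel (n (snd p)) (x - snd p) (fst p)\<bar>)) \<in> borel_measurable PM"
  by measurable

lemma nn_integral_near:
  fixes B :: real
  assumes [measurable]: "A \<in> sets borel" and B: "B \<ge> 0"
  shows "(\<integral>\<^sup>+p. ennreal (B * (indicator {0<..<T} (fst p) * indicator A (snd p) * \<bar>normal_kernel (n (snd p)) (x - snd p) (fst p)\<bar>)) \<partial>PM)
    = ennreal B * (\<integral>\<^sup>+\<sigma>. (\<integral>\<^sup>+\<xi>. indicator A \<xi> * ennreal \<bar>normal_kernel (n \<xi>) (x - \<xi>) \<sigma>\<bar> \<partial>\<mu>) * indicator {0<..<T} \<sigma> \<partial>lborel)"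
proof -
  have "(\<integral>\<^sup>+p. ennreal (B * (indicator {0<..<T} (fst p) * indicator A (snd p) * \<bar>normal_kernel (n (snd p)) (x - snd p) (fst p)\<bar>)) \<partial>PM)
     = (\<integral>\<^sup>+\<sigma>. (\<integral>\<^sup>+\<xi>. ennreal (B * (indicator {0<..<T} \<sigma> * indicator A \<xi> * \<bar>normal_kernel (n \<xi>) (x - \<xi>) \<sigma>\<bar>)) \<partial>\<mu>) \<partial>lborel)"
    by (subst nn_integral_fst[symmetric]) auto
  also have "\<dots> = (\<integral>\<^sup>+\<sigma>. ennreal B * ((\<integral>\<^sup>+\<xi>. indicator A \<xi> * ennreal \<bar>normal_kernel (n \<xi>) (x - \<xi>) \<sigma>\<bar> \<partial>\<mu>) * indicator {0<..<T} \<sigma>) \<partial>lborel)"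
  proof (rule nn_integral_cong)
    fix \<sigma> :: real
    have "(\<integral>\<^sup>+\<xi>. ennreal (B * (indicator {0<..<T} \<sigma> * indicator A \<xi> * \<bar>normal_kernel (n \<xi>) (x - \<xi>) \<sigma>\<bar>)) \<partial>\<mu>)
      = (\<integral>\<^sup>+\<xi>. (ennreal B * indicator {0<..<T} \<sigma>) * (indicator A \<xi> * ennreal \<bar>normal_kernel (n \<xi>) (x - \<xi>) \<sigma>\<bar>) \<partial>\<mu>)"
      using B by (intro nn_integral_cong) (auto simp: indicator_def ennreal_mult)
    also have "\<dots> = (ennreal B * indicator {0<..<T} \<sigma>) * (\<integral>\<^sup>+\<xi>. indicator A \<xi> * ennreal \<bar>normal_kernel (n \<xi>) (x - \<xi>) \<sigma>\<bar> \<partial>\<mu>)"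
      by (rule nn_integral_cmult) simp
    finally show "(\<integral>\<^sup>+\<xi>. ennreal (B * (indicator {0<..<T} \<sigma> * indicator A \<xi> * \<bar>normal_kernel (n \<xi>) (x - \<xi>) \<sigma>\<bar>)) \<partial>\<mu>)
      = ennreal B * ((\<integral>\<^sup>+\<xi>. indicator A \<xi> * ennreal \<bar>normal_kernel (n \<xi>) (x - \<xi>) \<sigma>\<bar> \<partial>\<mu>) * indicator {0<..<T} \<sigma>)"
      by (simp add: mult_ac)
  qed
  also have "\<dots> = ennreal B * (\<integral>\<^sup>+\<sigma>. (\<integral>\<^sup>+\<xi>. indicator A \<xi> * ennreal \<bar>normal_kernel (n \<xi>) (x - \<xi>) \<sigma>\<bar> \<partial>\<mu>) * indicator {0<..<T} \<sigma> \<partial>lborel)"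
    by (rule nn_integral_cmult) simp
  finally show ?thesis .
qed

lemma integrable_integrand:
  assumes \<psi>: "density_ok \<psi>"
  shows "integrable PM (integrand \<psi> x t)"
proof -
  obtain B where B: "B > 0" "\<And>\<xi> t. \<bar>\<psi> \<xi> t\<bar> \<le> B" using density_bound[OF \<psi>] by blast
  obtain r M where r: "r > 0" "M \<ge> 0" and M: "\<forall>y\<in>ball x r.
      near_mass \<mu> n x r t y \<le> ennreal M"
    using near_bound[of x t] by blast
  obtain C where C: "C > 0" "\<And>x \<xi> \<sigma>. r \<le> norm (x - \<xi>) \<or> r \<le> \<sigma> \<Longrightarrow> \<bar>normal_kernel (n \<xi>) (x - \<xi>) \<sigma>\<bar> \<le> C"
    using far_kernel_bound[OF r(1)] by blast
  define w1 where "w1 p = B * (indicator {0<..<t} (fst p) * indicator (ball x r) (snd p) * \<bar>normal_kernel (n (snd p)) (x - snd p) (fst p)\<bar>)" for p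
  have i1: "integrable PM w1"
  proof (rule integrableI_bounded)
    show "w1 \<in> borel_measurable PM" unfolding w1_def by (rule near_measurable) simp
    have "(\<integral>\<^sup>+p. ennreal (norm (w1 p)) \<partial>PM) = (\<integral>\<^sup>+p. ennreal (B * (indicator {0<..<t} (fst p) * indicator (ball x r) (snd p) * \<bar>normal_kernel (n (snd p)) (x - snd p) (fst p)\<bar>)) \<partial>PM)"
      using B by (intro nn_integral_cong) (simp add: w1_def abs_mult)
    also have "\<dots> = ennreal B * near_mass \<mu> n x r t x"
      using B by (intro nn_integral_near) auto
    also have "\<dots> \<le> ennreal B * ennreal M" using M r by (intro mult_left_mono) auto
    also have "\<dots> < \<infinity>" by (simp add: ennreal_mult_less_top)
    finally show "(\<integral>\<^sup>+p. ennreal (norm (w1 p)) \<partial>PM) < \<infinity>" .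
  qed
  have i2: "integrable PM (\<lambda>p. w1 p + (C * B) * indicator {0<..<t} (fst p))"
    using i1 integrable_time_slab by (rule Bochner_Integration.integrable_add)
  show ?thesis
  proof (rule Bochner_Integration.integrable_bound[OF i2 integrand_measurable[OF \<psi>]], rule AE_I2)
    fix p :: "real \<times> (real^'n)"
    obtain \<sigma> \<xi> where p: "p = (\<sigma>, \<xi>)" by (cases p)
    have w1: "w1 p \<ge> 0" using B by (simp add: w1_def)
    show "norm (integrand \<psi> x t p) \<le> norm (w1 p + (C * B) * indicator {0<..<t} (fst p))"
    proof (cases "\<sigma> \<in> {0<..<t}")
      case True
      have "\<bar>normal_kernel (n \<xi>) (x - \<xi>) \<sigma> * \<psi> \<xi> (t - \<sigma>)\<bar> \<le> w1 p + C * B"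
      proof (cases "\<xi> \<in> ball x r")
        case in_ball: True
        have "\<bar>normal_kernel (n \<xi>) (x - \<xi>) \<sigma>\<bar> * \<bar>\<psi> \<xi> (t - \<sigma>)\<bar> \<le> \<bar>normal_kernel (n \<xi>) (x - \<xi>) \<sigma>\<bar> * B"
          using B by (intro mult_left_mono) auto
        also have "\<dots> = w1 p" using True in_ball by (simp add: w1_def p)
        finally show ?thesis using B C by (simp add: abs_mult add_increasing2)
      next
        case False
        then have "r \<le> norm (x - \<xi>)" by (simp add: dist_norm)
        then have "\<bar>normal_kernel (n \<xi>) (x - \<xi>) \<sigma>\<bar> * \<bar>\<psi> \<xi> (t - \<sigma>)\<bar> \<le> C * B"
          using B C by (intro mult_mono) (auto simp: less_imp_le)
        then show ?thesis using w1 by (simp add: abs_mult)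
      qed
      then show ?thesis using True B C w1 by (simp add: integrand_def p)
    qed (simp add: integrand_def p)
  qed
qed

lemma potential_iterated:
  assumes \<psi>: "density_ok \<psi>"
  shows "potential \<psi> x t = (\<integral>\<sigma>. indicator {0<..<t} \<sigma> * (\<integral>\<xi>. normal_kernel (n \<xi>) (x - \<xi>) \<sigma> * \<psi> \<xi> (t - \<sigma>) \<partial>\<mu>) \<partial>lborel)"
    "integrable lborel (\<lambda>\<sigma>. indicator {0<..<t} \<sigma> * (\<integral>\<xi>. normal_kernel (n \<xi>) (x - \<xi>) \<sigma> * \<psi> \<xi> (t - \<sigma>) \<partial>\<mu>))"
proof -
  have i: "integrable PM (\<lambda>(\<sigma>, \<xi>). integrand \<psi> x t (\<sigma>, \<xi>))"
    using integrable_integrand[OF \<psi>] by simp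
  have e: "(\<integral>\<xi>. integrand \<psi> x t (\<sigma>, \<xi>) \<partial>\<mu>) = indicator {0<..<t} \<sigma> * (\<integral>\<xi>. normal_kernel (n \<xi>) (x - \<xi>) \<sigma> * \<psi> \<xi> (t - \<sigma>) \<partial>\<mu>)" for \<sigma>
    by (simp add: integrand_def mult.assoc)
  show "potential \<psi> x t = (\<integral>\<sigma>. indicator {0<..<t} \<sigma> * (\<integral>\<xi>. normal_kernel (n \<xi>) (x - \<xi>) \<sigma> * \<psi> \<xi> (t - \<sigma>) \<partial>\<mu>) \<partial>lborel)"
    unfolding potential_def using P.integral_fst[OF i] by (simp add: e)
  show "integrable lborel (\<lambda>\<sigma>. indicator {0<..<t} \<sigma> * (\<integral>\<xi>. normal_kernel (n \<xi>) (x - \<xi>) \<sigma> * \<psi> \<xi> (t - \<sigma>) \<partial>\<mu>))"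
    using P.integrable_fst[OF i] by (simp add: e)
qed

lemma integrable_kernel_slice:
  assumes \<psi>: "density_ok \<psi>" and \<sigma>: "\<sigma> > 0"
  shows "integrable \<mu> (\<lambda>\<xi>. normal_kernel (n \<xi>) (x - \<xi>) \<sigma> * \<psi> \<xi> s)"
proof -
  obtain B where B: "B > 0" "\<And>\<xi> t. \<bar>\<psi> \<xi> t\<bar> \<le> B" using density_bound[OF \<psi>] by blast
  obtain C where C: "C > 0" "\<And>x \<xi> \<tau>. \<sigma> \<le> norm (x - \<xi>) \<or> \<sigma> \<le> \<tau> \<Longrightarrow> \<bar>normal_kernel (n \<xi>) (x - \<xi>) \<tau>\<bar> \<le> C"
    using far_kernel_bound[OF \<sigma>] by blast
  have [measurable]: "(\<lambda>\<xi>. \<psi> \<xi> s) \<in> borel_measurable borel" by (rule density_measurable[OF \<psi>]) measurable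
  show ?thesis
  proof (rule integrable_const_bound[of _ "C * B"])
    show "AE \<xi> in \<mu>. norm (normal_kernel (n \<xi>) (x - \<xi>) \<sigma> * \<psi> \<xi> s) \<le> C * B"
    proof (rule AE_I2)
      fix \<xi>
      have "\<bar>normal_kernel (n \<xi>) (x - \<xi>) \<sigma>\<bar> * \<bar>\<psi> \<xi> s\<bar> \<le> C * B"
        using B C by (intro mult_mono) (auto simp: less_imp_le)
      then show "norm (normal_kernel (n \<xi>) (x - \<xi>) \<sigma> * \<psi> \<xi> s) \<le> C * B" by (simp add: abs_mult)
    qed
  qed measurable
qed

text \<open>
Away from the singularity the kernel is bounded, so dominated convergence applies to the part of the integral outside
a neighbourhood of \<open>\<xi> = x0\<close>, \<open>\<sigma> = 0\<close>. Discontinuity can only come from that neighbourhood.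
\<close>

lemma potential_continuous_at:
  assumes \<psi>: "density_ok \<psi>"
    and near: "\<And>\<eta>. \<eta> > 0 \<Longrightarrow> \<exists>\<rho>>0. \<forall>x\<in>ball x0 \<rho>. \<forall>t. \<bar>t - t0\<bar> < \<rho> \<longrightarrow>
       (\<integral>\<^sup>+p. ennreal \<bar>integrand \<psi> x t p * indicator ({..<\<rho>} \<times> ball x0 \<rho>) p\<bar> \<partial>PM) \<le> ennreal \<eta>"
  shows "((\<lambda>(x, t). potential \<psi> x t) \<longlongrightarrow> potential \<psi> x0 t0) (at (x0, t0))"
proof (rule tendstoI)
  fix \<epsilon> :: real assume \<epsilon>: "\<epsilon> > 0"
  obtain B where B: "B > 0" "\<And>\<xi> t. \<bar>\<psi> \<xi> t\<bar> \<le> B" using density_bound[OF \<psi>] by blast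
  obtain \<rho> where \<rho>: "\<rho> > 0" and near\<rho>: "\<forall>x\<in>ball x0 \<rho>. \<forall>t. \<bar>t - t0\<bar> < \<rho> \<longrightarrow>
       (\<integral>\<^sup>+p. ennreal \<bar>integrand \<psi> x t p * indicator ({..<\<rho>} \<times> ball x0 \<rho>) p\<bar> \<partial>PM) \<le> ennreal (\<epsilon> / 4)"
    using near[of "\<epsilon> / 4"] \<epsilon> by auto
  define W where "W = {..<\<rho>} \<times> ball x0 \<rho>"
  have Wm[measurable]: "W \<in> sets PM" unfolding W_def by (intro pair_measureI) auto
  have \<rho>2: "\<rho> / 2 > 0" using \<rho> by simp
  obtain C where C: "C > 0" "\<And>x \<xi> \<sigma>. \<rho> / 2 \<le> norm (x - \<xi>) \<or> \<rho> / 2 \<le> \<sigma> \<Longrightarrow> \<bar>normal_kernel (n \<xi>) (x - \<xi>) \<sigma>\<bar> \<le> C"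
    using far_kernel_bound[OF \<rho>2] by blast
  note im[measurable] = integrand_measurable[OF \<psi>]
  define N where "N x t = (\<integral>p. integrand \<psi> x t p * indicator W p \<partial>PM)" for x t
  define F where "F x t = (\<integral>p. integrand \<psi> x t p * indicator (- W) p \<partial>PM)" for x t
  have iN: "integrable PM (\<lambda>p. integrand \<psi> x t p * indicator W p)" for x t
    by (rule Bochner_Integration.integrable_bound[OF integrable_integrand[OF \<psi>, of x t]])
      (auto simp: indicator_def)
  have iF: "integrable PM (\<lambda>p. integrand \<psi> x t p * indicator (- W) p)" for x t
    by (rule Bochner_Integration.integrable_bound[OF integrable_integrand[OF \<psi>, of x t]])
      (auto simp: indicator_def)
  have split: "potential \<psi> x t = N x t + F x t" for x t
    unfolding potential_def N_def F_def
    by (subst Bochner_Integration.integral_add[OF iN iF, symmetric]) (auto simp: indicator_def intro!: Bochner_Integration.integral_cong)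
  have Nb: "\<bar>N x t\<bar> \<le> \<epsilon> / 4" if "x \<in> ball x0 \<rho>" "\<bar>t - t0\<bar> < \<rho>" for x t
  proof -
    have "ennreal \<bar>N x t\<bar> \<le> (\<integral>\<^sup>+p. ennreal (norm (integrand \<psi> x t p * indicator W p)) \<partial>PM)"
      unfolding N_def using integral_norm_bound_ennreal[OF iN, of x t] by simp
    also have "\<dots> \<le> ennreal (\<epsilon> / 4)" using near\<rho> that by (simp add: W_def)
    finally show ?thesis using \<epsilon> by simp
  qed
  \<comment> \<open>The cut-off in time jumps at \<open>\<sigma> = t0\<close>, which is a null set.\<close>
  have "((\<lambda>q. \<integral>p. integrand \<psi> (fst q) (snd q) p * indicator (- W) p \<partial>PM) \<longlongrightarrow> (\<integral>p. integrand \<psi> x0 t0 p * indicator (- W) p \<partial>PM)) (at (x0, t0))"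
  proof (rule dominated_convergence_at[where w="\<lambda>p. (C * B) * indicator {0<..<t0 + 1} (fst p)"])
    show "integrable PM (\<lambda>p. (C * B) * indicator {0<..<t0 + 1} (fst p))" by (rule integrable_time_slab)
    show "AE p in PM. ((\<lambda>q. integrand \<psi> (fst q) (snd q) p * indicator (- W) p) \<longlongrightarrow> integrand \<psi> x0 t0 p * indicator (- W) p) (at (x0, t0))"
      using AE_time_neq[of t0]
    proof eventually_elim
      case (elim p)
      obtain \<sigma> \<xi> where p: "p = (\<sigma>, \<xi>)" by (cases p)
      have lx: "((\<lambda>q. fst q) \<longlongrightarrow> x0) (at (x0, t0))" and lt: "((\<lambda>q. snd q) \<longlongrightarrow> t0) (at (x0, t0))"
        using tendsto_fst[OF tendsto_ident_at, of "(x0, t0)"] tendsto_snd[OF tendsto_ident_at, of "(x0, t0)"] by simp_all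
      have li: "((\<lambda>q. indicator {0<..<snd q} \<sigma> :: real) \<longlongrightarrow> indicator {0<..<t0} \<sigma>) (at (x0, t0))"
        using elim p by (intro indicator_Ioo_tendsto lt) simp
      show ?case
      proof (cases "\<sigma> > 0")
        case True
        show ?thesis unfolding integrand_def p
          using True by (auto intro!: tendsto_intros li normal_kernel_tendsto density_tendsto[OF \<psi>] lx lt)
      qed (simp add: integrand_def p)
    qed
    have "eventually (\<lambda>q. q \<in> ball x0 (\<rho> / 2) \<times> {..<t0 + 1}) (at (x0, t0))"
    proof (rule eventually_at_in_open')
      show "open (ball x0 (\<rho> / 2) \<times> {..<t0 + 1})" by (intro open_Times) auto
      show "(x0, t0) \<in> ball x0 (\<rho> / 2) \<times> {..<t0 + 1}" using \<rho> by simp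
    qed
    then show "eventually (\<lambda>q. AE p in PM. \<bar>integrand \<psi> (fst q) (snd q) p * indicator (- W) p\<bar> \<le> (C * B) * indicator {0<..<t0 + 1} (fst p)) (at (x0, t0))"
    proof eventually_elim
      case (elim q)
      show ?case
      proof (rule AE_I2)
        fix p :: "real \<times> (real^'n)"
        obtain \<sigma> \<xi> where p: "p = (\<sigma>, \<xi>)" by (cases p)
        show "\<bar>integrand \<psi> (fst q) (snd q) p * indicator (- W) p\<bar> \<le> (C * B) * indicator {0<..<t0 + 1} (fst p)"
        proof (cases "p \<notin> W \<and> \<sigma> \<in> {0<..<snd q}")
          case True
          have "dist x0 (fst q) < \<rho> / 2" using elim by (auto simp: mem_Times_iff)
          moreover have "\<rho> \<le> dist x0 \<xi> \<or> \<rho> \<le> \<sigma>" using True by (auto simp: W_def p)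
          ultimately have "\<rho> / 2 \<le> norm (fst q - \<xi>) \<or> \<rho> / 2 \<le> \<sigma>"
            using dist_triangle[of x0 \<xi> "fst q"] \<rho> unfolding dist_norm by linarith
          then have "\<bar>normal_kernel (n \<xi>) (fst q - \<xi>) \<sigma>\<bar> * \<bar>\<psi> \<xi> (snd q - \<sigma>)\<bar> \<le> C * B"
            using B C by (intro mult_mono) (auto simp: less_imp_le)
          moreover have "\<sigma> < t0 + 1" using True elim by (auto simp: mem_Times_iff)
          ultimately show ?thesis using True by (simp add: integrand_def p abs_mult)
        next
          case False
          then show ?thesis using B C by (auto simp: integrand_def p indicator_def)
        qed
      qed
    qed
  qed measurable
  then have "((\<lambda>q. F (fst q) (snd q)) \<longlongrightarrow> F x0 t0) (at (x0, t0))" by (simp add: F_def)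
  then have "eventually (\<lambda>q. dist (F (fst q) (snd q)) (F x0 t0) < \<epsilon> / 2) (at (x0, t0))"
    using \<epsilon> by (intro tendstoD) auto
  moreover have "eventually (\<lambda>q. q \<in> ball x0 \<rho> \<times> {t0 - \<rho><..<t0 + \<rho>}) (at (x0, t0))"
    using \<rho> by (intro eventually_at_in_open') (auto intro!: open_Times)
  ultimately show "eventually (\<lambda>q. dist (case q of (x, t) \<Rightarrow> potential \<psi> x t) (potential \<psi> x0 t0) < \<epsilon>) (at (x0, t0))"
  proof eventually_elim
    case (elim q)
    have "\<bar>N (fst q) (snd q)\<bar> \<le> \<epsilon> / 4" using elim(2) by (intro Nb) (auto simp: mem_Times_iff)
    moreover have "\<bar>N x0 t0\<bar> \<le> \<epsilon> / 4" using \<rho> by (intro Nb) auto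
    ultimately have "dist (potential \<psi> (fst q) (snd q)) (potential \<psi> x0 t0) < \<epsilon>"
      using elim(1) \<epsilon> unfolding split dist_real_def by linarith
    then show ?case by (simp add: case_prod_beta')
  qed
qed

lemma potential_continuous_off_support:
  assumes \<psi>: "density_ok \<psi>" and r: "r > 0" "emeasure \<mu> (ball x0 r) = 0"
  shows "((\<lambda>(x, t). potential \<psi> x t) \<longlongrightarrow> potential \<psi> x0 t0) (at (x0, t0))"
proof (rule potential_continuous_at[OF \<psi>])
  fix \<eta> :: real assume "\<eta> > 0"
  have z: "emeasure PM (UNIV \<times> ball x0 r) = 0"
    using r by (subst emeasure_pair_measure_Times) auto
  have "AE p in PM. p \<notin> UNIV \<times> ball x0 r"
    by (rule AE_not_in) (use z in \<open>auto simp: null_sets_def intro!: pair_measureI\<close>)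
  then have "(\<integral>\<^sup>+p. ennreal \<bar>integrand \<psi> x t p * indicator ({..<r} \<times> ball x0 r) p\<bar> \<partial>PM) = (\<integral>\<^sup>+p. 0 \<partial>PM)" for x t
    by (intro nn_integral_cong_AE) (auto simp: indicator_def elim!: eventually_mono)
  then show "\<exists>\<rho>>0. \<forall>x\<in>ball x0 \<rho>. \<forall>t. \<bar>t - t0\<bar> < \<rho> \<longrightarrow>
       (\<integral>\<^sup>+p. ennreal \<bar>integrand \<psi> x t p * indicator ({..<\<rho>} \<times> ball x0 \<rho>) p\<bar> \<partial>PM) \<le> ennreal \<eta>"
    using r by (intro exI[of _ r]) auto
qed

text \<open>
Near \<open>(x0, t0)\<close> the density is at most \<open>\<beta>\<close>, so the near part of the potential is at most \<open>\<beta>\<close> times the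
uniform bound of the mass of the kernel.
\<close>

lemma potential_continuous_at_zero_of_density:
  assumes \<psi>: "density_ok \<psi>" and z: "\<psi> x0 t0 = 0"
  shows "((\<lambda>(x, t). potential \<psi> x t) \<longlongrightarrow> potential \<psi> x0 t0) (at (x0, t0))"
proof (rule potential_continuous_at[OF \<psi>])
  fix \<eta> :: real assume \<eta>: "\<eta> > 0"
  obtain r M where r: "r > 0" "M \<ge> 0" and M: "\<forall>x\<in>ball x0 r.
      near_mass \<mu> n x0 r (t0 + 1) x \<le> ennreal M"
    using near_bound[of x0 "t0 + 1"] by blast
  \<comment> \<open>\<open>M\<close> may be \<open>0\<close>.\<close>
  define \<beta> where "\<beta> = \<eta> / (M + 1)"
  have \<beta>: "\<beta> > 0" "\<beta> * M \<le> \<eta>" using \<eta> r by (auto simp: \<beta>_def field_simps add_nonneg_pos)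
  have "isCont (\<lambda>(\<xi>, t). \<psi> \<xi> t) (x0, t0)"
    using \<psi> by (auto simp: density_ok_def continuous_on_eq_continuous_at)
  then obtain d where d: "d > 0" "\<And>q. dist q (x0, t0) < d \<Longrightarrow> \<bar>\<psi> (fst q) (snd q)\<bar> < \<beta>"
    using \<beta>(1) z unfolding continuous_at_eps_delta by (force simp: dist_real_def case_prod_beta')
  define \<rho> where "\<rho> = Min {r, d / 4, 1}"
  have \<rho>: "\<rho> > 0" "\<rho> \<le> r" "\<rho> \<le> d / 4" "\<rho> \<le> 1" using r d by (auto simp: \<rho>_def)
  have "(\<integral>\<^sup>+p. ennreal \<bar>integrand \<psi> x t p * indicator ({..<\<rho>} \<times> ball x0 \<rho>) p\<bar> \<partial>PM) \<le> ennreal \<eta>"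
    if x: "x \<in> ball x0 \<rho>" and t: "\<bar>t - t0\<bar> < \<rho>" for x t
  proof -
    have "(\<integral>\<^sup>+p. ennreal \<bar>integrand \<psi> x t p * indicator ({..<\<rho>} \<times> ball x0 \<rho>) p\<bar> \<partial>PM)
      \<le> (\<integral>\<^sup>+p. ennreal (\<beta> * (indicator {0<..<t0 + 1} (fst p) * indicator (ball x0 r) (snd p) * \<bar>normal_kernel (n (snd p)) (x - snd p) (fst p)\<bar>)) \<partial>PM)"
    proof (intro nn_integral_mono ennreal_leI)
      fix p :: "real \<times> (real^'n)"
      obtain \<sigma> \<xi> where p: "p = (\<sigma>, \<xi>)" by (cases p)
      show "\<bar>integrand \<psi> x t p * indicator ({..<\<rho>} \<times> ball x0 \<rho>) p\<bar>
        \<le> \<beta> * (indicator {0<..<t0 + 1} (fst p) * indicator (ball x0 r) (snd p) * \<bar>normal_kernel (n (snd p)) (x - snd p) (fst p)\<bar>)"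
      proof (cases "\<sigma> < \<rho> \<and> \<xi> \<in> ball x0 \<rho> \<and> \<sigma> \<in> {0<..<t}")
        case True
        have "dist (\<xi>, t - \<sigma>) (x0, t0) \<le> dist \<xi> x0 + dist (t - \<sigma>) t0"
          unfolding dist_Pair_Pair by (rule sqrt_sum_squares_le_sum) auto
        also have "\<dots> < d" using True t \<rho> by (auto simp: dist_commute dist_real_def)
        finally have "\<bar>\<psi> \<xi> (t - \<sigma>)\<bar> \<le> \<beta>" using d(2)[of "(\<xi>, t - \<sigma>)"] by simp
        then have "\<bar>normal_kernel (n \<xi>) (x - \<xi>) \<sigma>\<bar> * \<bar>\<psi> \<xi> (t - \<sigma>)\<bar> \<le> \<bar>normal_kernel (n \<xi>) (x - \<xi>) \<sigma>\<bar> * \<beta>"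
          by (intro mult_left_mono) auto
        moreover have "\<sigma> < t0 + 1" "\<xi> \<in> ball x0 r" using True t \<rho> by auto
        ultimately show ?thesis using True by (simp add: integrand_def p abs_mult mult.commute)
      next
        case False
        then show ?thesis using \<beta>(1) by (auto simp: integrand_def p indicator_def)
      qed
    qed
    also have "\<dots> = ennreal \<beta> * near_mass \<mu> n x0 r (t0 + 1) x"
      using \<beta> by (intro nn_integral_near) auto
    also have "\<dots> \<le> ennreal \<beta> * ennreal M" using M x \<rho> by (intro mult_left_mono) auto
    also have "\<dots> \<le> ennreal \<eta>" using \<beta> r by (simp add: ennreal_mult[symmetric] ennreal_leI)
    finally show ?thesis .
  qed
  then show "\<exists>\<rho>>0. \<forall>x\<in>ball x0 \<rho>. \<forall>t. \<bar>t - t0\<bar> < \<rho> \<longrightarrow>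
       (\<integral>\<^sup>+p. ennreal \<bar>integrand \<psi> x t p * indicator ({..<\<rho>} \<times> ball x0 \<rho>) p\<bar> \<partial>PM) \<le> ennreal \<eta>"
    using \<rho>(1) by blast
qed

end

section \<open>Convolution with the heat kernel\<close>

lemma integral_lborel_affine:
  fixes f :: "'a::euclidean_space \<Rightarrow> real"
  assumes [measurable]: "f \<in> borel_measurable borel" and c: "c > 0"
  shows "(\<integral>x. f x \<partial>lborel) = (\<integral>z. c ^ DIM('a) * f (x + c *\<^sub>R z) \<partial>lborel)"
proof -
  have "(\<integral>x. f x \<partial>lborel) = (\<integral>y. f y \<partial>density (distr lborel borel (\<lambda>z. x + c *\<^sub>R z)) (\<lambda>_. ennreal (\<bar>c\<bar> ^ DIM('a))))"
    using lborel_affine[of c x] c by simp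
  also have "\<dots> = (\<integral>y. \<bar>c\<bar> ^ DIM('a) *\<^sub>R f y \<partial>distr lborel borel (\<lambda>z. x + c *\<^sub>R z))"
    by (rule integral_density) auto
  also have "\<dots> = (\<integral>z. c ^ DIM('a) * f (x + c *\<^sub>R z) \<partial>lborel)"
    using c by (subst integral_distr) auto
  finally show ?thesis .
qed

lemma truncated_integral_tendsto:
  fixes u :: "real \<Rightarrow> real"
  assumes [measurable]: "u \<in> borel_measurable borel" and ui: "integrable lborel (\<lambda>\<sigma>. indicator {0<..<t} \<sigma> * u \<sigma>)"
  shows "((\<lambda>\<delta>. \<integral>\<sigma>. indicator {\<delta>..t} \<sigma> * (indicator {0<..<t} \<sigma> * u \<sigma>) \<partial>lborel) \<longlongrightarrow> (\<integral>\<sigma>. indicator {0<..<t} \<sigma> * u \<sigma> \<partial>lborel)) (at_right 0)"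
proof (rule dominated_convergence_at[where w="\<lambda>\<sigma>. \<bar>indicator {0<..<t} \<sigma> * u \<sigma>\<bar>"])
  show "integrable lborel (\<lambda>\<sigma>. \<bar>indicator {0<..<t} \<sigma> * u \<sigma>\<bar>)" using ui by (rule integrable_abs)
  show "AE \<sigma> in lborel. ((\<lambda>\<delta>. indicator {\<delta>..t} \<sigma> * (indicator {0<..<t} \<sigma> * u \<sigma>)) \<longlongrightarrow> indicator {0<..<t} \<sigma> * u \<sigma>) (at_right 0)"
  proof (rule AE_I2)
    fix \<sigma> :: real
    show "((\<lambda>\<delta>. indicator {\<delta>..t} \<sigma> * (indicator {0<..<t} \<sigma> * u \<sigma>)) \<longlongrightarrow> indicator {0<..<t} \<sigma> * u \<sigma>) (at_right 0)"
    proof (cases "\<sigma> \<in> {0<..<t}")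
      case True
      then have "eventually (\<lambda>\<delta>. \<delta> < \<sigma>) (at_right 0)" by (intro order_tendstoD[OF tendsto_ident_at]) auto
      then have "eventually (\<lambda>\<delta>. indicator {\<delta>..t} \<sigma> * (indicator {0<..<t} \<sigma> * u \<sigma>) = indicator {0<..<t} \<sigma> * u \<sigma>) (at_right 0)"
        by eventually_elim (use True in \<open>auto simp: indicator_def\<close>)
      then show ?thesis by (rule tendsto_eventually)
    qed simp
  qed
  show "\<forall>\<^sub>F \<delta> in at_right 0. AE \<sigma> in lborel. \<bar>indicator {\<delta>..t} \<sigma> * (indicator {0<..<t} \<sigma> * u \<sigma>)\<bar> \<le> \<bar>indicator {0<..<t} \<sigma> * u \<sigma>\<bar>"
    by (intro always_eventually allI AE_I2) (auto simp: indicator_def)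
qed measurable

lemma heat_kernel_scaling:
  assumes "\<delta> > 0"
  shows "sqrt \<delta> ^ CARD('n) * heat_kernel (sqrt \<delta> *\<^sub>R (z::real^'n)) \<delta> = heat_kernel z 1"
proof -
  have "sqrt \<delta> ^ CARD('n) = \<delta> powr (real CARD('n) / 2)"
    using assms by (simp add: powr_half_sqrt[symmetric] powr_powr flip: powr_realpow)
  moreover have "(norm (sqrt \<delta> *\<^sub>R z))\<^sup>2 / (4 * \<delta>) = (norm z)\<^sup>2 / 4"
    using assms by (simp add: power_mult_distrib)
  moreover have "\<delta> powr (real CARD('n) / 2) * (4 * pi * \<delta>) powr (- real CARD('n) / 2) = (4 * pi) powr (- real CARD('n) / 2)"
    using assms by (simp add: powr_mult powr_minus field_simps)
  ultimately show ?thesis using assms by (simp add: heat_kernel_def mult.assoc[symmetric])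
qed

lemma heat_kernel_uminus [simp]: "heat_kernel (- z) \<sigma> = heat_kernel z \<sigma>"
  by (simp add: heat_kernel_def)

lemma heat_kernel_le:
  assumes "0 < a" "a \<le> \<sigma>"
  shows "heat_kernel (z::real^'n) \<sigma> \<le> (4 * pi * a) powr (- real CARD('n) / 2)"
proof -
  have "heat_kernel z \<sigma> \<le> (4 * pi * \<sigma>) powr (- real CARD('n) / 2) * 1"
    unfolding heat_kernel_def using assms by (auto intro!: mult_left_mono)
  also have "(4 * pi * \<sigma>) powr (- real CARD('n) / 2) \<le> (4 * pi * a) powr (- real CARD('n) / 2)"
    using assms by (intro powr_mono2') auto
  finally show ?thesis by simp
qed

lemma has_integral_heat_kernel:
  assumes "\<sigma> > 0"
  shows "integrable lborel (\<lambda>z::real^'n. heat_kernel z \<sigma>)" "(\<integral>z. heat_kernel (z::real^'n) \<sigma> \<partial>lborel) = 1"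
proof -
  have "(\<integral>\<^sup>+z. ennreal (heat_kernel (z::real^'n) \<sigma>) \<partial>lborel)
    = (\<integral>\<^sup>+z. ennreal ((4 * pi * \<sigma>) powr (- real CARD('n) / 2)) * ennreal (exp (- (1 / (4 * \<sigma>)) * (norm ((z::real^'n) - 0))\<^sup>2)) \<partial>lborel)"
    using assms by (intro nn_integral_cong) (simp add: heat_kernel_def ennreal_mult)
  also have "\<dots> = ennreal ((4 * pi * \<sigma>) powr (- real CARD('n) / 2)) * ennreal ((pi / (1 / (4 * \<sigma>))) powr (real CARD('n) / 2))"
    using assms by (subst nn_integral_cmult, simp, subst nn_integral_gaussian) auto
  also have "\<dots> = ennreal 1"
    using assms by (simp add: ennreal_mult[symmetric] powr_add[symmetric] mult_ac)
  finally have *: "(\<integral>\<^sup>+z. ennreal (heat_kernel (z::real^'n) \<sigma>) \<partial>lborel) = ennreal 1" .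
  show "integrable lborel (\<lambda>z::real^'n. heat_kernel z \<sigma>)"
    by (rule integrableI_nonneg) (simp_all add: *)
  show "(\<integral>z. heat_kernel (z::real^'n) \<sigma> \<partial>lborel) = 1"
    by (subst integral_eq_nn_integral) (simp_all add: *)
qed

lemma heat_convolution_tendsto:
  fixes h :: "real^'n \<Rightarrow> real"
  assumes h: "integrable lborel h" and t0: "t0 > 0"
  shows "((\<lambda>(x, t). \<integral>\<xi>. h \<xi> * heat_kernel (x - \<xi>) t \<partial>lborel) \<longlongrightarrow> (\<integral>\<xi>. h \<xi> * heat_kernel (x0 - \<xi>) t0 \<partial>lborel)) (at (x0, t0))"
proof -
  have [measurable]: "h \<in> borel_measurable borel" using h by simp
  define C where "C = (4 * pi * (t0 / 2)) powr (- real CARD('n) / 2)"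
  have "((\<lambda>q. \<integral>\<xi>. h \<xi> * heat_kernel (fst q - \<xi>) (snd q) \<partial>lborel) \<longlongrightarrow> (\<integral>\<xi>. h \<xi> * heat_kernel (x0 - \<xi>) t0 \<partial>lborel)) (at (x0, t0))"
  proof (rule dominated_convergence_at[where w="\<lambda>\<xi>. \<bar>h \<xi>\<bar> * C"])
    show "integrable lborel (\<lambda>\<xi>. \<bar>h \<xi>\<bar> * C)" using h by (intro integrable_mult_left integrable_abs)
    have lx: "((\<lambda>q. fst q) \<longlongrightarrow> x0) (at (x0, t0))" and lt: "((\<lambda>q. snd q) \<longlongrightarrow> t0) (at (x0, t0))"
      using tendsto_fst[OF tendsto_ident_at, of "(x0, t0)"] tendsto_snd[OF tendsto_ident_at, of "(x0, t0)"] by simp_all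
    show "AE \<xi> in lborel. ((\<lambda>q. h \<xi> * heat_kernel (fst q - \<xi>) (snd q)) \<longlongrightarrow> h \<xi> * heat_kernel (x0 - \<xi>) t0) (at (x0, t0))"
      by (intro AE_I2 tendsto_mult tendsto_const heat_kernel_tendsto tendsto_diff lx lt t0)
    have "eventually (\<lambda>q. t0 / 2 < snd q) (at (x0, t0))" by (rule order_tendstoD(1)[OF lt]) (use t0 in simp)
    then show "eventually (\<lambda>q. AE \<xi> in lborel. \<bar>h \<xi> * heat_kernel (fst q - \<xi>) (snd q)\<bar> \<le> \<bar>h \<xi>\<bar> * C) (at (x0, t0))"
    proof eventually_elim
      case (elim q)
      have "heat_kernel (fst q - \<xi>) (snd q) \<le> C" for \<xi>
        unfolding C_def by (rule heat_kernel_le) (use elim t0 in auto)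
      then show ?case unfolding abs_mult
        by (intro AE_I2 mult_left_mono) auto
    qed
  qed measurable
  then show ?thesis by (simp add: case_prod_beta')
qed

text \<open>
In the scaled variable \<open>\<xi> = x + sqrt \<delta> z\<close> the heat kernel at time \<open>\<delta>\<close> becomes the one at time \<open>1\<close>, so for small
times the convolution only sees the blow-up of \<open>h\<close> at \<open>x\<close>.
\<close>

lemma heat_convolution_small_time:
  fixes h :: "real^'n \<Rightarrow> real"
  assumes [measurable]: "h \<in> borel_measurable borel" and B: "\<And>\<xi>. \<bar>h \<xi>\<bar> \<le> B"
    and [measurable]: "l \<in> borel_measurable borel"
    and lim: "AE z in lborel. ((\<lambda>\<delta>. h (x + sqrt \<delta> *\<^sub>R z)) \<longlongrightarrow> l z) (at_right 0)"
  shows "((\<lambda>\<delta>. \<integral>\<xi>. h \<xi> * heat_kernel (x - \<xi>) \<delta> \<partial>lborel) \<longlongrightarrow> (\<integral>z. l z * heat_kernel z 1 \<partial>lborel)) (at_right 0)"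
proof -
  have eq: "(\<integral>\<xi>. h \<xi> * heat_kernel (x - \<xi>) \<delta> \<partial>lborel) = (\<integral>z. h (x + sqrt \<delta> *\<^sub>R z) * heat_kernel z 1 \<partial>lborel)" if "\<delta> > 0" for \<delta>
  proof -
    have "(\<integral>\<xi>. h \<xi> * heat_kernel (x - \<xi>) \<delta> \<partial>lborel)
      = (\<integral>z. sqrt \<delta> ^ CARD('n) * (h (x + sqrt \<delta> *\<^sub>R z) * heat_kernel (x - (x + sqrt \<delta> *\<^sub>R z)) \<delta>) \<partial>lborel)"
      using that by (subst integral_lborel_affine[of _ "sqrt \<delta>" x]) auto
    also have "\<dots> = (\<integral>z. h (x + sqrt \<delta> *\<^sub>R z) * heat_kernel z 1 \<partial>lborel)"
      by (intro Bochner_Integration.integral_cong) (simp_all add: heat_kernel_scaling[OF that, symmetric])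
    finally show ?thesis .
  qed
  have "((\<lambda>\<delta>. \<integral>z. h (x + sqrt \<delta> *\<^sub>R z) * heat_kernel z 1 \<partial>lborel) \<longlongrightarrow> (\<integral>z. l z * heat_kernel z 1 \<partial>lborel)) (at_right 0)"
  proof (rule dominated_convergence_at[where w="\<lambda>z. B * heat_kernel z 1"])
    show "integrable lborel (\<lambda>z. B * heat_kernel (z::real^'n) 1)" by (intro integrable_mult_right has_integral_heat_kernel) simp
    show "AE z in lborel. ((\<lambda>\<delta>. h (x + sqrt \<delta> *\<^sub>R z) * heat_kernel z 1) \<longlongrightarrow> l z * heat_kernel z 1) (at_right 0)"
      using lim by eventually_elim (intro tendsto_mult tendsto_const)
    show "\<forall>\<^sub>F \<delta> in at_right 0. AE z in lborel. \<bar>h (x + sqrt \<delta> *\<^sub>R z) * heat_kernel z 1\<bar> \<le> B * heat_kernel z 1"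
      by (intro always_eventually allI AE_I2) (simp add: abs_mult mult_right_mono B)
  qed measurable
  then show ?thesis
    by (rule Lim_transform_eventually) (auto simp: eventually_at_filter eq)
qed

lemma abs_normal_kernel_gaussian:
  assumes \<sigma>: "\<sigma> > 0"
  shows "\<bar>normal_kernel v (z::real^'n) \<sigma>\<bar> \<le> norm v * (\<sigma> powr (- 1 / 2) * (4 * pi * \<sigma>) powr (- real CARD('n) / 2)) * exp (- (1 / (8 * \<sigma>)) * (norm z)\<^sup>2)"
proof -
  define w where "w = norm z / (2 * sqrt \<sigma>)"
  have w: "w \<ge> 0" "norm z = 2 * sqrt \<sigma> * w" "(norm z)\<^sup>2 = 4 * \<sigma> * w\<^sup>2"
    using \<sigma> by (simp_all add: w_def power_divide power_mult_distrib)
  have "w \<le> exp (w\<^sup>2 / 2)"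
  proof -
    have "0 \<le> (w - 1)\<^sup>2" by simp
    then have "w \<le> 1 + w\<^sup>2 / 2" by (simp add: power2_eq_square algebra_simps)
    then show ?thesis using exp_ge_add_one_self[of "w\<^sup>2 / 2"] by linarith
  qed
  then have "w * exp (- w\<^sup>2) \<le> exp (w\<^sup>2 / 2) * exp (- w\<^sup>2)" by (intro mult_right_mono) auto
  also have "\<dots> = exp (- (w\<^sup>2 / 2))" by (simp add: exp_add[symmetric])
  finally have we: "w * exp (- w\<^sup>2) \<le> exp (- (w\<^sup>2 / 2))" .
  have "\<bar>z \<bullet> v\<bar> \<le> norm z * norm v" by (rule Cauchy_Schwarz_ineq2)
  then have "\<bar>normal_kernel v z \<sigma>\<bar> \<le> heat_kernel z \<sigma> * (norm z * norm v) / (2 * \<sigma>)"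
    using \<sigma> unfolding normal_kernel_def abs_mult abs_divide by (intro divide_mono mult_mono) auto
  also have "\<dots> = norm v * ((sqrt \<sigma> / \<sigma>) * (4 * pi * \<sigma>) powr (- real CARD('n) / 2)) * (w * exp (- w\<^sup>2))"
  proof -
    have "(norm z)\<^sup>2 / (4 * \<sigma>) = w\<^sup>2" using \<sigma> w(3) by simp
    then have "heat_kernel z \<sigma> = (4 * pi * \<sigma>) powr (- real CARD('n) / 2) * exp (- w\<^sup>2)"
      using \<sigma> by (simp add: heat_kernel_def)
    then show ?thesis by (simp add: w(2))
  qed
  also have "\<dots> \<le> norm v * ((sqrt \<sigma> / \<sigma>) * (4 * pi * \<sigma>) powr (- real CARD('n) / 2)) * exp (- (w\<^sup>2 / 2))"
    using we \<sigma> by (intro mult_left_mono) auto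
  also have "sqrt \<sigma> / \<sigma> = \<sigma> powr (- 1 / 2)"
  proof -
    have "\<sigma> powr (- (1 / 2)) = inverse (\<sigma> powr (1 / 2))" by (rule powr_minus)
    also have "\<dots> = sqrt \<sigma> / \<sigma>" using \<sigma> by (simp only: powr_half_sqrt sqrt_divide_self_eq less_imp_le)
    finally show ?thesis by simp
  qed
  also have "w\<^sup>2 / 2 = (1 / (8 * \<sigma>)) * (norm z)\<^sup>2" using \<sigma> w(3) by simp
  finally show ?thesis by simp
qed

text \<open>
In space the gradient of the heat kernel has an integral of order \<open>\<sigma> powr (- 1 / 2)\<close>, which is integrable in time.
This is why volume potentials of the gradient are continuous even for discontinuous \<open>h\<close>.
\<close>

lemma gradient_convolution_bound:
  fixes h :: "real^'n \<Rightarrow> real^'n"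
  assumes [measurable]: "h \<in> borel_measurable borel" and B: "\<And>\<xi>. norm (h \<xi>) \<le> B" and \<sigma>: "\<sigma> > 0"
  shows "integrable lborel (\<lambda>\<xi>. normal_kernel (h \<xi>) (x - \<xi>) \<sigma>)"
    "\<bar>\<integral>\<xi>. normal_kernel (h \<xi>) (x - \<xi>) \<sigma> \<partial>lborel\<bar> \<le> B * 2 powr (real CARD('n) / 2) * \<sigma> powr (- 1 / 2)"
proof -
  define c where "c = B * (\<sigma> powr (- 1 / 2) * (4 * pi * \<sigma>) powr (- real CARD('n) / 2))"
  have B0: "B \<ge> 0" using B[of 0] norm_ge_zero order_trans by blast
  then have c: "c \<ge> 0" by (simp add: c_def)
  have pw: "\<bar>normal_kernel (h \<xi>) (x - \<xi>) \<sigma>\<bar> \<le> c * exp (- (1 / (8 * \<sigma>)) * (norm (\<xi> - x))\<^sup>2)" for \<xi>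
  proof -
    have "\<bar>normal_kernel (h \<xi>) (x - \<xi>) \<sigma>\<bar> \<le> norm (h \<xi>) * (\<sigma> powr (- 1 / 2) * (4 * pi * \<sigma>) powr (- real CARD('n) / 2)) * exp (- (1 / (8 * \<sigma>)) * (norm (x - \<xi>))\<^sup>2)"
      by (rule abs_normal_kernel_gaussian[OF \<sigma>])
    also have "\<dots> \<le> c * exp (- (1 / (8 * \<sigma>)) * (norm (x - \<xi>))\<^sup>2)"
      unfolding c_def by (intro mult_right_mono B) auto
    finally show ?thesis by (simp add: norm_minus_commute)
  qed
  have "(\<integral>\<^sup>+\<xi>. ennreal (c * exp (- (1 / (8 * \<sigma>)) * (norm (\<xi> - x))\<^sup>2)) \<partial>lborel) = ennreal c * ennreal ((pi / (1 / (8 * \<sigma>))) powr (real CARD('n) / 2))"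
    using c \<sigma> by (simp only: ennreal_mult exp_ge_zero) (subst nn_integral_cmult, simp, subst nn_integral_gaussian, simp_all)
  also have "\<dots> = ennreal (B * 2 powr (real CARD('n) / 2) * \<sigma> powr (- 1 / 2))"
  proof -
    have "(pi / (1 / (8 * \<sigma>))) powr (real CARD('n) / 2) = 2 powr (real CARD('n) / 2) * (4 * pi * \<sigma>) powr (real CARD('n) / 2)"
      using \<sigma> by (simp add: powr_mult[symmetric] mult_ac)
    moreover have "(4 * pi * \<sigma>) powr (- real CARD('n) / 2) * (4 * pi * \<sigma>) powr (real CARD('n) / 2) = 1"
      using \<sigma> by (simp add: powr_add[symmetric])
    ultimately show ?thesis using c by (simp add: ennreal_mult[symmetric] c_def mult_ac)
  qed
  finally have nn: "(\<integral>\<^sup>+\<xi>. ennreal (c * exp (- (1 / (8 * \<sigma>)) * (norm (\<xi> - x))\<^sup>2)) \<partial>lborel) = ennreal (B * 2 powr (real CARD('n) / 2) * \<sigma> powr (- 1 / 2))" .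
  have le: "(\<integral>\<^sup>+\<xi>. ennreal \<bar>normal_kernel (h \<xi>) (x - \<xi>) \<sigma>\<bar> \<partial>lborel) \<le> ennreal (B * 2 powr (real CARD('n) / 2) * \<sigma> powr (- 1 / 2))"
    unfolding nn[symmetric] by (intro nn_integral_mono ennreal_leI pw)
  show i: "integrable lborel (\<lambda>\<xi>. normal_kernel (h \<xi>) (x - \<xi>) \<sigma>)"
    using le by (intro integrableI_bounded) (auto simp: less_top[symmetric] top_unique intro: le_less_trans)
  have "ennreal \<bar>\<integral>\<xi>. normal_kernel (h \<xi>) (x - \<xi>) \<sigma> \<partial>lborel\<bar> \<le> (\<integral>\<^sup>+\<xi>. ennreal \<bar>normal_kernel (h \<xi>) (x - \<xi>) \<sigma>\<bar> \<partial>lborel)"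
    using integral_norm_bound_ennreal[OF i] by simp
  also note le
  finally show "\<bar>\<integral>\<xi>. normal_kernel (h \<xi>) (x - \<xi>) \<sigma> \<partial>lborel\<bar> \<le> B * 2 powr (real CARD('n) / 2) * \<sigma> powr (- 1 / 2)"
    using B0 by simp
qed

lemma integrable_powr_half: "integrable lborel (\<lambda>\<sigma>. c * (\<sigma> powr (- 1 / 2) * indicator {0<..<T} \<sigma>) :: real)"
proof (intro integrable_mult_right integrableI_bounded)
  have "(\<integral>\<^sup>+\<sigma>. ennreal (norm (\<sigma> powr (- 1 / 2) * indicator {0<..<T} \<sigma> :: real)) \<partial>lborel)
    = (\<integral>\<^sup>+\<sigma>. ennreal (\<sigma> powr (1 / 2 - 1)) * indicator {0<..<max T 0} \<sigma> \<partial>lborel)"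
    by (intro nn_integral_cong) (auto simp: indicator_def)
  also have "\<dots> \<le> ennreal (max T 0 powr (1 / 2) / (1 / 2))" by (rule nn_integral_powr_Ioo) auto
  also have "\<dots> < \<infinity>" by simp
  finally show "(\<integral>\<^sup>+\<sigma>. ennreal (norm (\<sigma> powr (- 1 / 2) * indicator {0<..<T} \<sigma> :: real)) \<partial>lborel) < \<infinity>" .
qed measurable

definition gradient_potential :: "(real^'n \<Rightarrow> real^'n) \<Rightarrow> real^'n \<Rightarrow> real \<Rightarrow> real" where
  "gradient_potential h x t = (\<integral>\<sigma>. indicator {0<..<t} \<sigma> * (\<integral>\<xi>. normal_kernel (h \<xi>) (x - \<xi>) \<sigma> \<partial>lborel) \<partial>lborel)"

lemma gradient_potential_tendsto:
  fixes h :: "real^'n \<Rightarrow> real^'n"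
  assumes hi: "integrable lborel h" and B: "\<And>\<xi>. norm (h \<xi>) \<le> B"
  shows "((\<lambda>(x, t). gradient_potential h x t) \<longlongrightarrow> gradient_potential h x0 t0) (at (x0, t0))"
    and gradient_potential_integrable: "integrable lborel (\<lambda>\<sigma>. indicator {0<..<t} \<sigma> * (\<integral>\<xi>. normal_kernel (h \<xi>) (x - \<xi>) \<sigma> \<partial>lborel))"
proof -
  have [measurable]: "h \<in> borel_measurable borel" using hi by simp
  define c where "c = B * 2 powr (real CARD('n) / 2)"
  have B0: "B \<ge> 0" using B[of 0] norm_ge_zero order_trans by blast
  have b: "\<bar>indicator {0<..<t} \<sigma> * (\<integral>\<xi>. normal_kernel (h \<xi>) (x - \<xi>) \<sigma> \<partial>lborel)\<bar> \<le> c * (\<sigma> powr (- 1 / 2) * indicator {0<..<T} \<sigma>)"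
    if "t \<le> T" for x t T \<sigma>
    using that gradient_convolution_bound(2)[where h=h and B=B and \<sigma>=\<sigma> and x=x, OF _ B] B0 by (auto simp: indicator_def c_def)
  have m: "(\<lambda>\<sigma>. indicator {0<..<t} \<sigma> * (\<integral>\<xi>. normal_kernel (h \<xi>) (x - \<xi>) \<sigma> \<partial>lborel)) \<in> borel_measurable lborel" for x t
    by measurable
  show "integrable lborel (\<lambda>\<sigma>. indicator {0<..<t} \<sigma> * (\<integral>\<xi>. normal_kernel (h \<xi>) (x - \<xi>) \<sigma> \<partial>lborel))"
    by (rule Bochner_Integration.integrable_bound[OF integrable_powr_half[of c t] m]) (rule AE_I2, unfold real_norm_def, rule order_trans[OF b[OF order_refl] abs_ge_self])
  have lx: "((\<lambda>q. fst q) \<longlongrightarrow> x0) (at (x0, t0))" and lt: "((\<lambda>q. snd q) \<longlongrightarrow> t0) (at (x0, t0))"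
    using tendsto_fst[OF tendsto_ident_at, of "(x0, t0)"] tendsto_snd[OF tendsto_ident_at, of "(x0, t0)"] by simp_all
  have "((\<lambda>q. gradient_potential h (fst q) (snd q)) \<longlongrightarrow> gradient_potential h x0 t0) (at (x0, t0))"
    unfolding gradient_potential_def
  proof (rule dominated_convergence_at[where w="\<lambda>\<sigma>. c * (\<sigma> powr (- 1 / 2) * indicator {0<..<t0 + 1} \<sigma>)"])
    show "integrable lborel (\<lambda>\<sigma>. c * (\<sigma> powr (- 1 / 2) * indicator {0<..<t0 + 1} \<sigma>))" by (rule integrable_powr_half)
    have "eventually (\<lambda>q. snd q < t0 + 1) (at (x0, t0))" using lt by (auto intro: order_tendstoD)
    then show "\<forall>\<^sub>F q in at (x0, t0). AE \<sigma> in lborel. \<bar>indicator {0<..<snd q} \<sigma> * (\<integral>\<xi>. normal_kernel (h \<xi>) (fst q - \<xi>) \<sigma> \<partial>lborel)\<bar> \<le> c * (\<sigma> powr (- 1 / 2) * indicator {0<..<t0 + 1} \<sigma>)"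
      by eventually_elim (intro AE_I2 b, simp)
    show "AE \<sigma> in lborel. ((\<lambda>q. indicator {0<..<snd q} \<sigma> * (\<integral>\<xi>. normal_kernel (h \<xi>) (fst q - \<xi>) \<sigma> \<partial>lborel)) \<longlongrightarrow> indicator {0<..<t0} \<sigma> * (\<integral>\<xi>. normal_kernel (h \<xi>) (x0 - \<xi>) \<sigma> \<partial>lborel)) (at (x0, t0))"
      using AE_lborel_singleton[of t0]
    proof eventually_elim
      case (elim \<sigma>)
      have li: "((\<lambda>q. indicator {0<..<snd q} \<sigma> :: real) \<longlongrightarrow> indicator {0<..<t0} \<sigma>) (at (x0, t0))"
        using elim by (intro indicator_Ioo_tendsto lt)
      show ?case
      proof (cases "\<sigma> > 0")
        case True
        obtain C where C: "C > 0" "\<And>(z::real^'n) \<tau>. \<sigma> \<le> norm z \<or> \<sigma> \<le> \<tau> \<Longrightarrow> heat_kernel z \<tau> * norm z / (2 * \<tau>) \<le> C"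
          using heat_gradient_bounded_far[OF True] by blast
        have bd: "\<bar>normal_kernel (h \<xi>) (y - \<xi>) \<sigma>\<bar> \<le> norm (h \<xi>) * C" for y \<xi>
        proof -
          have "\<bar>(y - \<xi>) \<bullet> h \<xi>\<bar> \<le> norm (y - \<xi>) * norm (h \<xi>)" by (rule Cauchy_Schwarz_ineq2)
          then have "\<bar>normal_kernel (h \<xi>) (y - \<xi>) \<sigma>\<bar> \<le> heat_kernel (y - \<xi>) \<sigma> * (norm (y - \<xi>) * norm (h \<xi>)) / (2 * \<sigma>)"
            using True unfolding normal_kernel_def abs_mult abs_divide by (intro divide_mono mult_mono) auto
          also have "\<dots> = norm (h \<xi>) * (heat_kernel (y - \<xi>) \<sigma> * norm (y - \<xi>) / (2 * \<sigma>))" by simp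
          also have "\<dots> \<le> norm (h \<xi>) * C" using C(2)[of "y - \<xi>" \<sigma>] by (intro mult_left_mono) auto
          finally show ?thesis .
        qed
        have "((\<lambda>q. \<integral>\<xi>. normal_kernel (h \<xi>) (fst q - \<xi>) \<sigma> \<partial>lborel) \<longlongrightarrow> (\<integral>\<xi>. normal_kernel (h \<xi>) (x0 - \<xi>) \<sigma> \<partial>lborel)) (at (x0, t0))"
        proof (rule dominated_convergence_at[where w="\<lambda>\<xi>. norm (h \<xi>) * C"])
          show "integrable lborel (\<lambda>\<xi>. norm (h \<xi>) * C)" using hi by (intro integrable_mult_left integrable_norm)
          show "AE \<xi> in lborel. ((\<lambda>q. normal_kernel (h \<xi>) (fst q - \<xi>) \<sigma>) \<longlongrightarrow> normal_kernel (h \<xi>) (x0 - \<xi>) \<sigma>) (at (x0, t0))"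
            by (intro AE_I2 normal_kernel_tendsto tendsto_diff tendsto_const lx True)
          show "\<forall>\<^sub>F q in at (x0, t0). AE \<xi> in lborel. \<bar>normal_kernel (h \<xi>) (fst q - \<xi>) \<sigma>\<bar> \<le> norm (h \<xi>) * C"
            by (intro always_eventually allI AE_I2 bd)
        qed measurable
        then show ?thesis by (intro tendsto_mult li)
      qed simp
    qed
  qed (rule m)+
  then show "((\<lambda>(x, t). gradient_potential h x t) \<longlongrightarrow> gradient_potential h x0 t0) (at (x0, t0))"
    by (simp add: case_prod_beta')
qed

text \<open>
The time derivative of the heat kernel. By the heat equation it is also the Laplacian; in this form it appears in
\<open>gauss_identity\<close>.
\<close>

definition heat_kernel_dt :: "real^'n \<Rightarrow> real \<Rightarrow> real" where
  "heat_kernel_dt z \<sigma> = heat_kernel z \<sigma> * ((norm z)\<^sup>2 / (4 * \<sigma>\<^sup>2) - real CARD('n) / (2 * \<sigma>))"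

lemma heat_kernel_dt_measurable [measurable]:
  assumes [measurable]: "f \<in> borel_measurable M" "g \<in> borel_measurable M"
  shows "(\<lambda>x. heat_kernel_dt (f x :: real^'n) (g x)) \<in> borel_measurable M"
  unfolding heat_kernel_dt_def by measurable

lemma heat_kernel_has_dt:
  assumes "\<sigma> > 0"
  shows "((\<lambda>\<sigma>. heat_kernel (z::real^'n) \<sigma>) has_real_derivative heat_kernel_dt z \<sigma>) (at \<sigma>)"
proof -
  define c where "c = - real CARD('n) / 2"
  have "((\<lambda>\<sigma>. (4 * pi * \<sigma>) powr c * exp (- (norm z)\<^sup>2 / (4 * \<sigma>))) has_real_derivative
      (4 * pi * \<sigma>) powr c * exp (- (norm z)\<^sup>2 / (4 * \<sigma>)) * ((norm z)\<^sup>2 / (4 * \<sigma>\<^sup>2) + c / \<sigma>)) (at \<sigma>)"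
    using assms
    by (auto intro!: derivative_eq_intros simp: powr_diff field_simps power2_eq_square)
  also have "(4 * pi * \<sigma>) powr c * exp (- (norm z)\<^sup>2 / (4 * \<sigma>)) * ((norm z)\<^sup>2 / (4 * \<sigma>\<^sup>2) + c / \<sigma>) = heat_kernel_dt z \<sigma>"
    using assms by (simp add: heat_kernel_dt_def heat_kernel_def c_def)
  finally have "((\<lambda>\<sigma>. (4 * pi * \<sigma>) powr (- real CARD('n) / 2) * exp (- (norm z)\<^sup>2 / (4 * \<sigma>))) has_real_derivative heat_kernel_dt z \<sigma>) (at \<sigma>)"
    unfolding c_def .
  then show ?thesis
    by (rule has_field_derivative_transform_within_open[of _ _ _ "{0<..}"]) (use assms in \<open>auto simp: heat_kernel_def\<close>)
qed

lemma continuous_on_heat_kernel: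
  assumes "continuous_on A f" "continuous_on A g" "\<And>x. x \<in> A \<Longrightarrow> g x > 0"
  shows "continuous_on A (\<lambda>x. heat_kernel (f x :: real^'n) (g x))"
    "continuous_on A (\<lambda>x. heat_kernel_dt (f x :: real^'n) (g x))"
proof -
  show 1: "continuous_on A (\<lambda>x. heat_kernel (f x) (g x))"
    using assms unfolding continuous_on_def by (auto intro!: heat_kernel_tendsto)
  show "continuous_on A (\<lambda>x. heat_kernel_dt (f x) (g x))"
    unfolding heat_kernel_dt_def by (intro continuous_intros 1 assms(1,2)) (use assms(3) in force)+
qed

lemma heat_convolution_time_FTC:
  fixes \<zeta> :: "real^'n \<Rightarrow> real"
  assumes \<zeta>: "continuous_on UNIV \<zeta>" and S: "compact S" "\<And>x. x \<notin> S \<Longrightarrow> \<zeta> x = 0"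
    and A[measurable]: "A \<in> sets borel" and t: "0 < \<delta>" "\<delta> \<le> t"
  shows "(\<integral>\<sigma>. indicator {\<delta>..t} \<sigma> * (\<integral>\<xi>. indicator A \<xi> * \<zeta> \<xi> * heat_kernel_dt (x - \<xi>) \<sigma> \<partial>lborel) \<partial>lborel)
    = (\<integral>\<xi>. indicator A \<xi> * \<zeta> \<xi> * heat_kernel (x - \<xi>) t \<partial>lborel) - (\<integral>\<xi>. indicator A \<xi> * \<zeta> \<xi> * heat_kernel (x - \<xi>) \<delta> \<partial>lborel)"
proof -
  have [measurable]: "\<zeta> \<in> borel_measurable borel" by (rule borel_measurable_continuous_onI[OF \<zeta>])
  obtain B where B: "B > 0" "\<And>x. \<bar>\<zeta> x\<bar> \<le> B"
    using continuous_compact_support_bounded[OF \<zeta> S] by (metis real_norm_def)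
  have "continuous_on ({\<delta>..t} \<times> S) (\<lambda>p. \<zeta> (snd p) * heat_kernel_dt (x - snd p) (fst p))"
    using t by (intro continuous_intros continuous_on_heat_kernel(2) continuous_on_compose2[OF \<zeta>]) auto
  then have "compact ((\<lambda>p. \<zeta> (snd p) * heat_kernel_dt (x - snd p) (fst p)) ` ({\<delta>..t} \<times> S))"
    using S(1) by (intro compact_continuous_image compact_Times) auto
  then have "bounded ((\<lambda>p. \<zeta> (snd p) * heat_kernel_dt (x - snd p) (fst p)) ` ({\<delta>..t} \<times> S))" by (rule compact_imp_bounded)
  then obtain C where "\<forall>p\<in>{\<delta>..t} \<times> S. norm (\<zeta> (snd p) * heat_kernel_dt (x - snd p) (fst p)) \<le> C" by (auto simp: bounded_iff)
  then have C: "\<bar>\<zeta> \<xi> * heat_kernel_dt (x - \<xi>) \<sigma>\<bar> \<le> C" if "\<sigma> \<in> {\<delta>..t}" "\<xi> \<in> S" for \<sigma> \<xi> using that by force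
  have Sm[measurable]: "S \<in> sets borel" using S(1) by (simp add: borel_closed compact_imp_closed)
  define F where "F \<sigma> \<xi> = indicator {\<delta>..t} \<sigma> * (indicator A \<xi> * \<zeta> \<xi> * heat_kernel_dt (x - \<xi>) \<sigma>)" for \<sigma> \<xi>
  have iF: "integrable (lborel \<Otimes>\<^sub>M lborel) (case_prod F)"
  proof (rule Bochner_Integration.integrable_bound)
    have "emeasure lborel S < \<infinity>" using emeasure_bounded_finite[OF compact_imp_bounded[OF S(1)]] by simp
    then have "emeasure (lborel \<Otimes>\<^sub>M lborel) ({\<delta>..t} \<times> S) < \<infinity>"
      by (subst lborel.emeasure_pair_measure_Times) (auto simp: ennreal_mult_less_top emeasure_lborel_Icc_eq)
    then show "integrable (lborel \<Otimes>\<^sub>M lborel) (\<lambda>p. C * indicator ({\<delta>..t} \<times> S) p)"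
      by (intro integrable_mult_right integrable_real_indicator pair_measureI) auto
    show "AE p in lborel \<Otimes>\<^sub>M lborel. norm (case p of (\<sigma>, \<xi>) \<Rightarrow> F \<sigma> \<xi>) \<le> norm (C * indicator ({\<delta>..t} \<times> S) p)"
    proof (rule AE_I2)
      fix p :: "real \<times> (real^'n)"
      obtain \<sigma> \<xi> where p: "p = (\<sigma>, \<xi>)" by (cases p)
      show "norm (case p of (\<sigma>, \<xi>) \<Rightarrow> F \<sigma> \<xi>) \<le> norm (C * indicator ({\<delta>..t} \<times> S) p)"
        using C[of \<sigma> \<xi>] S(2)[of \<xi>] by (auto simp: F_def p indicator_def)
    qed
    show "case_prod F \<in> borel_measurable (lborel \<Otimes>\<^sub>M lborel)" unfolding F_def by measurable
  qed
  have ftc: "(\<integral>\<sigma>. F \<sigma> \<xi> \<partial>lborel) = indicator A \<xi> * \<zeta> \<xi> * heat_kernel (x - \<xi>) t - indicator A \<xi> * \<zeta> \<xi> * heat_kernel (x - \<xi>) \<delta>" for \<xi>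
  proof -
    have "(\<integral>\<sigma>. indicator {\<delta>..t} \<sigma> *\<^sub>R heat_kernel_dt (x - \<xi>) \<sigma> \<partial>lborel) = heat_kernel (x - \<xi>) t - heat_kernel (x - \<xi>) \<delta>"
    proof (rule integral_FTC_Icc[OF t(2)])
      show "continuous_on {\<delta>..t} (heat_kernel_dt (x - \<xi>))"
        using t by (intro continuous_on_heat_kernel(2)[of _ "\<lambda>_. x - \<xi>" "\<lambda>\<sigma>. \<sigma>"] continuous_intros) auto
      show "(heat_kernel (x - \<xi>) has_vector_derivative heat_kernel_dt (x - \<xi>) \<sigma>) (at \<sigma> within {\<delta>..t})"
        if "\<delta> \<le> \<sigma>" "\<sigma> \<le> t" for \<sigma>
        using heat_kernel_has_dt[of \<sigma> "x - \<xi>"] that t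
        by (auto simp: has_real_derivative_iff_has_vector_derivative[symmetric] intro: has_field_derivative_at_within)
    qed
    moreover have "(\<integral>\<sigma>. F \<sigma> \<xi> \<partial>lborel) = indicator A \<xi> * \<zeta> \<xi> * (\<integral>\<sigma>. indicator {\<delta>..t} \<sigma> *\<^sub>R heat_kernel_dt (x - \<xi>) \<sigma> \<partial>lborel)"
      unfolding F_def by (subst integral_mult_right_zero[symmetric]) (simp add: mult_ac)
    ultimately show ?thesis by (simp add: right_diff_distrib)
  qed
  have ih: "integrable lborel (\<lambda>\<xi>. indicator A \<xi> * \<zeta> \<xi> * heat_kernel (x - \<xi>) \<sigma>)" if "\<sigma> > 0" for \<sigma>
  proof (rule integrable_bounded_support[OF _ _ compact_imp_bounded[OF S(1)]])
    show "norm (indicator A \<xi> * \<zeta> \<xi> * heat_kernel (x - \<xi>) \<sigma>) \<le> B * (4 * pi * \<sigma>) powr (- real CARD('n) / 2)" for \<xi>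
      unfolding norm_mult using B heat_kernel_le[OF that order_refl, of "x - \<xi>"]
      by (intro mult_mono) (auto simp: indicator_def less_imp_le)
  qed (use S(2) in auto)
  have "(\<integral>\<sigma>. indicator {\<delta>..t} \<sigma> * (\<integral>\<xi>. indicator A \<xi> * \<zeta> \<xi> * heat_kernel_dt (x - \<xi>) \<sigma> \<partial>lborel) \<partial>lborel)
    = (\<integral>\<sigma>. (\<integral>\<xi>. F \<sigma> \<xi> \<partial>lborel) \<partial>lborel)"
    by (simp add: F_def)
  also have "\<dots> = (\<integral>\<xi>. (\<integral>\<sigma>. F \<sigma> \<xi> \<partial>lborel) \<partial>lborel)"
    by (rule lborel_pair.Fubini_integral[OF iF, symmetric])
  also have "\<dots> = (\<integral>\<xi>. indicator A \<xi> * \<zeta> \<xi> * heat_kernel (x - \<xi>) t \<partial>lborel) - (\<integral>\<xi>. indicator A \<xi> * \<zeta> \<xi> * heat_kernel (x - \<xi>) \<delta> \<partial>lborel)"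
    unfolding ftc using t by (intro Bochner_Integration.integral_diff ih) auto
  finally show ?thesis .
qed

section \<open>The Gauss identity and the jump relation\<close>

lemma integrable_continuous_compact_support:
  fixes f :: "real^'n \<Rightarrow> real"
  assumes f: "continuous_on UNIV f" and S: "compact S" "\<And>x. x \<notin> S \<Longrightarrow> f x = 0" and A[measurable]: "A \<in> sets borel"
  shows "integrable lborel (\<lambda>x. indicator A x * f x)"
proof -
  have [measurable]: "f \<in> borel_measurable borel" by (rule borel_measurable_continuous_onI[OF f])
  obtain B where B: "B > 0" "\<And>x. \<bar>f x\<bar> \<le> B"
    using continuous_compact_support_bounded[OF f S] by (metis real_norm_def)
  show ?thesis
    using B S(2) by (intro integrable_bounded_support[OF _ _ compact_imp_bounded[OF S(1)], of _ B]) (auto simp: indicator_def)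
qed

text \<open>
The reflection \<open>z \<mapsto> - z\<close> exchanges the two open half spaces, and the hyperplane between them is a null set.
\<close>

lemma half_space_heat_mass:
  assumes v: "v \<noteq> (0::real^'n)"
  shows "(\<integral>z. c * indicator {z. z \<bullet> v < 0} z * heat_kernel z 1 \<partial>lborel) = c / 2"
proof -
  define I where "I A = (\<integral>z. indicator A z * heat_kernel (z::real^'n) 1 \<partial>lborel)" for A
  have i: "integrable lborel (\<lambda>z. indicator A z * heat_kernel (z::real^'n) 1)" if [measurable]: "A \<in> sets borel" for A
    by (rule Bochner_Integration.integrable_bound[OF has_integral_heat_kernel(1)[of 1]]) (auto simp: indicator_def)
  have m: "{z. z \<bullet> v < 0} \<in> sets borel" "{z. z \<bullet> v > 0} \<in> sets borel" by measurable
  have "I {z. z \<bullet> v < 0} = (\<integral>z. indicator {z. z \<bullet> v < 0} (- z) * heat_kernel (- z) 1 \<partial>lborel)"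
  proof -
    have "(\<integral>z. f z \<partial>lborel) = (\<integral>z. f (- z) \<partial>lborel)" if [measurable]: "f \<in> borel_measurable borel" for f :: "real^'n \<Rightarrow> real"
    proof -
      have "lborel = distr lborel borel (uminus :: real^'n \<Rightarrow> real^'n)"
        using lborel_affine[of "-1" "0::real^'n"] by (simp add: density_1)
      then have "(\<integral>z. f z \<partial>lborel) = (\<integral>z. f z \<partial>distr lborel borel (uminus :: real^'n \<Rightarrow> real^'n))" by simp
      also have "\<dots> = (\<integral>z. f (- z) \<partial>lborel)" by (rule integral_distr) measurable
      finally show ?thesis .
    qed
    then show ?thesis unfolding I_def using m by measurable
  qed
  also have "\<dots> = I {z. z \<bullet> v > 0}"
    unfolding I_def by (intro Bochner_Integration.integral_cong) (auto simp: indicator_def)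
  finally have eq: "I {z. z \<bullet> v < 0} = I {z. z \<bullet> v > 0}" .
  have "I {z. z \<bullet> v < 0} + I {z. z \<bullet> v > 0}
     = (\<integral>z. indicator {z. z \<bullet> v < 0} z * heat_kernel z 1 + indicator {z. z \<bullet> v > 0} z * heat_kernel z 1 \<partial>lborel)"
    unfolding I_def by (intro Bochner_Integration.integral_add[symmetric] i m)
  also have "\<dots> = (\<integral>z. heat_kernel (z::real^'n) 1 \<partial>lborel)"
  proof (rule integral_cong_AE)
    have "negligible {z. v \<bullet> z = 0}" using v by (intro negligible_hyperplane) auto
    then have "AE z in lebesgue. z \<notin> {z. v \<bullet> z = 0}" by (intro AE_not_in) (simp add: negligible_iff_null_sets)
    then have "AE z in lborel. z \<notin> {z. v \<bullet> z = 0}" by (simp add: AE_completion_iff)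
    then show "AE z in lborel. indicator {z. z \<bullet> v < 0} z * heat_kernel z 1 + indicator {z. z \<bullet> v > 0} z * heat_kernel z 1 = heat_kernel z 1"
      by eventually_elim (auto simp: indicator_def inner_commute)
  qed (use m in measurable)
  also have "\<dots> = 1" by (rule has_integral_heat_kernel) simp
  finally have "I {z. z \<bullet> v < 0} = 1 / 2" using eq by simp
  moreover have "(\<integral>z. c * indicator {z. z \<bullet> v < 0} z * heat_kernel z 1 \<partial>lborel) = c * I {z. z \<bullet> v < 0}"
    unfolding I_def by (subst integral_mult_right_zero[symmetric]) (simp add: mult.assoc)
  ultimately show ?thesis by simp
qed

lemma sum_Basis_inner: "(\<Sum>b\<in>Basis. (u \<bullet> b) * (b \<bullet> v)) = u \<bullet> (v::'a::euclidean_space)"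
  by (subst euclidean_inner) (simp add: inner_commute)

lemma normal_kernel_sum_Basis:
  "(\<Sum>b\<in>Basis. normal_kernel b z \<sigma> * (b \<bullet> v)) = normal_kernel v z \<sigma>"
proof -
  have "(\<Sum>b\<in>Basis. normal_kernel b z \<sigma> * (b \<bullet> v)) = heat_kernel z \<sigma> / (2 * \<sigma>) * (\<Sum>b\<in>Basis. (z \<bullet> b) * (b \<bullet> v))"
    unfolding sum_distrib_left normal_kernel_def by (intro sum.cong) auto
  then show ?thesis by (simp add: sum_Basis_inner normal_kernel_def)
qed

lemma normal_kernel_scaleR: "normal_kernel (c *\<^sub>R v) z \<sigma> = c * normal_kernel v z \<sigma>"
  by (simp add: normal_kernel_def)

lemma heat_kernel_has_gradient:
  assumes "\<sigma> > 0"
  shows "((\<lambda>\<xi>. heat_kernel (x - \<xi> :: real^'n) \<sigma>) has_derivative (\<lambda>w. normal_kernel w (x - \<xi>) \<sigma>)) (at \<xi>)"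
proof -
  have "((\<lambda>\<xi>. (4 * pi * \<sigma>) powr (- real CARD('n) / 2) * exp (- ((x - \<xi>) \<bullet> (x - \<xi>)) / (4 * \<sigma>))) has_derivative (\<lambda>w. normal_kernel w (x - \<xi>) \<sigma>)) (at \<xi>)"
    using assms
    by (auto intro!: derivative_eq_intros simp: normal_kernel_def heat_kernel_def power2_norm_eq_inner inner_commute fun_eq_iff field_simps)
  then show ?thesis using assms by (simp add: heat_kernel_def power2_norm_eq_inner)
qed

locale double_layer_domain = double_layer_kernel "boundary_measure \<Omega>" n for \<Omega> :: "(real^'n) set" and n +
  assumes open_Omega: "open \<Omega>"
    and n_eq: "\<And>\<xi>. \<xi> \<in> frontier \<Omega> \<Longrightarrow> n \<xi> = outward_normal \<Omega> \<xi>"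
begin

lemma Omega_measurable [measurable]: "\<Omega> \<in> sets borel"
  using open_Omega by simp

text \<open>
The divergence theorem for the field \<open>\<zeta> \<nabla>\<epsilon>\<close>, where \<open>\<epsilon> \<xi> = heat_kernel (x - \<xi>) \<sigma>\<close>. The field is tested one
coordinate \<open>b\<close> at a time: its component is \<open>f b = \<zeta> * normal_kernel b\<close>, with gradient \<open>Df b\<close>. The divergence is
\<open>\<zeta> \<Delta>\<epsilon> + \<nabla>\<zeta> \<bullet> \<nabla>\<epsilon>\<close>, and \<open>\<Delta>\<epsilon>\<close> is the time derivative of \<open>\<epsilon>\<close>.
\<close>

lemma gauss_identity:
  assumes g: "boundary_graph \<Omega> e g G U"
    and \<zeta>: "\<And>x. (\<zeta> has_derivative (\<lambda>w. w \<bullet> D x)) (at x)" and D: "continuous_on UNIV D"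
    and S: "compact S" "S \<subseteq> U" "\<And>x. x \<notin> S \<Longrightarrow> \<zeta> x = 0" "\<And>x. x \<notin> S \<Longrightarrow> D x = 0" and \<sigma>: "\<sigma> > 0"
  shows "(\<integral>\<xi>. normal_kernel (n \<xi>) (x - \<xi>) \<sigma> * \<zeta> \<xi> \<partial>boundary_measure \<Omega>)
    = (\<integral>\<xi>. indicator \<Omega> \<xi> * \<zeta> \<xi> * heat_kernel_dt (x - \<xi>) \<sigma> \<partial>lborel)
      + (\<integral>\<xi>. normal_kernel (indicator \<Omega> \<xi> *\<^sub>R D \<xi>) (x - \<xi>) \<sigma> \<partial>lborel)"
proof -
  interpret B: boundary_graph \<Omega> e g G U by (rule g)
  have \<zeta>c: "continuous_on UNIV \<zeta>"
    by (intro continuous_at_imp_continuous_on ballI has_derivative_continuous[OF \<zeta>])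
  have [measurable]: "\<zeta> \<in> borel_measurable borel" by (rule borel_measurable_continuous_onI[OF \<zeta>c])
  have hc: "continuous_on UNIV (\<lambda>\<xi>. heat_kernel (x - \<xi>) \<sigma>)" "continuous_on UNIV (\<lambda>\<xi>. heat_kernel_dt (x - \<xi>) \<sigma>)"
    using \<sigma> by (intro continuous_on_heat_kernel continuous_intros; simp)+
  have kc: "continuous_on UNIV (\<lambda>\<xi>. normal_kernel (v \<xi>) (x - \<xi>) \<sigma>)" if "continuous_on UNIV v" for v
    unfolding normal_kernel_def using \<sigma> that hc by (intro continuous_intros) auto
  define f where "f b \<xi> = \<zeta> \<xi> * normal_kernel b (x - \<xi>) \<sigma>" for b \<xi>
  define Df where "Df b \<xi> = normal_kernel b (x - \<xi>) \<sigma> *\<^sub>R D \<xi>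
     + \<zeta> \<xi> *\<^sub>R ((normal_kernel b (x - \<xi>) \<sigma> / (2 * \<sigma>)) *\<^sub>R (x - \<xi>) - (heat_kernel (x - \<xi>) \<sigma> / (2 * \<sigma>)) *\<^sub>R b)" for b \<xi>
  have fd: "(f b has_derivative (\<lambda>w. w \<bullet> Df b \<xi>)) (at \<xi>)" for b \<xi>
  proof -
    have hb: "((\<lambda>\<xi>. (x - \<xi>) \<bullet> b) has_derivative (\<lambda>w. - (w \<bullet> b))) (at \<xi>)"
      by (auto intro!: derivative_eq_intros)
    have "((\<lambda>\<xi>. \<zeta> \<xi> * (heat_kernel (x - \<xi>) \<sigma> * ((x - \<xi>) \<bullet> b) * (1 / (2 * \<sigma>)))) has_derivative
       (\<lambda>w. \<zeta> \<xi> * ((heat_kernel (x - \<xi>) \<sigma> * (- (w \<bullet> b)) + normal_kernel w (x - \<xi>) \<sigma> * ((x - \<xi>) \<bullet> b)) * (1 / (2 * \<sigma>)))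
         + (w \<bullet> D \<xi>) * (heat_kernel (x - \<xi>) \<sigma> * ((x - \<xi>) \<bullet> b) * (1 / (2 * \<sigma>))))) (at \<xi>)"
      by (rule has_derivative_mult[OF \<zeta> has_derivative_mult_left[OF has_derivative_mult[OF heat_kernel_has_gradient[OF \<sigma>] hb]]])
    moreover have "(\<lambda>w. \<zeta> \<xi> * ((heat_kernel (x - \<xi>) \<sigma> * (- (w \<bullet> b)) + normal_kernel w (x - \<xi>) \<sigma> * ((x - \<xi>) \<bullet> b)) * (1 / (2 * \<sigma>)))
         + (w \<bullet> D \<xi>) * (heat_kernel (x - \<xi>) \<sigma> * ((x - \<xi>) \<bullet> b) * (1 / (2 * \<sigma>)))) = (\<lambda>w. w \<bullet> Df b \<xi>)"
    proof
      fix w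
      show "\<zeta> \<xi> * ((heat_kernel (x - \<xi>) \<sigma> * (- (w \<bullet> b)) + normal_kernel w (x - \<xi>) \<sigma> * ((x - \<xi>) \<bullet> b)) * (1 / (2 * \<sigma>)))
         + (w \<bullet> D \<xi>) * (heat_kernel (x - \<xi>) \<sigma> * ((x - \<xi>) \<bullet> b) * (1 / (2 * \<sigma>))) = w \<bullet> Df b \<xi>"
        unfolding Df_def normal_kernel_def inner_add_right inner_scaleR_right inner_diff_right[of w "_ *\<^sub>R _"] inner_commute[of "x - \<xi>" w]
        using \<sigma> by (simp add: field_simps)
    qed
    moreover have "f b = (\<lambda>\<xi>. \<zeta> \<xi> * (heat_kernel (x - \<xi>) \<sigma> * ((x - \<xi>) \<bullet> b) * (1 / (2 * \<sigma>))))"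
      by (simp add: fun_eq_iff f_def normal_kernel_def)
    ultimately show ?thesis by (simp only:)
  qed
  have Dfc: "continuous_on UNIV (Df b)" for b
    unfolding Df_def using D \<zeta>c hc kc \<sigma> by (intro continuous_intros) auto
  have fz: "f b \<xi> = 0" "Df b \<xi> = 0" if "\<xi> \<notin> S" for b \<xi> using that S(3,4) by (simp_all add: f_def Df_def)
  have fc: "continuous_on UNIV (f b)" for b
    unfolding f_def using \<zeta>c kc by (intro continuous_intros) auto
  have dt: "(\<Sum>b\<in>Basis. b \<bullet> Df b \<xi>) = \<zeta> \<xi> * heat_kernel_dt (x - \<xi>) \<sigma> + normal_kernel (D \<xi>) (x - \<xi>) \<sigma>" for \<xi>
  proof -
    have "(\<Sum>b\<in>Basis. b \<bullet> Df b \<xi>) = (\<Sum>b\<in>Basis. normal_kernel b (x - \<xi>) \<sigma> * (b \<bullet> D \<xi>)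
       + \<zeta> \<xi> / (2 * \<sigma>) * (normal_kernel b (x - \<xi>) \<sigma> * (b \<bullet> (x - \<xi>))) - \<zeta> \<xi> * heat_kernel (x - \<xi>) \<sigma> / (2 * \<sigma>))"
      using \<sigma> by (intro sum.cong) (auto simp: Df_def inner_add_right inner_diff_right field_simps)
    also have "\<dots> = normal_kernel (D \<xi>) (x - \<xi>) \<sigma> + \<zeta> \<xi> / (2 * \<sigma>) * normal_kernel (x - \<xi>) (x - \<xi>) \<sigma> - real CARD('n) * (\<zeta> \<xi> * heat_kernel (x - \<xi>) \<sigma> / (2 * \<sigma>))"
      by (simp add: sum.distrib sum_subtractf sum_distrib_left[symmetric] sum_divide_distrib[symmetric] normal_kernel_sum_Basis)
    also have "\<dots> = \<zeta> \<xi> * heat_kernel_dt (x - \<xi>) \<sigma> + normal_kernel (D \<xi>) (x - \<xi>) \<sigma>"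
      using \<sigma> by (simp add: normal_kernel_def heat_kernel_dt_def dot_square_norm power2_eq_square field_simps)
    finally show ?thesis .
  qed
  have iD: "integrable lborel (\<lambda>\<xi>. indicator \<Omega> \<xi> * (b \<bullet> Df b \<xi>))" for b
    using Dfc fz(2) by (intro integrable_continuous_compact_support[OF _ S(1)] continuous_intros) auto
  have iN: "integrable B.H (\<lambda>y. f b (B.lift y) * (b \<bullet> B.N y))" for b
    using fc fz(1) B.G_cont by (intro B.integrable_over_graph[OF _ S(1)] continuous_intros) auto
  have i1: "integrable lborel (\<lambda>\<xi>. indicator \<Omega> \<xi> * (\<zeta> \<xi> * heat_kernel_dt (x - \<xi>) \<sigma>))"
    using \<zeta>c hc S(3) by (intro integrable_continuous_compact_support[OF _ S(1)] continuous_intros) auto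
  have i2: "integrable lborel (\<lambda>\<xi>. indicator \<Omega> \<xi> * normal_kernel (D \<xi>) (x - \<xi>) \<sigma>)"
    using kc[OF D] S(4) by (intro integrable_continuous_compact_support[OF _ S(1)]) (auto simp: normal_kernel_def)
  have "(\<integral>\<xi>. normal_kernel (n \<xi>) (x - \<xi>) \<sigma> * \<zeta> \<xi> \<partial>boundary_measure \<Omega>)
    = (\<integral>y. normal_kernel (n (B.lift y)) (x - (B.lift y)) \<sigma> * \<zeta> (B.lift y) * norm (B.N y) \<partial>B.H)"
    using S by (intro B.integral_boundary_measure) auto
  also have "\<dots> = (\<integral>y. (\<Sum>b\<in>Basis. f b (B.lift y) * (b \<bullet> B.N y)) \<partial>B.H)"
  proof (rule integral_cong_AE)
    have [measurable]: "f b \<in> borel_measurable borel" for b by (rule borel_measurable_continuous_onI[OF fc])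
    show "(\<lambda>y. \<Sum>b\<in>Basis. f b (B.lift y) * (b \<bullet> B.N y)) \<in> borel_measurable B.H" by measurable
    show "(\<lambda>y. normal_kernel (n (B.lift y)) (x - (B.lift y)) \<sigma> * \<zeta> (B.lift y) * norm (B.N y)) \<in> borel_measurable B.H" by measurable
    show "AE y in B.H. normal_kernel (n (B.lift y)) (x - (B.lift y)) \<sigma> * \<zeta> (B.lift y) * norm (B.N y)
       = (\<Sum>b\<in>Basis. f b (B.lift y) * (b \<bullet> B.N y))"
    proof (rule AE_mp[OF B.AE_e], rule AE_I2, rule impI)
      fix y assume y: "y \<bullet> e = 0"
      let ?Y = "B.lift y"
      have "(\<Sum>b\<in>Basis. f b ?Y * (b \<bullet> B.N y)) = \<zeta> ?Y * normal_kernel (B.N y) (x - ?Y) \<sigma>"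
        unfolding f_def mult.assoc sum_distrib_left[symmetric] normal_kernel_sum_Basis ..
      moreover have "normal_kernel (n ?Y) (x - ?Y) \<sigma> * norm (B.N y) = normal_kernel (B.N y) (x - ?Y) \<sigma>" if "?Y \<in> S"
      proof -
        have YU: "?Y \<in> U" using that S(2) by blast
        then have "n ?Y = B.N y /\<^sub>R norm (B.N y)"
          using n_eq[of ?Y] B.outward_normal_eq[of ?Y] B.graph_point(3,4)[OF y] by simp
        moreover have "norm (B.N y) > 0" using B.norm_N(2)[of y] by linarith
        ultimately show ?thesis by (simp add: normal_kernel_def)
      qed
      ultimately show "normal_kernel (n ?Y) (x - ?Y) \<sigma> * \<zeta> ?Y * norm (B.N y) = (\<Sum>b\<in>Basis. f b ?Y * (b \<bullet> B.N y))"
        using S(3)[of ?Y] by (cases "?Y \<in> S") (auto simp: mult_ac)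
    qed
  qed
  also have "\<dots> = (\<Sum>b\<in>Basis. \<integral>y. f b (B.lift y) * (b \<bullet> B.N y) \<partial>B.H)"
    by (rule Bochner_Integration.integral_sum) (rule iN)
  also have "\<dots> = (\<Sum>b\<in>Basis. \<integral>\<xi>. indicator \<Omega> \<xi> * (b \<bullet> Df b \<xi>) \<partial>lborel)"
    by (intro sum.cong refl B.divergence_below_graph[OF fd Dfc S(1,2) fz(1), symmetric])
  also have "\<dots> = (\<integral>\<xi>. (\<Sum>b\<in>Basis. indicator \<Omega> \<xi> * (b \<bullet> Df b \<xi>)) \<partial>lborel)"
    by (rule Bochner_Integration.integral_sum[symmetric]) (rule iD)
  also have "\<dots> = (\<integral>\<xi>. indicator \<Omega> \<xi> * (\<zeta> \<xi> * heat_kernel_dt (x - \<xi>) \<sigma>) + indicator \<Omega> \<xi> * normal_kernel (D \<xi>) (x - \<xi>) \<sigma> \<partial>lborel)"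
    unfolding sum_distrib_left[symmetric] dt by (simp add: distrib_left)
  also have "\<dots> = (\<integral>\<xi>. indicator \<Omega> \<xi> * (\<zeta> \<xi> * heat_kernel_dt (x - \<xi>) \<sigma>) \<partial>lborel) + (\<integral>\<xi>. indicator \<Omega> \<xi> * normal_kernel (D \<xi>) (x - \<xi>) \<sigma> \<partial>lborel)"
    by (rule Bochner_Integration.integral_add[OF i1 i2])
  finally show ?thesis by (simp add: normal_kernel_scaleR mult.assoc)
qed

text \<open>
The blow-up of \<open>\<Omega>\<close> at a boundary point is the half space opposite to the normal: along a direction \<open>w\<close> that is not
tangential, the sign of the derivative of the height decides whether points near \<open>x\<close> belong to \<open>\<Omega>\<close>. If \<open>x\<close> is
outside the chart, the product tends to \<open>0\<close> because \<open>\<zeta>\<close> does.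
\<close>

lemma blow_up_tendsto:
  fixes \<zeta> :: "real^'n \<Rightarrow> real"
  assumes g: "boundary_graph \<Omega> e g G U" and \<zeta>: "continuous_on UNIV \<zeta>" and z: "\<And>y. y \<notin> U \<Longrightarrow> \<zeta> y = 0"
    and x: "x \<in> frontier \<Omega>" and w: "w \<bullet> (e - G x) \<noteq> 0"
  shows "((\<lambda>\<delta>. indicator \<Omega> (x + sqrt \<delta> *\<^sub>R w) * \<zeta> (x + sqrt \<delta> *\<^sub>R w)) \<longlongrightarrow> \<zeta> x * indicator {w. w \<bullet> (e - G x) < 0} w) (at_right 0)"
proof -
  interpret B: boundary_graph \<Omega> e g G U by (rule g)
  have sq: "((\<lambda>\<delta>. sqrt \<delta>) \<longlongrightarrow> 0) (at_right 0)" using tendsto_real_sqrt[OF tendsto_ident_at, of 0 "{0<..}"] by simp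
  then have lx: "((\<lambda>\<delta>. x + sqrt \<delta> *\<^sub>R w) \<longlongrightarrow> x) (at_right 0)"
    using tendsto_add[OF tendsto_const tendsto_scaleR[OF sq tendsto_const[of w]], of x] by simp
  have l\<zeta>: "((\<lambda>\<delta>. \<zeta> (x + sqrt \<delta> *\<^sub>R w)) \<longlongrightarrow> \<zeta> x) (at_right 0)"
    using \<zeta> lx by (auto simp: continuous_on_eq_continuous_at intro: isCont_tendsto_compose)
  show ?thesis
  proof (cases "x \<in> U")
    case False
    then have l0: "((\<lambda>\<delta>. \<zeta> (x + sqrt \<delta> *\<^sub>R w)) \<longlongrightarrow> 0) (at_right 0)" using l\<zeta> z by simp
    have "((\<lambda>\<delta>. indicator \<Omega> (x + sqrt \<delta> *\<^sub>R w) * \<zeta> (x + sqrt \<delta> *\<^sub>R w)) \<longlongrightarrow> 0) (at_right 0)"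
      by (rule Lim_null_comparison[OF _ tendsto_rabs_zero[OF l0]])
        (auto intro!: always_eventually simp: indicator_def)
    then show ?thesis using False z by simp
  next
    case True
    have x0: "x \<bullet> e - g x = 0" using B.frontier_iff[OF True] x by simp
    have evU: "eventually (\<lambda>\<delta>. x + sqrt \<delta> *\<^sub>R w \<in> U) (at_right 0)"
      using topological_tendstoD[OF lx B.open_U True] .
    have ev: "eventually (\<lambda>\<delta>. (x + sqrt \<delta> *\<^sub>R w) \<bullet> e - g (x + sqrt \<delta> *\<^sub>R w) < 0 \<longleftrightarrow> w \<bullet> B.N x < 0) (at_right 0)"
    proof -
      obtain d where d: "d > 0" "\<And>t. 0 < t \<Longrightarrow> t < d \<Longrightarrow> ((x + t *\<^sub>R w) \<bullet> e - g (x + t *\<^sub>R w) < 0 \<longleftrightarrow> w \<bullet> B.N x < 0)"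
      proof (cases "w \<bullet> B.N x < 0")
        case True
        then show ?thesis using DERIV_neg_dec_right[OF B.height_has_derivative[of x w]] x0 that by auto
      next
        case False
        then have "w \<bullet> B.N x > 0" using w by linarith
        then obtain d where "d > 0" "\<And>t. 0 < t \<Longrightarrow> t < d \<Longrightarrow> (x + t *\<^sub>R w) \<bullet> e - g (x + t *\<^sub>R w) > 0"
          using DERIV_pos_inc_right[OF B.height_has_derivative[of x w]] x0 by auto
        then show ?thesis using False that[of d] by force
      qed
      have "eventually (\<lambda>\<delta>. sqrt \<delta> < d) (at_right 0)" using sq d(1) by (auto intro: order_tendstoD)
      moreover have "eventually (\<lambda>\<delta>. sqrt \<delta> > (0::real)) (at_right 0)" by (auto simp: eventually_at_filter)
      ultimately show ?thesis by eventually_elim (use d(2) in blast)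
    qed
    have "eventually (\<lambda>\<delta>. (indicator \<Omega> (x + sqrt \<delta> *\<^sub>R w) :: real) = indicator {w. w \<bullet> B.N x < 0} w) (at_right 0)"
      using evU ev by eventually_elim (auto simp: indicator_def B.Omega_iff)
    then have "((\<lambda>\<delta>. indicator \<Omega> (x + sqrt \<delta> *\<^sub>R w) :: real) \<longlongrightarrow> indicator {w. w \<bullet> B.N x < 0} w) (at_right 0)"
      by (rule tendsto_eventually)
    from tendsto_mult[OF l\<zeta> this] show ?thesis by (simp add: mult.commute)
  qed
qed

text \<open>
On \<open>closure \<Omega>\<close> this is the function whose continuity is claimed: the boundary values are the direct values of the
potential lowered by half the density.
\<close>

definition extended_potential :: "(real^'n \<Rightarrow> real \<Rightarrow> real) \<Rightarrow> real^'n \<Rightarrow> real \<Rightarrow> real" where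
  "extended_potential \<psi> x t = potential \<psi> x t - (if x \<in> \<Omega> then 0 else \<psi> x t / 2)"

text \<open>
The jump relation for the density \<open>\<zeta>\<close>. The Gauss identity is integrated over times \<open>\<sigma>\<close> from \<open>\<delta>\<close> to \<open>t\<close>; as
\<open>\<delta> \<rightarrow> 0\<close>, the lower boundary term \<open>p \<delta>\<close> tends to \<open>\<zeta> x\<close> in \<open>\<Omega>\<close> and to \<open>\<zeta> x / 2\<close> on the boundary. The
correction in \<open>extended_potential\<close> compensates the difference, so that one formula with continuous right-hand side
holds on all of \<open>closure \<Omega>\<close>.
\<close>

lemma extended_potential_bump:
  assumes g: "boundary_graph \<Omega> e g G U"
    and \<zeta>: "\<And>x. (\<zeta> has_derivative (\<lambda>w. w \<bullet> D x)) (at x)" and D: "continuous_on UNIV D"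
    and S: "compact S" "S \<subseteq> U" "\<And>x. x \<notin> S \<Longrightarrow> \<zeta> x = 0" "\<And>x. x \<notin> S \<Longrightarrow> D x = 0"
    and ok: "density_ok (\<lambda>\<xi> _. \<zeta> \<xi>)" and t: "t > 0" and x: "x \<in> closure \<Omega>"
  shows "extended_potential (\<lambda>\<xi> _. \<zeta> \<xi>) x t
    = (\<integral>\<xi>. (indicator \<Omega> \<xi> * \<zeta> \<xi>) * heat_kernel (x - \<xi>) t \<partial>lborel) - \<zeta> x + gradient_potential (\<lambda>\<xi>. indicator \<Omega> \<xi> *\<^sub>R D \<xi>) x t"
proof -
  interpret B: boundary_graph \<Omega> e g G U by (rule g)
  have \<zeta>c: "continuous_on UNIV \<zeta>"
    by (intro continuous_at_imp_continuous_on ballI has_derivative_continuous[OF \<zeta>])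
  have [measurable]: "\<zeta> \<in> borel_measurable borel" by (rule borel_measurable_continuous_onI[OF \<zeta>c])
  have [measurable]: "D \<in> borel_measurable borel" by (rule borel_measurable_continuous_onI[OF D])
  obtain BD where BD: "BD > 0" "\<And>x. norm (D x) \<le> BD"
    using continuous_compact_support_bounded[OF D S(1,4)] by blast
  obtain BZ where BZ: "BZ > 0" "\<And>x. \<bar>\<zeta> x\<bar> \<le> BZ"
    using continuous_compact_support_bounded[OF \<zeta>c S(1,3)] by (metis real_norm_def)
  define h where "h \<xi> = indicator \<Omega> \<xi> *\<^sub>R D \<xi>" for \<xi>
  have hm[measurable]: "h \<in> borel_measurable borel" unfolding h_def by measurable
  have hb: "norm (h \<xi>) \<le> BD" for \<xi> using BD(1) BD(2)[of \<xi>] by (auto simp: h_def indicator_def)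
  have hi: "integrable lborel h"
    by (rule integrable_bounded_support[OF hm hb compact_imp_bounded[OF S(1)]]) (simp add: h_def S(4))
  define q where "q \<sigma> = (\<integral>\<xi>. normal_kernel (n \<xi>) (x - \<xi>) \<sigma> * \<zeta> \<xi> \<partial>boundary_measure \<Omega>)" for \<sigma>
  define r where "r \<sigma> = (\<integral>\<xi>. normal_kernel (h \<xi>) (x - \<xi>) \<sigma> \<partial>lborel)" for \<sigma>
  define p where "p s = (\<integral>\<xi>. indicator \<Omega> \<xi> * \<zeta> \<xi> * heat_kernel (x - \<xi>) s \<partial>lborel)" for s
  have qm[measurable]: "q \<in> borel_measurable borel" unfolding q_def by measurable
  have rm[measurable]: "r \<in> borel_measurable borel" unfolding r_def by measurable
  have pot: "potential (\<lambda>\<xi> _. \<zeta> \<xi>) x t = (\<integral>\<sigma>. indicator {0<..<t} \<sigma> * q \<sigma> \<partial>lborel)"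
    and qi: "integrable lborel (\<lambda>\<sigma>. indicator {0<..<t} \<sigma> * q \<sigma>)"
    using potential_iterated[OF ok, where x=x and t=t] unfolding q_def by simp_all
  have ri: "integrable lborel (\<lambda>\<sigma>. indicator {0<..<t} \<sigma> * r \<sigma>)"
    unfolding r_def by (rule gradient_potential_integrable[OF hi hb])
  have ae: "AE \<sigma> in lborel. (indicator {\<delta>..t} \<sigma> * u \<sigma> :: real) = indicator {\<delta>..t} \<sigma> * (indicator {0<..<t} \<sigma> * u \<sigma>)" if "\<delta> > 0" for \<delta> u
    using AE_lborel_singleton[of t] by eventually_elim (use that in \<open>auto simp: indicator_def\<close>)
  have trunc: "integrable lborel (\<lambda>\<sigma>. indicator {\<delta>..t} \<sigma> * (indicator {0<..<t} \<sigma> * u \<sigma>))"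
    if [measurable]: "u \<in> borel_measurable borel" and ui: "integrable lborel (\<lambda>\<sigma>. indicator {0<..<t} \<sigma> * u \<sigma>)" for u :: "real \<Rightarrow> real" and \<delta>
    by (rule Bochner_Integration.integrable_bound[OF ui]) (auto simp: indicator_def)
  have key: "(\<integral>\<sigma>. indicator {\<delta>..t} \<sigma> * (indicator {0<..<t} \<sigma> * q \<sigma>) \<partial>lborel) - (\<integral>\<sigma>. indicator {\<delta>..t} \<sigma> * (indicator {0<..<t} \<sigma> * r \<sigma>) \<partial>lborel) = p t - p \<delta>"
    if \<delta>: "0 < \<delta>" "\<delta> \<le> t" for \<delta>
  proof -
    have "(\<integral>\<sigma>. indicator {\<delta>..t} \<sigma> * (indicator {0<..<t} \<sigma> * q \<sigma>) \<partial>lborel) - (\<integral>\<sigma>. indicator {\<delta>..t} \<sigma> * (indicator {0<..<t} \<sigma> * r \<sigma>) \<partial>lborel)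
      = (\<integral>\<sigma>. indicator {\<delta>..t} \<sigma> * (indicator {0<..<t} \<sigma> * q \<sigma>) - indicator {\<delta>..t} \<sigma> * (indicator {0<..<t} \<sigma> * r \<sigma>) \<partial>lborel)"
      by (rule Bochner_Integration.integral_diff[symmetric, OF trunc[OF qm qi] trunc[OF rm ri]])
    also have "\<dots> = (\<integral>\<sigma>. indicator {\<delta>..t} \<sigma> * (\<integral>\<xi>. indicator \<Omega> \<xi> * \<zeta> \<xi> * heat_kernel_dt (x - \<xi>) \<sigma> \<partial>lborel) \<partial>lborel)"
    proof (rule integral_cong_AE)
      have kk: "indicator {\<delta>..t} \<sigma> * q \<sigma> - indicator {\<delta>..t} \<sigma> * r \<sigma> = indicator {\<delta>..t} \<sigma> * (\<integral>\<xi>. indicator \<Omega> \<xi> * \<zeta> \<xi> * heat_kernel_dt (x - \<xi>) \<sigma> \<partial>lborel)" for \<sigma>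
        using gauss_identity[OF g \<zeta> D S, where \<sigma>=\<sigma> and x=x] \<delta> by (auto simp: indicator_def q_def r_def h_def)
      show "AE \<sigma> in lborel. indicator {\<delta>..t} \<sigma> * (indicator {0<..<t} \<sigma> * q \<sigma>) - indicator {\<delta>..t} \<sigma> * (indicator {0<..<t} \<sigma> * r \<sigma>)
         = indicator {\<delta>..t} \<sigma> * (\<integral>\<xi>. indicator \<Omega> \<xi> * \<zeta> \<xi> * heat_kernel_dt (x - \<xi>) \<sigma> \<partial>lborel)"
        using ae[OF \<delta>(1), of q] ae[OF \<delta>(1), of r] by eventually_elim (simp only: kk[symmetric])
    qed measurable
    also have "\<dots> = p t - p \<delta>"
      unfolding p_def by (rule heat_convolution_time_FTC[OF \<zeta>c S(1,3) Omega_measurable \<delta>])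
    finally show ?thesis .
  qed
  have small: "(p \<longlongrightarrow> (if x \<in> \<Omega> then \<zeta> x else \<zeta> x / 2)) (at_right 0)"
  proof (cases "x \<in> \<Omega>")
    case True
    have "((\<lambda>\<delta>. \<integral>\<xi>. (indicator \<Omega> \<xi> * \<zeta> \<xi>) * heat_kernel (x - \<xi>) \<delta> \<partial>lborel) \<longlongrightarrow> (\<integral>z. \<zeta> x * heat_kernel (z::real^'n) 1 \<partial>lborel)) (at_right 0)"
    proof (rule heat_convolution_small_time[where B=BZ])
      show "\<bar>indicator \<Omega> \<xi> * \<zeta> \<xi>\<bar> \<le> BZ" for \<xi> using BZ(1) BZ(2)[of \<xi>] by (auto simp: indicator_def)
      show "AE z in lborel. ((\<lambda>\<delta>. indicator \<Omega> (x + sqrt \<delta> *\<^sub>R z) * \<zeta> (x + sqrt \<delta> *\<^sub>R z)) \<longlongrightarrow> \<zeta> x) (at_right 0)"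
      proof (rule AE_I2)
        fix z :: "real^'n"
        have sq: "((\<lambda>\<delta>. sqrt \<delta>) \<longlongrightarrow> 0) (at_right 0)" using tendsto_real_sqrt[OF tendsto_ident_at, of 0 "{0<..}"] by simp
        then have lx: "((\<lambda>\<delta>. x + sqrt \<delta> *\<^sub>R z) \<longlongrightarrow> x) (at_right 0)"
          using tendsto_add[OF tendsto_const tendsto_scaleR[OF sq tendsto_const[of z]], of x] by simp
        have l\<zeta>: "((\<lambda>\<delta>. \<zeta> (x + sqrt \<delta> *\<^sub>R z)) \<longlongrightarrow> \<zeta> x) (at_right 0)"
          using \<zeta>c lx by (auto simp: continuous_on_eq_continuous_at intro: isCont_tendsto_compose)
        have "eventually (\<lambda>\<delta>. x + sqrt \<delta> *\<^sub>R z \<in> \<Omega>) (at_right 0)" using topological_tendstoD[OF lx open_Omega True] .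
        then have "eventually (\<lambda>\<delta>. (indicator \<Omega> (x + sqrt \<delta> *\<^sub>R z) :: real) = 1) (at_right 0)" by eventually_elim simp
        from tendsto_mult[OF tendsto_eventually[OF this] l\<zeta>]
        show "((\<lambda>\<delta>. indicator \<Omega> (x + sqrt \<delta> *\<^sub>R z) * \<zeta> (x + sqrt \<delta> *\<^sub>R z)) \<longlongrightarrow> \<zeta> x) (at_right 0)" by simp
      qed
    qed measurable
    then show ?thesis using True by (simp add: p_def[abs_def] has_integral_heat_kernel(2))
  next
    case False
    then have fr: "x \<in> frontier \<Omega>" using x open_Omega by (simp add: frontier_def interior_open)
    define v where "v = B.N x"
    have v: "v \<noteq> 0" using B.norm_N(2)[of x] by (auto simp: v_def)
    have "((\<lambda>\<delta>. \<integral>\<xi>. (indicator \<Omega> \<xi> * \<zeta> \<xi>) * heat_kernel (x - \<xi>) \<delta> \<partial>lborel) \<longlongrightarrow> (\<integral>z. \<zeta> x * indicator {z. z \<bullet> v < 0} z * heat_kernel (z::real^'n) 1 \<partial>lborel)) (at_right 0)"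
    proof (rule heat_convolution_small_time[where B=BZ])
      show "\<bar>indicator \<Omega> \<xi> * \<zeta> \<xi>\<bar> \<le> BZ" for \<xi> using BZ(1) BZ(2)[of \<xi>] by (auto simp: indicator_def)
      have "negligible {z. v \<bullet> z = 0}" using v by (intro negligible_hyperplane) auto
      then have "AE z in lebesgue. z \<notin> {z. v \<bullet> z = 0}" by (intro AE_not_in) (simp add: negligible_iff_null_sets)
      then have "AE z in lborel. z \<notin> {z. v \<bullet> z = 0}" by (simp add: AE_completion_iff)
      then show "AE z in lborel. ((\<lambda>\<delta>. indicator \<Omega> (x + sqrt \<delta> *\<^sub>R z) * \<zeta> (x + sqrt \<delta> *\<^sub>R z)) \<longlongrightarrow> \<zeta> x * indicator {z. z \<bullet> v < 0} z) (at_right 0)"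
      proof eventually_elim
        case (elim z)
        then show ?case unfolding v_def
          using S(2,3) by (intro blow_up_tendsto[OF g \<zeta>c _ fr]) (auto simp: v_def inner_commute)
      qed
    qed measurable
    then show ?thesis using False by (simp add: p_def[abs_def] half_space_heat_mass[OF v])
  qed
  have "((\<lambda>\<delta>. p t - p \<delta>) \<longlongrightarrow> p t - (if x \<in> \<Omega> then \<zeta> x else \<zeta> x / 2)) (at_right 0)"
    by (intro tendsto_diff tendsto_const small)
  moreover have "((\<lambda>\<delta>. p t - p \<delta>) \<longlongrightarrow> (\<integral>\<sigma>. indicator {0<..<t} \<sigma> * q \<sigma> \<partial>lborel) - (\<integral>\<sigma>. indicator {0<..<t} \<sigma> * r \<sigma> \<partial>lborel)) (at_right 0)"
  proof (rule Lim_transform_eventually[OF tendsto_diff[OF truncated_integral_tendsto[OF qm qi] truncated_integral_tendsto[OF rm ri]]])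
    have "eventually (\<lambda>\<delta>. \<delta> < t) (at_right 0)" using t by (intro order_tendstoD[OF tendsto_ident_at]) auto
    moreover have "eventually (\<lambda>\<delta>. \<delta> > (0::real)) (at_right 0)" by (simp add: eventually_at_right_less)
    ultimately show "\<forall>\<^sub>F \<delta> in at_right 0. (\<integral>\<sigma>. indicator {\<delta>..t} \<sigma> * (indicator {0<..<t} \<sigma> * q \<sigma>) \<partial>lborel) - (\<integral>\<sigma>. indicator {\<delta>..t} \<sigma> * (indicator {0<..<t} \<sigma> * r \<sigma>) \<partial>lborel) = p t - p \<delta>"
      by eventually_elim (simp add: key)
  qed
  ultimately have "p t - (if x \<in> \<Omega> then \<zeta> x else \<zeta> x / 2) = (\<integral>\<sigma>. indicator {0<..<t} \<sigma> * q \<sigma> \<partial>lborel) - (\<integral>\<sigma>. indicator {0<..<t} \<sigma> * r \<sigma> \<partial>lborel)"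
    by (intro tendsto_unique[of "at_right (0::real)"]) auto
  then show ?thesis unfolding extended_potential_def pot gradient_potential_def p_def r_def h_def
    by (cases "x \<in> \<Omega>"; simp; linarith)
qed

end

section \<open>Continuity up to the boundary\<close>

lemma max_0_square_has_derivative:
  "((\<lambda>u::real. (max 0 u)\<^sup>2) has_real_derivative 2 * max 0 u) (at u)"
proof -
  consider "u > 0" | "u < 0" | "u = 0" by linarith
  then show ?thesis
  proof cases
    case 1
    have "((\<lambda>u::real. u\<^sup>2) has_real_derivative 2 * max 0 u) (at u)"
      using 1 by (auto intro!: derivative_eq_intros)
    then show ?thesis
      by (rule has_field_derivative_transform_within_open[of _ _ _ "{0<..}"]) (use 1 in auto)
  next
    case 2
    have "((\<lambda>u::real. 0) has_real_derivative 2 * max 0 u) (at u)" using 2 by simp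
    then show ?thesis
      by (rule has_field_derivative_transform_within_open[of _ _ _ "{..<0}"]) (use 2 in auto)
  next
    case 3
    have "((\<lambda>h::real. (max 0 h)\<^sup>2 / h) \<longlongrightarrow> 0) (at 0)"
    proof (rule Lim_null_comparison[OF _ tendsto_rabs_zero[OF tendsto_ident_at]])
      have "norm ((max 0 h)\<^sup>2 / h) \<le> \<bar>h\<bar>" for h :: real
        by (cases "h > 0") (auto simp: power2_eq_square)
      then show "\<forall>\<^sub>F h in at 0. norm ((max 0 h)\<^sup>2 / h) \<le> \<bar>h\<bar>" by (intro always_eventually) auto
    qed
    then show ?thesis using 3 by (simp add: has_field_derivative_iff)
  qed
qed

lemma smooth_bump:
  fixes x0 :: "'a::euclidean_space"
  assumes r: "r > 0"
  obtains \<zeta> D where "\<And>x. (\<zeta> has_derivative (\<lambda>w. w \<bullet> D x)) (at x)" "continuous_on UNIV D"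
    "\<And>x. x \<notin> cball x0 r \<Longrightarrow> \<zeta> x = 0" "\<And>x. x \<notin> cball x0 r \<Longrightarrow> D x = (0::'a)" "\<And>x. \<bar>\<zeta> x\<bar> \<le> 1" "\<zeta> x0 = (1::real)"
proof -
  define u where "u x = 1 - ((x - x0) \<bullet> (x - x0)) / r\<^sup>2" for x
  define \<zeta> where "\<zeta> x = (max 0 (u x))\<^sup>2" for x
  define D where "D x = (2 * max 0 (u x) * (- 2 / r\<^sup>2)) *\<^sub>R (x - x0)" for x
  have u1: "u x \<le> 1" for x by (simp add: u_def)
  have uneg: "u x \<le> 0" if "x \<notin> cball x0 r" for x
  proof -
    have "r \<le> norm (x - x0)" using that by (simp add: dist_norm norm_minus_commute)
    then have "r\<^sup>2 \<le> (norm (x - x0))\<^sup>2" using r by (intro power_mono) auto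
    then show ?thesis using r by (simp add: u_def dot_square_norm)
  qed
  have d: "(\<zeta> has_derivative (\<lambda>w. w \<bullet> D x)) (at x)" for x
  proof -
    have "(u has_derivative (\<lambda>w. - (2 / r\<^sup>2) * (w \<bullet> (x - x0)))) (at x)"
      unfolding u_def using r
      by (auto intro!: derivative_eq_intros simp: inner_commute fun_eq_iff field_simps)
    from has_derivative_compose[OF this max_0_square_has_derivative[of "u x", unfolded has_field_derivative_def]]
    have "(\<zeta> has_derivative (\<lambda>w. 2 * max 0 (u x) * (- (2 / r\<^sup>2) * (w \<bullet> (x - x0))))) (at x)"
      by (simp add: \<zeta>_def[abs_def])
    moreover have "(\<lambda>w. 2 * max 0 (u x) * (- (2 / r\<^sup>2) * (w \<bullet> (x - x0)))) = (\<lambda>w. w \<bullet> D x)"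
      by (auto simp: D_def fun_eq_iff)
    ultimately show ?thesis by simp
  qed
  show ?thesis
  proof (rule that[of \<zeta> D])
    show "continuous_on UNIV D" unfolding D_def u_def using r by (intro continuous_intros) auto
    show "\<zeta> x = 0" "D x = 0" if "x \<notin> cball x0 r" for x using uneg[OF that] by (simp_all add: \<zeta>_def D_def)
    show "\<bar>\<zeta> x\<bar> \<le> 1" for x using u1[of x] by (simp add: \<zeta>_def power_le_one)
    show "\<zeta> x0 = 1" by (simp add: \<zeta>_def u_def)
  qed (rule d)
qed

context double_layer_domain begin

lemma density_ok_add:
  assumes "density_ok \<psi>1" "density_ok \<psi>2"
  shows "density_ok (\<lambda>\<xi> t. \<psi>1 \<xi> t + c * \<psi>2 \<xi> t)"
proof -
  obtain B1 where B1: "B1 > 0" "\<And>\<xi> t. \<bar>\<psi>1 \<xi> t\<bar> \<le> B1" using density_bound[OF assms(1)] by blast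
  obtain B2 where B2: "B2 > 0" "\<And>\<xi> t. \<bar>\<psi>2 \<xi> t\<bar> \<le> B2" using density_bound[OF assms(2)] by blast
  have "\<bar>\<psi>1 \<xi> t + c * \<psi>2 \<xi> t\<bar> \<le> B1 + \<bar>c\<bar> * B2" for \<xi> t
  proof -
    have "\<bar>c * \<psi>2 \<xi> t\<bar> \<le> \<bar>c\<bar> * B2" using B2 by (simp add: abs_mult mult_left_mono)
    then show ?thesis using B1(2)[of \<xi> t] by linarith
  qed
  moreover have "continuous_on UNIV (\<lambda>(\<xi>, t). \<psi>1 \<xi> t + c * \<psi>2 \<xi> t)"
    using assms unfolding density_ok_def case_prod_beta' by (auto intro!: continuous_intros)
  ultimately show ?thesis unfolding density_ok_def by blast
qed

lemma potential_add:
  assumes "density_ok \<psi>1" "density_ok \<psi>2"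
  shows "potential (\<lambda>\<xi> t. \<psi>1 \<xi> t + c * \<psi>2 \<xi> t) x t = potential \<psi>1 x t + c * potential \<psi>2 x t"
proof -
  have "potential (\<lambda>\<xi> t. \<psi>1 \<xi> t + c * \<psi>2 \<xi> t) x t = (\<integral>p. integrand \<psi>1 x t p + c * integrand \<psi>2 x t p \<partial>PM)"
    unfolding potential_def by (intro Bochner_Integration.integral_cong) (auto simp: integrand_def algebra_simps)
  also have "\<dots> = potential \<psi>1 x t + (\<integral>p. c * integrand \<psi>2 x t p \<partial>PM)"
    unfolding potential_def
    by (intro Bochner_Integration.integral_add integrable_integrand assms integrable_mult_right)
  finally show ?thesis by (simp add: potential_def)
qed

lemma emeasure_boundary_null:
  assumes [measurable]: "A \<in> sets borel" and "A \<inter> frontier \<Omega> = {}"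
  shows "emeasure (boundary_measure \<Omega>) A = 0"
proof -
  have s[measurable_cong]: "sets (surface_measure \<Omega>) = sets borel" using sets_mu by (simp add: boundary_measure_def)
  have [measurable]: "frontier \<Omega> \<in> sets borel" by (simp add: frontier_closed borel_closed)
  have "emeasure (boundary_measure \<Omega>) A = (\<integral>\<^sup>+x. indicator (frontier \<Omega>) x * indicator A x \<partial>surface_measure \<Omega>)"
    unfolding boundary_measure_def by (rule emeasure_density) measurable
  also have "\<dots> = (\<integral>\<^sup>+x. 0 \<partial>surface_measure \<Omega>)"
    using assms(2) by (intro nn_integral_cong) (auto simp: indicator_def)
  finally show ?thesis by simp
qed

text \<open>
At a boundary point the density is split into \<open>c \<zeta>\<close>, where \<open>c = \<psi> x0 t0\<close> and \<open>\<zeta>\<close> is a bump function with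
\<open>\<zeta> x0 = 1\<close>, and a density \<open>\<rho>\<close> that vanishes at \<open>(x0, t0)\<close>. The first part is continuous by
\<open>extended_potential_bump\<close>, the second by \<open>potential_continuous_at_zero_of_density\<close>.
\<close>

lemma extended_potential_tendsto:
  assumes charts: "\<And>p. p \<in> frontier \<Omega> \<Longrightarrow> \<exists>e g G U. boundary_graph \<Omega> e g G U \<and> p \<in> U"
    and \<psi>: "density_ok \<psi>" and x0: "x0 \<in> closure \<Omega>" and t0: "t0 > 0"
  shows "((\<lambda>(x, t). extended_potential \<psi> x t) \<longlongrightarrow> extended_potential \<psi> x0 t0) (at (x0, t0) within closure \<Omega> \<times> UNIV)"
proof (cases "x0 \<in> \<Omega>")
  case True
  obtain r where r: "r > 0" "ball x0 r \<subseteq> \<Omega>" using True open_Omega open_contains_ball by blast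
  have "ball x0 r \<inter> frontier \<Omega> = {}" using r(2) open_Omega by (auto simp: frontier_def interior_open)
  then have "emeasure (boundary_measure \<Omega>) (ball x0 r) = 0" by (intro emeasure_boundary_null) auto
  then have "((\<lambda>(x, t). potential \<psi> x t) \<longlongrightarrow> potential \<psi> x0 t0) (at (x0, t0))"
    by (rule potential_continuous_off_support[OF \<psi> r(1)])
  then have "((\<lambda>(x, t). potential \<psi> x t) \<longlongrightarrow> extended_potential \<psi> x0 t0) (at (x0, t0))"
    using True by (simp add: extended_potential_def)
  moreover have "eventually (\<lambda>q. q \<in> \<Omega> \<times> UNIV) (at (x0, t0))"
    using True open_Omega by (intro eventually_at_in_open') (auto intro!: open_Times)
  then have "eventually (\<lambda>q. (case q of (x, t) \<Rightarrow> potential \<psi> x t) = (case q of (x, t) \<Rightarrow> extended_potential \<psi> x t)) (at (x0, t0))"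
    by eventually_elim (auto simp: extended_potential_def)
  ultimately have "((\<lambda>(x, t). extended_potential \<psi> x t) \<longlongrightarrow> extended_potential \<psi> x0 t0) (at (x0, t0))"
    by (rule Lim_transform_eventually)
  then show ?thesis by (rule tendsto_within_subset) simp
next
  case False
  then have fr: "x0 \<in> frontier \<Omega>" using x0 open_Omega by (simp add: frontier_def interior_open)
  obtain e g G U where g: "boundary_graph \<Omega> e g G U" "x0 \<in> U" using charts[OF fr] by blast
  interpret B: boundary_graph \<Omega> e g G U by (rule g)
  obtain r where r: "r > 0" "cball x0 r \<subseteq> U" using B.open_U g(2) open_contains_cball by blast
  obtain \<zeta> D where \<zeta>: "\<And>x. (\<zeta> has_derivative (\<lambda>w. w \<bullet> D x)) (at x)" "continuous_on UNIV D"
    "\<And>x. x \<notin> cball x0 r \<Longrightarrow> \<zeta> x = 0" "\<And>x. x \<notin> cball x0 r \<Longrightarrow> D x = 0" "\<And>x. \<bar>\<zeta> x\<bar> \<le> 1" "\<zeta> x0 = 1"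
    using smooth_bump[OF r(1)] by metis
  have \<zeta>c: "continuous_on UNIV \<zeta>"
    by (intro continuous_at_imp_continuous_on ballI has_derivative_continuous[OF \<zeta>(1)])
  have ok: "density_ok (\<lambda>\<xi> _. \<zeta> \<xi>)"
    unfolding density_ok_def case_prod_beta'
    using \<zeta>(5) by (auto intro!: continuous_on_compose2[OF \<zeta>c] continuous_intros)
  define c where "c = \<psi> x0 t0"
  define \<rho> where "\<rho> \<xi> t = \<psi> \<xi> t + (- c) * \<zeta> \<xi>" for \<xi> t
  have \<rho>: "density_ok \<rho>" unfolding \<rho>_def by (rule density_ok_add[OF \<psi> ok])
  have \<rho>0: "\<rho> x0 t0 = 0" by (simp add: \<rho>_def c_def \<zeta>(6))
  have dec: "extended_potential \<psi> x t = extended_potential \<rho> x t + c * extended_potential (\<lambda>\<xi> _. \<zeta> \<xi>) x t" for x t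
  proof -
    have "potential \<rho> x t = potential \<psi> x t + (- c) * potential (\<lambda>\<xi> _. \<zeta> \<xi>) x t"
      unfolding \<rho>_def by (rule potential_add[OF \<psi> ok])
    then show ?thesis by (simp add: extended_potential_def \<rho>_def algebra_simps diff_divide_distrib)
  qed
  let ?F = "at (x0, t0) within closure \<Omega> \<times> UNIV"
  have lx: "((\<lambda>q. fst q) \<longlongrightarrow> x0) ?F" and lt: "((\<lambda>q. snd q) \<longlongrightarrow> t0) ?F"
    using tendsto_fst[OF tendsto_ident_at, of "(x0, t0)"] tendsto_snd[OF tendsto_ident_at, of "(x0, t0)"] by simp_all
  have A: "((\<lambda>q. extended_potential \<rho> (fst q) (snd q)) \<longlongrightarrow> extended_potential \<rho> x0 t0) ?F"
  proof -
    have "((\<lambda>q. potential \<rho> (fst q) (snd q)) \<longlongrightarrow> potential \<rho> x0 t0) (at (x0, t0))"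
      using potential_continuous_at_zero_of_density[OF \<rho> \<rho>0] by (simp add: case_prod_beta')
    then have 1: "((\<lambda>q. potential \<rho> (fst q) (snd q)) \<longlongrightarrow> potential \<rho> x0 t0) ?F" by (rule tendsto_within_subset) simp
    have "((\<lambda>q. \<rho> (fst q) (snd q)) \<longlongrightarrow> 0) ?F" using density_tendsto[OF \<rho> lx lt] \<rho>0 by simp
    then have 2: "((\<lambda>q. \<bar>\<rho> (fst q) (snd q)\<bar>) \<longlongrightarrow> 0) ?F" by (rule tendsto_rabs_zero)
    have 3: "((\<lambda>q. if fst q \<in> \<Omega> then 0 else \<rho> (fst q) (snd q) / 2) \<longlongrightarrow> 0) ?F"
      by (rule Lim_null_comparison[OF _ 2]) (auto intro!: always_eventually)
    from tendsto_diff[OF 1 3] show ?thesis using \<rho>0 by (simp add: extended_potential_def)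
  qed
  have Z: "((\<lambda>q. extended_potential (\<lambda>\<xi> _. \<zeta> \<xi>) (fst q) (snd q)) \<longlongrightarrow> extended_potential (\<lambda>\<xi> _. \<zeta> \<xi>) x0 t0) ?F"
  proof -
    have rep: "extended_potential (\<lambda>\<xi> _. \<zeta> \<xi>) x t
      = (\<integral>\<xi>. (indicator \<Omega> \<xi> * \<zeta> \<xi>) * heat_kernel (x - \<xi>) t \<partial>lborel) - \<zeta> x + gradient_potential (\<lambda>\<xi>. indicator \<Omega> \<xi> *\<^sub>R D \<xi>) x t"
      if "t > 0" "x \<in> closure \<Omega>" for x t
      by (rule extended_potential_bump[OF g(1) \<zeta>(1,2) compact_cball r(2) \<zeta>(3,4) ok]) (use that in auto)
    have i1: "integrable lborel (\<lambda>\<xi>. indicator \<Omega> \<xi> * \<zeta> \<xi>)"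
      by (rule integrable_continuous_compact_support[OF \<zeta>c compact_cball \<zeta>(3) Omega_measurable])
    have Dm[measurable]: "D \<in> borel_measurable borel" by (rule borel_measurable_continuous_onI[OF \<zeta>(2)])
    obtain BD where BD: "BD > 0" "\<And>x. norm (D x) \<le> BD"
      using continuous_compact_support_bounded[OF \<zeta>(2) compact_cball \<zeta>(4)] by blast
    have b2: "norm (indicator \<Omega> \<xi> *\<^sub>R D \<xi>) \<le> BD" for \<xi> using BD(1) BD(2)[of \<xi>] by (auto simp: indicator_def)
    have i2: "integrable lborel (\<lambda>\<xi>. indicator \<Omega> \<xi> *\<^sub>R D \<xi>)"
      by (rule integrable_bounded_support[OF _ b2 bounded_cball[of x0 r]]) (use \<zeta>(4) in auto)
    have hc: "((\<lambda>(x, t). \<integral>\<xi>. (indicator \<Omega> \<xi> * \<zeta> \<xi>) * heat_kernel (x - \<xi>) t \<partial>lborel) \<longlongrightarrow> (\<integral>\<xi>. (indicator \<Omega> \<xi> * \<zeta> \<xi>) * heat_kernel (x0 - \<xi>) t0 \<partial>lborel)) (at (x0, t0))"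
      by (rule heat_convolution_tendsto[OF i1 t0])
    have "((\<lambda>q. \<integral>\<xi>. (indicator \<Omega> \<xi> * \<zeta> \<xi>) * heat_kernel (fst q - \<xi>) (snd q) \<partial>lborel) \<longlongrightarrow> (\<integral>\<xi>. (indicator \<Omega> \<xi> * \<zeta> \<xi>) * heat_kernel (x0 - \<xi>) t0 \<partial>lborel)) (at (x0, t0))"
      using hc by (simp add: case_prod_beta')
    then have 1: "((\<lambda>q. \<integral>\<xi>. (indicator \<Omega> \<xi> * \<zeta> \<xi>) * heat_kernel (fst q - \<xi>) (snd q) \<partial>lborel) \<longlongrightarrow> (\<integral>\<xi>. (indicator \<Omega> \<xi> * \<zeta> \<xi>) * heat_kernel (x0 - \<xi>) t0 \<partial>lborel)) ?F"
      by (rule tendsto_within_subset) simp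
    have gp: "((\<lambda>(x, t). gradient_potential (\<lambda>\<xi>. indicator \<Omega> \<xi> *\<^sub>R D \<xi>) x t) \<longlongrightarrow> gradient_potential (\<lambda>\<xi>. indicator \<Omega> \<xi> *\<^sub>R D \<xi>) x0 t0) (at (x0, t0))"
      by (rule gradient_potential_tendsto[OF i2 b2])
    have "((\<lambda>q. gradient_potential (\<lambda>\<xi>. indicator \<Omega> \<xi> *\<^sub>R D \<xi>) (fst q) (snd q)) \<longlongrightarrow> gradient_potential (\<lambda>\<xi>. indicator \<Omega> \<xi> *\<^sub>R D \<xi>) x0 t0) (at (x0, t0))"
      using gp by (simp add: case_prod_beta')
    then have 2: "((\<lambda>q. gradient_potential (\<lambda>\<xi>. indicator \<Omega> \<xi> *\<^sub>R D \<xi>) (fst q) (snd q)) \<longlongrightarrow> gradient_potential (\<lambda>\<xi>. indicator \<Omega> \<xi> *\<^sub>R D \<xi>) x0 t0) ?F"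
      by (rule tendsto_within_subset) simp
    have 3: "((\<lambda>q. \<zeta> (fst q)) \<longlongrightarrow> \<zeta> x0) ?F"
      using \<zeta>c lx by (auto simp: continuous_on_eq_continuous_at intro: isCont_tendsto_compose)
    have ev: "eventually (\<lambda>q. snd q > 0 \<and> fst q \<in> closure \<Omega>) ?F"
    proof (rule eventually_conj)
      show "eventually (\<lambda>q. snd q > 0) ?F" using lt t0 by (auto intro: order_tendstoD)
      show "eventually (\<lambda>q. fst q \<in> closure \<Omega>) ?F" by (auto simp: eventually_at_filter intro!: always_eventually)
    qed
    have "((\<lambda>q. extended_potential (\<lambda>\<xi> _. \<zeta> \<xi>) (fst q) (snd q)) \<longlongrightarrow>
       (\<integral>\<xi>. (indicator \<Omega> \<xi> * \<zeta> \<xi>) * heat_kernel (x0 - \<xi>) t0 \<partial>lborel) - \<zeta> x0 + gradient_potential (\<lambda>\<xi>. indicator \<Omega> \<xi> *\<^sub>R D \<xi>) x0 t0) ?F"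
    proof (rule Lim_transform_eventually[OF tendsto_add[OF tendsto_diff[OF 1 3] 2]])
      show "\<forall>\<^sub>F q in ?F. (\<integral>\<xi>. (indicator \<Omega> \<xi> * \<zeta> \<xi>) * heat_kernel (fst q - \<xi>) (snd q) \<partial>lborel) - \<zeta> (fst q)
         + gradient_potential (\<lambda>\<xi>. indicator \<Omega> \<xi> *\<^sub>R D \<xi>) (fst q) (snd q) = extended_potential (\<lambda>\<xi> _. \<zeta> \<xi>) (fst q) (snd q)"
        using ev by eventually_elim (rule rep[symmetric]; simp)
    qed
    then show ?thesis using rep[OF t0 x0] by simp
  qed
  show ?thesis unfolding dec case_prod_beta'
    by (intro tendsto_add tendsto_mult tendsto_const A Z)
qed

end

locale hoelder_domain =
  fixes \<Omega> :: "(real^'n) set" and \<alpha> :: real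
  assumes \<alpha>: "\<alpha> > 0" and op: "open \<Omega>" and ne: "\<Omega> \<noteq> {}" and bd: "bounded \<Omega>" and C1: "C1_Hoelder_boundary \<alpha> \<Omega>"
begin

lemma obtain_chart:
  assumes "p \<in> frontier \<Omega>"
  obtains e g G U C where "boundary_graph \<Omega> e g G U" "p \<in> U" "\<forall>x y. norm (G x - G y) \<le> C * dist x y powr \<alpha>"
proof -
  from C1[unfolded C1_Hoelder_boundary_def, rule_format, OF assms]
  obtain e g G U C where "boundary_chart \<Omega> e g G U" "p \<in> U" "\<forall>x y. norm (G x - G y) \<le> C * dist x y powr \<alpha>"
    by (elim exE conjE) (rule that)
  then show ?thesis using op by (intro that[of e g G U C] boundary_graphI)
qed

lemma frontier_nonempty: "frontier \<Omega> \<noteq> {}"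
proof
  assume "frontier \<Omega> = {}"
  then have "\<Omega> = UNIV" using ne by (auto simp: frontier_eq_empty)
  then show False using bd by simp
qed

lemma compact_frontier: "compact (frontier \<Omega>)"
  using bd by (rule compact_frontier_bounded)

lemma sets_surface [simp]: "sets (surface_measure \<Omega>) = sets borel"
  and sets_boundary [simp, measurable_cong]: "sets (boundary_measure \<Omega>) = sets borel"
proof -
  obtain p where "p \<in> frontier \<Omega>" using frontier_nonempty by blast
  then obtain e g G U C where g: "boundary_graph \<Omega> e g G U" by (rule obtain_chart)
  then show "sets (surface_measure \<Omega>) = sets borel" "sets (boundary_measure \<Omega>) = sets borel"
    using boundary_graph.sets_surface_measure[OF g, of "{}"] boundary_graph.sets_boundary_measure[OF g] by simp_all
qed

lemma finite_boundary: "finite_measure (boundary_measure \<Omega>)"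
proof
  have Fm[measurable]: "frontier \<Omega> \<in> sets borel" by (simp add: frontier_closed borel_closed)
  have "\<exists>r>0. emeasure (boundary_measure \<Omega>) (ball p r) < \<infinity>" if p: "p \<in> frontier \<Omega>" for p
  proof -
    obtain e g G U C where g: "boundary_graph \<Omega> e g G U" "p \<in> U" by (rule obtain_chart[OF p])
    interpret B: boundary_graph \<Omega> e g G U by (rule g)
    obtain r where r: "r > 0" "ball p r \<subseteq> U" using B.open_U g(2) open_contains_ball by blast
    have "emeasure (boundary_measure \<Omega>) (ball p r) = emeasure (surface_measure \<Omega>) (ball p r \<inter> frontier \<Omega>)"
      by (rule B.emeasure_boundary_measure) simp
    also have "\<dots> = emeasure (graph_area_measure e g G U) (ball p r \<inter> frontier \<Omega>)"
      using r by (intro B.surface_measure_eq) auto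
    also have "\<dots> < \<infinity>" by (intro B.emeasure_graph_area_bounded bounded_Int) auto
    finally show ?thesis using r(1) by blast
  qed
  then obtain r where r: "\<And>p. p \<in> frontier \<Omega> \<Longrightarrow> r p > 0 \<and> emeasure (boundary_measure \<Omega>) (ball p (r p)) < \<infinity>" by metis
  have "frontier \<Omega> \<subseteq> (\<Union>p\<in>frontier \<Omega>. ball p (r p))" using r by fastforce
  then obtain I where I: "I \<subseteq> frontier \<Omega>" "finite I" "frontier \<Omega> \<subseteq> (\<Union>p\<in>I. ball p (r p))"
    using compactE_image[OF compact_frontier, of "frontier \<Omega>" "\<lambda>p. ball p (r p)"] by auto
  obtain p where "p \<in> frontier \<Omega>" using frontier_nonempty by blast
  then obtain e g G U C where g: "boundary_graph \<Omega> e g G U" by (rule obtain_chart)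
  interpret B: boundary_graph \<Omega> e g G U by (rule g)
  have "emeasure (boundary_measure \<Omega>) (space (boundary_measure \<Omega>)) = emeasure (boundary_measure \<Omega>) (frontier \<Omega>)"
    using B.emeasure_boundary_measure[of UNIV] B.emeasure_boundary_measure[OF Fm] sets_eq_imp_space_eq[OF sets_boundary] by simp
  also have "\<dots> \<le> emeasure (boundary_measure \<Omega>) (\<Union>p\<in>I. ball p (r p))"
    using I by (intro emeasure_mono) auto
  also have "\<dots> \<le> (\<Sum>p\<in>I. emeasure (boundary_measure \<Omega>) (ball p (r p)))"
    using I by (intro emeasure_subadditive_finite) auto
  also have "\<dots> < \<infinity>" using I r by auto
  finally show "emeasure (boundary_measure \<Omega>) (space (boundary_measure \<Omega>)) \<noteq> \<infinity>" by simp
qed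

lemma outward_normal_continuous: "continuous_on (frontier \<Omega>) (outward_normal \<Omega>)"
  unfolding continuous_on_def
proof
  fix p assume p: "p \<in> frontier \<Omega>"
  obtain e g G U C where g: "boundary_graph \<Omega> e g G U" "p \<in> U" by (rule obtain_chart[OF p])
  interpret B: boundary_graph \<Omega> e g G U by (rule g)
  have nz: "norm (B.N x) \<noteq> 0" for x using B.norm_N(2)[of x] by linarith
  have "continuous_on UNIV (\<lambda>x. B.N x /\<^sub>R norm (B.N x))" using nz B.G_cont by (auto intro!: continuous_intros)
  then have "((\<lambda>x. B.N x /\<^sub>R norm (B.N x)) \<longlongrightarrow> B.N p /\<^sub>R norm (B.N p)) (at p)"
    by (simp add: continuous_on_eq_continuous_at isCont_def)
  then have "((\<lambda>x. B.N x /\<^sub>R norm (B.N x)) \<longlongrightarrow> outward_normal \<Omega> p) (at p within frontier \<Omega>)"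
    using B.outward_normal_eq[OF g(2) p] by (auto intro: tendsto_within_subset)
  moreover have "eventually (\<lambda>x. B.N x /\<^sub>R norm (B.N x) = outward_normal \<Omega> x) (at p within frontier \<Omega>)"
    unfolding eventually_at_topological
    using B.open_U g(2) B.outward_normal_eq by (intro exI[of _ U]) auto
  ultimately show "(outward_normal \<Omega> \<longlongrightarrow> outward_normal \<Omega> p) (at p within frontier \<Omega>)"
    by (rule Lim_transform_eventually)
qed

lemma norm_outward_normal: "p \<in> frontier \<Omega> \<Longrightarrow> norm (outward_normal \<Omega> p) = 1"
proof -
  assume p: "p \<in> frontier \<Omega>"
  obtain e g G U C where g: "boundary_graph \<Omega> e g G U" "p \<in> U" by (rule obtain_chart[OF p])
  interpret B: boundary_graph \<Omega> e g G U by (rule g)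
  have "norm (B.N p) \<noteq> 0" using B.norm_N(2)[of p] by linarith
  then show ?thesis using B.outward_normal_eq[OF g(2) p] by simp
qed

text \<open>
Cut off to the boundary, the normal is Borel measurable on the whole space.
\<close>

definition normal_field :: "real^'n \<Rightarrow> real^'n" where
  "normal_field \<xi> = indicator (frontier \<Omega>) \<xi> *\<^sub>R outward_normal \<Omega> \<xi>"

lemma normal_field_measurable [measurable]: "normal_field \<in> borel_measurable borel"
  unfolding normal_field_def[abs_def]
  by (rule borel_measurable_continuous_on_indicator[OF _ outward_normal_continuous])
    (simp add: frontier_closed borel_closed)

sublocale double_layer_domain \<Omega> normal_field
proof -
  interpret finite_measure "boundary_measure \<Omega>" by (rule finite_boundary)
  show "double_layer_domain \<Omega> normal_field"
  proof
    show "sets (boundary_measure \<Omega>) = sets borel" by simp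
    show "normal_field \<in> borel_measurable borel" by simp
    show "norm (normal_field \<xi>) \<le> 1" for \<xi> using norm_outward_normal by (auto simp: normal_field_def indicator_def)
    show "open \<Omega>" by (rule op)
    show "\<xi> \<in> frontier \<Omega> \<Longrightarrow> normal_field \<xi> = outward_normal \<Omega> \<xi>" for \<xi> by (simp add: normal_field_def)
    fix x0 :: "real^'n" and T :: real
    show "\<exists>r>0. \<exists>M\<ge>0. \<forall>x\<in>ball x0 r. near_mass (boundary_measure \<Omega>) normal_field x0 r T x \<le> ennreal M"
    proof (cases "x0 \<in> frontier \<Omega>")
      case True
      obtain e g G U C where g: "boundary_graph \<Omega> e g G U" "x0 \<in> U" "\<forall>x y. norm (G x - G y) \<le> C * dist x y powr \<alpha>"
        by (rule obtain_chart[OF True])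
      interpret B: boundary_graph \<Omega> e g G U by (rule g)
      have nf: "\<xi> \<in> frontier \<Omega> \<Longrightarrow> normal_field \<xi> = outward_normal \<Omega> \<xi>" for \<xi> by (simp add: normal_field_def)
      show ?thesis
      proof (rule B.double_layer_near_bound[OF g(3)[rule_format] \<alpha> g(2) normal_field_measurable nf, where T="max T 0"])
        show "0 \<le> max T 0" by simp
        fix r M assume rM: "r > 0" "ball x0 r \<subseteq> U" "\<And>x. x \<in> ball x0 r \<Longrightarrow>
        near_mass (boundary_measure \<Omega>) normal_field x0 r (max T 0) x \<le> ennreal M"
      have T: "{0<..<max T 0} = {0<..<T}" by auto
      have "near_mass (boundary_measure \<Omega>) normal_field x0 r T x \<le> ennreal (max M 0)"
        if "x \<in> ball x0 r" for x
        using order_trans[OF rM(3)[OF that, unfolded T] ennreal_leI[of M "max M 0"]] by simp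
      then show ?thesis using rM(1) by (intro exI[of _ r] conjI exI[of _ "max M 0"] ballI) auto
      qed
    next
      case False
      then have "open (- frontier \<Omega>)" "x0 \<in> - frontier \<Omega>" by (auto simp: frontier_closed)
      then obtain r where r: "r > 0" "ball x0 r \<subseteq> - frontier \<Omega>" using open_contains_ball by blast
      \<comment> \<open>Away from the boundary the cut-off of the normal makes the kernel vanish.\<close>
      have z: "indicator (ball x0 r) \<xi> * ennreal \<bar>normal_kernel (normal_field \<xi>) (x - \<xi>) \<sigma>\<bar> = 0" for x \<xi> \<sigma>
        using r(2) by (auto simp: indicator_def normal_field_def normal_kernel_def)
      show ?thesis using r(1) by (intro exI[of _ r] conjI exI[of _ 0]) (simp_all add: z)
    qed
  qed
qed

end

section \<open>The change of time and the double layer potential\<close>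

locale time_change =
  fixes T :: real and a :: "real \<Rightarrow> real"
  assumes T: "0 < T" and a_L1: "set_integrable lebesgue {0..T} a" and a_nonneg: "\<forall>t\<in>{0..T}. 0 \<le> a t"
    and a_zeros: "\<forall>t\<in>{t\<in>{0..T}. a t = 0}. t isolated_in {t\<in>{0..T}. a t = 0}"
begin

abbreviation A :: "real \<Rightarrow> real" where "A \<equiv> coeff_primitive a"

lemma a_integrable_sub: "0 \<le> s \<Longrightarrow> t \<le> T \<Longrightarrow> set_integrable lebesgue {s..t} a"
  by (rule set_integrable_subset[OF a_L1]) auto

lemma A_eq: "t \<in> {0..T} \<Longrightarrow> A t = integral {0..t} a"
  unfolding coeff_primitive_def by (rule set_lebesgue_integral_eq_integral(2)[OF a_integrable_sub]) auto

lemma A_0 [simp]: "A 0 = 0"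
  using A_eq[of 0] T by simp

lemma A_diff:
  assumes "0 \<le> s" "s \<le> t" "t \<le> T"
  shows "A t - A s = (LINT z:{s..t}|lebesgue. a z)"
proof -
  have "integral {0..s} a + integral {s..t} a = integral {0..t} a"
    using assms a_integrable_sub[of 0 t] by (intro Henstock_Kurzweil_Integration.integral_combine set_lebesgue_integral_eq_integral(1)) auto
  then show ?thesis
    using assms A_eq[of s] A_eq[of t] set_lebesgue_integral_eq_integral(2)[OF a_integrable_sub[of s t]] by simp
qed

lemma A_continuous: "continuous_on {0..T} A"
proof -
  have "continuous_on {0..T} (\<lambda>x. integral {0..x} a)"
    by (rule indefinite_integral_continuous_1) (rule set_lebesgue_integral_eq_integral(1)[OF a_L1])
  then show ?thesis by (rule continuous_on_cong[THEN iffD1, rotated -1]) (auto simp: A_eq)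
qed

text \<open>
If the primitive were constant on an interval, then \<open>a\<close> would vanish almost everywhere on it. So every subinterval
would contain zeros, and none of them could be isolated.
\<close>

lemma A_strict: 
  assumes st: "0 \<le> s" "s < t" "t \<le> T"
  shows "A s < A t"
proof (rule ccontr)
  assume "\<not> A s < A t"
  then have le: "(LINT z:{s..t}|lebesgue. a z) \<le> 0" using A_diff[of s t] st by simp
  have i: "integrable lebesgue (\<lambda>z. indicator {s..t} z *\<^sub>R a z)"
    using a_integrable_sub[of s t] st by (simp add: set_integrable_def)
  have nn: "AE z in lebesgue. 0 \<le> indicator {s..t} z *\<^sub>R a z"
    using a_nonneg st by (intro AE_I2) (auto simp: indicator_def)
  have "(\<integral>z. indicator {s..t} z *\<^sub>R a z \<partial>lebesgue) = 0"
    using le integral_nonneg_AE[OF nn] by (simp add: set_lebesgue_integral_def)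
  then have ae: "AE z in lebesgue. indicator {s..t} z *\<^sub>R a z = 0"
    using integral_nonneg_eq_0_iff_AE[OF i nn] by blast
  have zero_in: "\<exists>z\<in>{u<..<v}. a z = 0" if uv: "s \<le> u" "u < v" "v \<le> t" for u v
  proof (rule ccontr)
    assume nz: "\<not> (\<exists>z\<in>{u<..<v}. a z = 0)"
    have "AE z in lebesgue. z \<notin> {u<..<v}"
      using ae by eventually_elim (use uv nz in \<open>auto simp: indicator_def\<close>)
    moreover have "{z \<in> space lebesgue. \<not> z \<notin> {u<..<v}} = {u<..<v}" by auto
    ultimately have "emeasure lebesgue {u<..<v} = 0"
      using AE_iff_measurable[of "{u<..<v}" lebesgue "\<lambda>z. z \<notin> {u<..<v}"] by simp
    then show False using uv by simp
  qed
  obtain z where z: "z \<in> {s<..<t}" "a z = 0" using zero_in[of s t] st by auto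
  define Z where "Z = {t\<in>{0..T}. a t = 0}"
  have "z \<in> Z" using z st by (auto simp: Z_def)
  then have "z isolated_in Z" using a_zeros by (auto simp: Z_def)
  then obtain e where e: "e > 0" "\<forall>y\<in>Z. dist z y < e \<longrightarrow> y = z" unfolding isolated_in_dist_Ex_iff by blast
  have "s \<le> z" "z < min t (z + e)" using z(1) e(1) by simp_all
  then have "\<exists>y\<in>{z<..<min t (z + e)}. a y = 0" by (rule zero_in) simp
  then obtain y where y: "y \<in> {z<..<min t (z + e)}" "a y = 0" by blast
  have "y \<in> Z" using y z(1) st by (simp add: Z_def)
  moreover have "dist z y < e" using y(1) by (simp add: dist_real_def)
  ultimately have "y = z" using e(2) by blast
  then show False using y(1) by simp
qed

lemma A_mono: "0 \<le> s \<Longrightarrow> s \<le> t \<Longrightarrow> t \<le> T \<Longrightarrow> A s \<le> A t"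
  using A_strict[of s t] by (cases "s = t") auto

lemma A_le_iff: "s \<in> {0..T} \<Longrightarrow> t \<in> {0..T} \<Longrightarrow> A s \<le> A t \<longleftrightarrow> s \<le> t"
  using A_strict[of t s] A_mono[of s t] by (cases "s \<le> t") auto

lemma A_inj: "inj_on A {0..T}"
proof (rule inj_onI)
  fix s t assume "s \<in> {0..T}" "t \<in> {0..T}" "A s = A t"
  then show "s = t" using A_le_iff[of s t] A_le_iff[of t s] by simp
qed

lemma A_pos: "0 < t \<Longrightarrow> t \<le> T \<Longrightarrow> 0 < A t"
  using A_strict[of 0 t] by simp

text \<open>
\<open>A\<close> is only known to be measurable on \<open>{0..T}\<close>; \<open>clamped\<close> continues it by its values at the end points.
\<close>

definition clamped :: "real \<Rightarrow> real" where "clamped t = A (max 0 (min T t))"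

lemma clamped_eq: "t \<in> {0..T} \<Longrightarrow> clamped t = A t"
  by (simp add: clamped_def)

lemma clamped_measurable [measurable]: "clamped \<in> borel_measurable lebesgue"
proof -
  have "continuous_on UNIV clamped"
    unfolding clamped_def using T by (intro continuous_on_compose2[OF A_continuous]) (auto intro!: continuous_intros)
  then have "clamped \<in> borel_measurable borel" by (rule borel_measurable_continuous_onI)
  then have "clamped \<in> borel_measurable lborel" by simp
  then show ?thesis by (rule measurable_completion)
qed

text \<open>
The image of \<open>a d\<tau>\<close> under its primitive is Lebesgue measure, because both measures have the same distribution
function: the preimage of \<open>{..A u}\<close> is \<open>{..u}\<close>, and its mass is \<open>A u\<close>.
\<close>

lemma distr_primitive:
  assumes s: "s \<in> {0..T}"
  shows "distr (density lebesgue (\<lambda>\<tau>. ennreal (indicator {0..s} \<tau> * a \<tau>))) borel clamped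
    = density lborel (\<lambda>w. ennreal (indicator {0..A s} w))" (is "?L = ?R")
proof (rule cdf_unique')
  let ?d = "\<lambda>\<tau>. indicator {0..s} \<tau> * a \<tau>"
  have ai: "integrable lebesgue (\<lambda>\<tau>. indicator {0..u} \<tau> * a \<tau>)" if "u \<le> T" for u
    using a_integrable_sub[of 0 u] that by (simp add: set_integrable_def)
  have dm[measurable]: "?d \<in> borel_measurable lebesgue" using ai[of s] s by auto
  have Lc: "emeasure ?L {..c} = ennreal (A u)"
    if u: "u \<in> {0..s}" and eq: "\<And>\<tau>. \<tau> \<in> {0..s} \<Longrightarrow> A \<tau> \<le> c \<longleftrightarrow> \<tau> \<le> u" for c u
  proof -
    have "emeasure ?L {..c} = (\<integral>\<^sup>+\<tau>. ennreal (?d \<tau>) * indicator (clamped -` {..c}) \<tau> \<partial>lebesgue)"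
      using measurable_sets[OF clamped_measurable, of "{..c}"]
      by (subst emeasure_distr, simp, simp, subst emeasure_density) auto
    also have "\<dots> = (\<integral>\<^sup>+\<tau>. ennreal (indicator {0..u} \<tau> * a \<tau>) \<partial>lebesgue)"
      using u eq s by (intro nn_integral_cong) (auto simp: indicator_def clamped_eq)
    also have "\<dots> = ennreal (\<integral>\<tau>. indicator {0..u} \<tau> * a \<tau> \<partial>lebesgue)"
      using u s a_nonneg by (intro nn_integral_eq_integral ai AE_I2) (auto simp: indicator_def)
    also have "(\<integral>\<tau>. indicator {0..u} \<tau> * a \<tau> \<partial>lebesgue) = A u"
      by (simp add: coeff_primitive_def set_lebesgue_integral_def)
    finally show ?thesis .
  qed
  have Lneg: "emeasure ?L {..c} = 0" if "c < 0" for c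
  proof -
    have "A \<tau> \<ge> 0" if "\<tau> \<in> {0..s}" for \<tau> using A_mono[of 0 \<tau>] that s by auto
    then have "\<tau> \<in> {0..s} \<Longrightarrow> \<not> A \<tau> \<le> c" for \<tau> using that by (force simp: not_le)
    then have z: "ennreal (?d \<tau>) * indicator (clamped -` {..c}) \<tau> = 0" for \<tau>
      using s by (auto simp: indicator_def clamped_eq)
    have "emeasure ?L {..c} = (\<integral>\<^sup>+\<tau>. ennreal (?d \<tau>) * indicator (clamped -` {..c}) \<tau> \<partial>lebesgue)"
      using measurable_sets[OF clamped_measurable, of "{..c}"]
      by (subst emeasure_distr, simp, simp, subst emeasure_density) auto
    then show ?thesis by (simp add: z)
  qed
  have Rc: "emeasure ?R {..c} = emeasure lborel ({0..A s} \<inter> {..c})" for c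
    by (subst emeasure_density) (auto simp: ennreal_indicator indicator_inter_arith[symmetric])
  have eq: "emeasure ?L {..c} = emeasure ?R {..c}" for c
  proof (cases "c < 0")
    case True
    then have "{0..A s} \<inter> {..c} = {}" by auto
    then show ?thesis using Lneg[OF True] Rc[of c] by simp
  next
    case c0: False
    show ?thesis
    proof (cases "c \<le> A s")
      case True
      obtain u where u: "0 \<le> u" "u \<le> s" "A u = c"
        using IVT'[of A 0 c s] c0 True s continuous_on_subset[OF A_continuous, of "{0..s}"] by auto
      have "{0..A s} \<inter> {..c} = {0..c}" using True by auto
      then show ?thesis using Lc[of u c] u s A_le_iff Rc[of c] c0 by auto
    next
      case False
      then have "{0..A s} \<inter> {..c} = {0..A s}" by auto
      moreover have "\<tau> \<in> {0..s} \<Longrightarrow> A \<tau> \<le> c" for \<tau> using A_mono[of \<tau> s] s False by auto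
      moreover have "A s \<ge> 0" using A_mono[of 0 s] s by simp
      ultimately show ?thesis using Lc[of s c] s Rc[of c] by auto
    qed
  qed
  have fin: "emeasure ?L UNIV \<noteq> \<infinity>"
  proof -
    have "emeasure ?L UNIV = (\<integral>\<^sup>+\<tau>. ennreal (?d \<tau>) \<partial>lebesgue)"
      by (subst emeasure_distr, simp, simp, subst emeasure_density) auto
    also have "\<dots> = ennreal (\<integral>\<tau>. ?d \<tau> \<partial>lebesgue)"
      using s a_nonneg by (intro nn_integral_eq_integral ai AE_I2) (auto simp: indicator_def)
    finally show ?thesis by simp
  qed
  have finR: "emeasure ?R UNIV \<noteq> \<infinity>"
    by (subst emeasure_density) (auto simp: ennreal_indicator emeasure_lborel_Icc_eq)
  show "finite_borel_measure ?L" using fin by (auto simp: finite_borel_measure_def finite_borel_measure_axioms_def intro!: finite_measureI)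
  show "finite_borel_measure ?R" using finR by (auto simp: finite_borel_measure_def finite_borel_measure_axioms_def intro!: finite_measureI)
  show "cdf ?L = cdf ?R" using eq by (auto simp: cdf_def fun_eq_iff measure_def)
qed

lemma primitive_substitution:
  fixes F :: "real \<Rightarrow> real"
  assumes s: "s \<in> {0..T}" and F[measurable]: "F \<in> borel_measurable borel"
  shows "set_integrable lebesgue {0..s} (\<lambda>\<tau>. F (A \<tau>) * a \<tau>) \<longleftrightarrow> integrable lborel (\<lambda>w. indicator {0..A s} w * F w)"
    "(LINT \<tau>:{0..s}|lebesgue. F (A \<tau>) * a \<tau>) = (\<integral>w. indicator {0..A s} w * F w \<partial>lborel)"
proof -
  let ?d = "\<lambda>\<tau>. indicator {0..s} \<tau> * a \<tau>"
  have dm[measurable]: "?d \<in> borel_measurable lebesgue"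
    using a_integrable_sub[of 0 s] s by (auto simp: set_integrable_def)
  have dn: "AE \<tau> in lebesgue. 0 \<le> ?d \<tau>" using s a_nonneg by (intro AE_I2) (auto simp: indicator_def)
  have e: "indicator {0..s} \<tau> *\<^sub>R (F (A \<tau>) * a \<tau>) = ?d \<tau> *\<^sub>R F (clamped \<tau>)" for \<tau>
    using s by (auto simp: indicator_def clamped_eq)
  have "integrable lebesgue (\<lambda>\<tau>. ?d \<tau> *\<^sub>R F (clamped \<tau>)) \<longleftrightarrow> integrable (density lebesgue (\<lambda>\<tau>. ennreal (?d \<tau>))) (\<lambda>\<tau>. F (clamped \<tau>))"
    by (rule integrable_density[symmetric]) (use dn in measurable)
  also have "\<dots> \<longleftrightarrow> integrable (distr (density lebesgue (\<lambda>\<tau>. ennreal (?d \<tau>))) borel clamped) F"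
    by (rule integrable_distr_eq[symmetric]) auto
  also have "\<dots> \<longleftrightarrow> integrable lborel (\<lambda>w. indicator {0..A s} w *\<^sub>R F w)"
    unfolding distr_primitive[OF s] by (rule integrable_density) auto
  finally show "set_integrable lebesgue {0..s} (\<lambda>\<tau>. F (A \<tau>) * a \<tau>) \<longleftrightarrow> integrable lborel (\<lambda>w. indicator {0..A s} w * F w)"
    unfolding set_integrable_def e by simp
  have "(\<integral>\<tau>. ?d \<tau> *\<^sub>R F (clamped \<tau>) \<partial>lebesgue) = (\<integral>\<tau>. F (clamped \<tau>) \<partial>density lebesgue (\<lambda>\<tau>. ennreal (?d \<tau>)))"
    by (rule integral_density[symmetric]) (use dn in measurable)
  also have "\<dots> = (\<integral>w. F w \<partial>distr (density lebesgue (\<lambda>\<tau>. ennreal (?d \<tau>))) borel clamped)"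
    by (rule integral_distr[symmetric]) auto
  also have "\<dots> = (\<integral>w. indicator {0..A s} w *\<^sub>R F w \<partial>lborel)"
    unfolding distr_primitive[OF s] by (rule integral_density) auto
  finally show "(LINT \<tau>:{0..s}|lebesgue. F (A \<tau>) * a \<tau>) = (\<integral>w. indicator {0..A s} w * F w \<partial>lborel)"
    unfolding set_lebesgue_integral_def e by simp
qed

text \<open>
The inverse of \<open>A\<close> is continuous on the compact interval \<open>A ` {0..T}\<close>, so in the new time variable the density is
continuous on a compact set. It is continued to the whole space by Tietze's theorem, which makes it measurable
everywhere.
\<close>

lemma time_changed_density:
  fixes \<phi> :: "real^'n \<Rightarrow> real \<Rightarrow> real"
  assumes \<phi>: "continuous_on (K \<times> {0..T}) (\<lambda>(\<xi>, \<tau>). \<phi> \<xi> \<tau>)" and K: "compact K"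
  obtains \<psi> B where "continuous_on UNIV (\<lambda>(\<xi>, t). \<psi> \<xi> t)" "\<forall>\<xi> t. \<bar>\<psi> \<xi> t\<bar> \<le> B"
    "\<forall>\<xi>\<in>K. \<forall>\<tau>\<in>{0..T}. \<psi> \<xi> (A \<tau>) = \<phi> \<xi> \<tau>"
proof -
  let ?S = "K \<times> A ` {0..T}"
  define inv where "inv = the_inv_into {0..T} A"
  have inv: "inv (A \<tau>) = \<tau>" if "\<tau> \<in> {0..T}" for \<tau>
    unfolding inv_def by (rule the_inv_into_f_f[OF A_inj that])
  have invc: "continuous_on (A ` {0..T}) inv"
    using inv by (intro continuous_on_inv A_continuous) auto
  have cS: "compact ?S" by (intro compact_Times K compact_continuous_image A_continuous) auto
  have c: "continuous_on ?S (\<lambda>(\<xi>, w). \<phi> \<xi> (inv w))"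
  proof -
    have c1: "continuous_on ?S (\<lambda>p. (fst p, inv (snd p)))"
      by (intro continuous_intros continuous_on_compose2[OF invc]) auto
    have c2: "(\<lambda>p. (fst p, inv (snd p))) ` ?S \<subseteq> K \<times> {0..T}" by (auto simp: inv)
    show ?thesis using continuous_on_compose2[OF \<phi> c1 c2] by (simp add: case_prod_beta')
  qed
  have "bounded ((\<lambda>(\<xi>, w). \<phi> \<xi> (inv w)) ` ?S)" by (intro compact_imp_bounded compact_continuous_image c cS)
  then obtain B where B: "\<forall>z\<in>(\<lambda>(\<xi>, w). \<phi> \<xi> (inv w)) ` ?S. norm z \<le> B" by (auto simp: bounded_iff)
  have b: "norm ((\<lambda>(\<xi>, w). \<phi> \<xi> (inv w)) q) \<le> max B 0" if "q \<in> ?S" for q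
    using B that by (meson imageI max.coboundedI1)
  have cl: "closedin (top_of_set UNIV) ?S" using cS by (simp add: compact_imp_closed)
  obtain \<Psi> where \<Psi>: "continuous_on UNIV \<Psi>" "\<And>q. q \<in> ?S \<Longrightarrow> \<Psi> q = (\<lambda>(\<xi>, w). \<phi> \<xi> (inv w)) q" "\<And>q. q \<in> UNIV \<Longrightarrow> norm (\<Psi> q) \<le> max B 0"
    using Tietze[OF c cl, of "max B 0"] b by auto
  show ?thesis
  proof (rule that[of "\<lambda>\<xi> t. \<Psi> (\<xi>, t)" "max B 0"])
    show "continuous_on UNIV (\<lambda>(\<xi>, t). \<Psi> (\<xi>, t))" using \<Psi>(1) by (simp add: case_prod_beta')
    show "\<forall>\<xi> t. \<bar>\<Psi> (\<xi>, t)\<bar> \<le> max B 0" using \<Psi>(3) by simp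
    show "\<forall>\<xi>\<in>K. \<forall>\<tau>\<in>{0..T}. \<Psi> (\<xi>, A \<tau>) = \<phi> \<xi> \<tau>" using \<Psi>(2) inv by auto
  qed
qed

end

locale double_layer_setting = hoelder_domain \<Omega> \<alpha> + time_change T a
  for \<Omega> :: "(real^'n) set" and \<alpha> T :: real and a :: "real \<Rightarrow> real" +
  fixes \<phi> \<psi> :: "real^'n \<Rightarrow> real \<Rightarrow> real"
  assumes \<psi>: "density_ok \<psi>" and \<psi>_eq: "\<And>\<xi> \<tau>. \<xi> \<in> frontier \<Omega> \<Longrightarrow> \<tau> \<in> {0..T} \<Longrightarrow> \<psi> \<xi> (A \<tau>) = \<phi> \<xi> \<tau>"
begin

text \<open>
The surface integral at the transformed source time \<open>w\<close>, and the same integral as a function of the elapsed time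
\<open>\<sigma> = t - w\<close>. At \<open>w = t\<close> the kernel is \<open>0\<close> by definition.
\<close>

definition slice :: "real^'n \<Rightarrow> real \<Rightarrow> real \<Rightarrow> real" where
  "slice x t w = (\<integral>\<xi>. normal_kernel (normal_field \<xi>) (x - \<xi>) (t - w) * \<psi> \<xi> w \<partial>boundary_measure \<Omega>)"

definition backward :: "real^'n \<Rightarrow> real \<Rightarrow> real \<Rightarrow> real" where
  "backward x t \<sigma> = (\<integral>\<xi>. normal_kernel (normal_field \<xi>) (x - \<xi>) \<sigma> * \<psi> \<xi> (t - \<sigma>) \<partial>boundary_measure \<Omega>)"

lemma slice_measurable [measurable]: "slice x t \<in> borel_measurable borel"
proof -
  have [measurable]: "(\<lambda>q. \<psi> (snd q) (fst q)) \<in> borel_measurable (borel \<Otimes>\<^sub>M boundary_measure \<Omega>)"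
    by (rule density_measurable[OF \<psi>]) measurable
  have "(\<lambda>w. \<integral>\<xi>. (case (w, \<xi>) of (w, \<xi>) \<Rightarrow> normal_kernel (normal_field \<xi>) (x - \<xi>) (t - w) * \<psi> \<xi> w) \<partial>boundary_measure \<Omega>) \<in> borel_measurable borel"
    by (rule borel_measurable_lebesgue_integral) (simp add: case_prod_beta')
  then show ?thesis by (simp add: slice_def[abs_def])
qed

lemma space_integral:
  assumes \<tau>: "\<tau> \<in> {0..T}" and le: "A \<tau> \<le> A t"
  shows "set_integrable (surface_measure \<Omega>) (frontier \<Omega>) (double_layer_integrand \<Omega> a \<phi> x t \<tau>)"
    "(LINT \<xi>:frontier \<Omega>|surface_measure \<Omega>. double_layer_integrand \<Omega> a \<phi> x t \<tau> \<xi>) = slice x (A t) (A \<tau>) * a \<tau>"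
proof -
  define u where "u \<xi> = normal_kernel (normal_field \<xi>) (x - \<xi>) (A t - A \<tau>) * \<psi> \<xi> (A \<tau>) * a \<tau>" for \<xi>
  have eq: "double_layer_integrand \<Omega> a \<phi> x t \<tau> \<xi> = u \<xi>" if "\<xi> \<in> frontier \<Omega>" for \<xi>
    using that \<psi>_eq[OF that \<tau>]
    by (simp add: double_layer_integrand_def normal_derivative_heat_kernel u_def normal_field_def)
  have fm: "frontier \<Omega> \<in> sets (surface_measure \<Omega>)" by (simp add: frontier_closed borel_closed)
  have [measurable]: "(\<lambda>\<xi>. \<psi> \<xi> (A \<tau>)) \<in> borel_measurable borel" by (rule density_measurable[OF \<psi>]) auto
  have um: "u \<in> borel_measurable borel" unfolding u_def by measurable
  have i: "integrable (boundary_measure \<Omega>) (\<lambda>\<xi>. normal_kernel (normal_field \<xi>) (x - \<xi>) (A t - A \<tau>) * \<psi> \<xi> (A \<tau>))"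
  proof (cases "A t - A \<tau> > 0")
    case True
    then show ?thesis by (rule integrable_kernel_slice[OF \<psi>])
  next
    case False
    then have "A t - A \<tau> = 0" using le by simp
    then show ?thesis by simp
  qed
  then have ui: "integrable (boundary_measure \<Omega>) u" unfolding u_def by (rule integrable_mult_left)
  have "set_integrable (surface_measure \<Omega>) (frontier \<Omega>) u"
    using ui by (simp add: set_lebesgue_boundary(1)[OF sets_surface um])
  then show "set_integrable (surface_measure \<Omega>) (frontier \<Omega>) (double_layer_integrand \<Omega> a \<phi> x t \<tau>)"
    by (rule set_integrable_cong[THEN iffD1, rotated -1]) (auto simp: eq)
  have "(LINT \<xi>:frontier \<Omega>|surface_measure \<Omega>. double_layer_integrand \<Omega> a \<phi> x t \<tau> \<xi>) = (LINT \<xi>:frontier \<Omega>|surface_measure \<Omega>. u \<xi>)"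
    by (rule set_lebesgue_integral_cong[OF fm]) (auto simp: eq)
  also have "\<dots> = (LINT \<xi>|boundary_measure \<Omega>. u \<xi>)" by (rule set_lebesgue_boundary(2)[OF sets_surface um])
  also have "\<dots> = slice x (A t) (A \<tau>) * a \<tau>" unfolding u_def slice_def by simp
  finally show "(LINT \<xi>:frontier \<Omega>|surface_measure \<Omega>. double_layer_integrand \<Omega> a \<phi> x t \<tau> \<xi>) = slice x (A t) (A \<tau>) * a \<tau>" .
qed

lemma backward_slice: "backward x t \<sigma> = slice x t (t - \<sigma>)"
  by (simp add: backward_def slice_def)

lemma backward_measurable [measurable]: "backward x t \<in> borel_measurable borel"
  unfolding backward_slice[abs_def] by measurable

lemma backward_integrable: "integrable lborel (\<lambda>\<sigma>. indicator {0<..<t} \<sigma> * backward x t \<sigma>)"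
  and potential_backward: "potential \<psi> x t = (\<integral>\<sigma>. indicator {0<..<t} \<sigma> * backward x t \<sigma> \<partial>lborel)"
  using potential_iterated[OF \<psi>] by (simp_all add: backward_def)

lemma double_layer_upto:
  assumes t: "t \<in> {0..T}" and s: "s \<in> {0..t}"
  shows "double_layer_upto_exists \<Omega> a \<phi> x t s"
    "double_layer_upto \<Omega> a \<phi> x t s = (\<integral>\<sigma>. indicator {A t - A s..A t} \<sigma> * (indicator {0<..<A t} \<sigma> * backward x (A t) \<sigma>) \<partial>lborel)"
proof -
  have sT: "s \<in> {0..T}" using s t by auto
  have le: "A \<tau> \<le> A t" if "\<tau> \<in> {0..s}" for \<tau> using that s t by (intro A_mono) auto
  have inner: "(LINT \<xi>:frontier \<Omega>|surface_measure \<Omega>. double_layer_integrand \<Omega> a \<phi> x t \<tau> \<xi>) = slice x (A t) (A \<tau>) * a \<tau>"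
    if "\<tau> \<in> {0..s}" for \<tau> using that sT by (intro space_integral(2) le) auto
  define F where "F \<sigma> = indicator {A t - A s..A t} \<sigma> * (indicator {0<..<A t} \<sigma> * backward x (A t) \<sigma>)" for \<sigma>
  have Fm[measurable]: "F \<in> borel_measurable borel" unfolding F_def by measurable
  have Fi: "integrable lborel F"
    unfolding F_def[abs_def]
    by (rule Bochner_Integration.integrable_bound[OF backward_integrable[of "A t" x]]) (auto simp: indicator_def)
  have As: "0 \<le> A s" "A s \<le> A t" using A_mono[of 0 s] A_mono[of s t] s t by auto
  \<comment> \<open>The substitution \<open>\<sigma> = A t - w\<close>; the intervals differ in their end points.\<close>
  have ae: "AE w in lborel. F (A t + (-1) * w) = indicator {0..A s} w * slice x (A t) w"
    using AE_lborel_singleton[of 0] AE_lborel_singleton[of "A t"]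
    by eventually_elim (use As in \<open>auto simp: F_def indicator_def backward_slice\<close>)
  have i0: "integrable lborel (\<lambda>w. F (A t + (-1) * w))"
    by (rule lborel_integrable_real_affine[OF Fi]) simp
  have i1: "integrable lborel (\<lambda>w. indicator {0..A s} w * slice x (A t) w)"
    using i0 by (subst (asm) integrable_cong_AE[OF _ _ ae]) auto
  have "(\<integral>\<sigma>. F \<sigma> \<partial>lborel) = \<bar>-1\<bar> *\<^sub>R (\<integral>w. F (A t + (-1) * w) \<partial>lborel)"
    by (rule lborel_integral_real_affine) simp
  also have "\<dots> = (\<integral>w. indicator {0..A s} w * slice x (A t) w \<partial>lborel)"
    using ae by (simp, intro integral_cong_AE) auto
  finally have eq: "(\<integral>\<sigma>. F \<sigma> \<partial>lborel) = (\<integral>w. indicator {0..A s} w * slice x (A t) w \<partial>lborel)" .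
  have i2: "set_integrable lebesgue {0..s} (\<lambda>\<tau>. slice x (A t) (A \<tau>) * a \<tau>)"
    using i1 primitive_substitution(1)[OF sT slice_measurable[of x "A t"]] by simp
  show "double_layer_upto_exists \<Omega> a \<phi> x t s"
    unfolding double_layer_upto_exists_def
  proof (intro conjI ballI)
    show "set_integrable (surface_measure \<Omega>) (frontier \<Omega>) (double_layer_integrand \<Omega> a \<phi> x t \<tau>)" if "\<tau> \<in> {0..s}" for \<tau>
      using that sT by (intro space_integral(1) le) auto
    show "set_integrable lebesgue {0..s} (\<lambda>\<tau>. LINT \<xi>:frontier \<Omega>|surface_measure \<Omega>. double_layer_integrand \<Omega> a \<phi> x t \<tau> \<xi>)"
      using i2 by (rule set_integrable_cong[THEN iffD1, rotated -1]) (auto simp: inner)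
  qed
  have "double_layer_upto \<Omega> a \<phi> x t s = (LINT \<tau>:{0..s}|lebesgue. slice x (A t) (A \<tau>) * a \<tau>)"
    unfolding double_layer_upto_def by (rule set_lebesgue_integral_cong) (auto simp: inner)
  also have "\<dots> = (\<integral>\<sigma>. F \<sigma> \<partial>lborel)"
    unfolding eq by (rule primitive_substitution(2)[OF sT slice_measurable])
  finally show "double_layer_upto \<Omega> a \<phi> x t s = (\<integral>\<sigma>. indicator {A t - A s..A t} \<sigma> * (indicator {0<..<A t} \<sigma> * backward x (A t) \<sigma>) \<partial>lborel)"
    by (simp add: F_def)
qed

lemma double_layer_eq_potential:
  assumes t: "t \<in> {0..T}" shows "double_layer \<Omega> a \<phi> x t = potential \<psi> x (A t)"
  unfolding double_layer_def potential_backward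
  using t by (subst double_layer_upto(2)[OF t]) (auto simp: indicator_def intro!: Bochner_Integration.integral_cong)

lemma double_layer_improper:
  assumes t: "t \<in> {0<..T}"
  shows "((\<lambda>h. double_layer_upto \<Omega> a \<phi> x t (t - h)) \<longlongrightarrow> potential \<psi> x (A t)) (at_right 0)"
proof -
  have lim: "((\<lambda>\<delta>. \<integral>\<sigma>. indicator {\<delta>..A t} \<sigma> * (indicator {0<..<A t} \<sigma> * backward x (A t) \<sigma>) \<partial>lborel) \<longlongrightarrow> potential \<psi> x (A t)) (at_right 0)"
    unfolding potential_backward by (rule truncated_integral_tendsto[OF backward_measurable backward_integrable])
  have ev: "eventually (\<lambda>h. h \<in> {0<..<t}) (at_right 0)"
    using t by (intro eventually_at_right_real) auto
  have "filterlim (\<lambda>h. A t - A (t - h)) (at_right 0) (at_right 0)"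
  proof (rule filterlim_at_withinI)
    show "eventually (\<lambda>h. A t - A (t - h) \<in> {0<..} - {0}) (at_right 0)"
      using ev by eventually_elim (use A_strict t in auto)
    have c: "continuous_on {0..t} (\<lambda>h. A t - A (t - h))"
      using t by (intro continuous_intros continuous_on_compose2[OF A_continuous]) auto
    have "((\<lambda>h. A t - A (t - h)) \<longlongrightarrow> A t - A (t - 0)) (at 0 within {0..t})"
      by (rule c[unfolded continuous_on_def, rule_format]) (use t in simp)
    then show "((\<lambda>h. A t - A (t - h)) \<longlongrightarrow> 0) (at_right 0)"
      using t by (simp add: at_within_Icc_at_right)
  qed
  from filterlim_compose[OF lim this]
  have "((\<lambda>h. \<integral>\<sigma>. indicator {A t - A (t - h)..A t} \<sigma> * (indicator {0<..<A t} \<sigma> * backward x (A t) \<sigma>) \<partial>lborel) \<longlongrightarrow> potential \<psi> x (A t)) (at_right 0)" .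
  then show ?thesis
  proof (rule Lim_transform_eventually)
    show "\<forall>\<^sub>F h in at_right 0. (\<integral>\<sigma>. indicator {A t - A (t - h)..A t} \<sigma> * (indicator {0<..<A t} \<sigma> * backward x (A t) \<sigma>) \<partial>lborel) = double_layer_upto \<Omega> a \<phi> x t (t - h)"
      using ev by eventually_elim (use t in \<open>auto simp: double_layer_upto(2)\<close>)
  qed
qed

lemma double_layer_boundary_eq:
  assumes t: "t \<in> {0<..T}" shows "double_layer_boundary \<Omega> a \<phi> x t = potential \<psi> x (A t)"
  unfolding double_layer_boundary_def
  by (rule tendsto_Lim[OF _ double_layer_improper[OF t]]) simp

lemma extended_continuous: "continuous_on (closure \<Omega> \<times> {0<..T}) (\<lambda>(x, t). extended_potential \<psi> x (A t))"
proof -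
  have ch: "\<exists>e g G U. boundary_graph \<Omega> e g G U \<and> p \<in> U" if "p \<in> frontier \<Omega>" for p
    by (rule obtain_chart[OF that]) auto
  have "continuous_on (closure \<Omega> \<times> {0<..}) (\<lambda>(x, t). extended_potential \<psi> x t)"
    unfolding continuous_on_def
  proof
    fix q assume "q \<in> closure \<Omega> \<times> {0::real<..}"
    then obtain x t where q: "q = (x, t)" "x \<in> closure \<Omega>" "t > 0" by auto
    then have "((\<lambda>(x, t). extended_potential \<psi> x t) \<longlongrightarrow> extended_potential \<psi> x t) (at (x, t) within closure \<Omega> \<times> UNIV)"
      by (intro extended_potential_tendsto ch \<psi>) auto
    then have "((\<lambda>(x, t). extended_potential \<psi> x t) \<longlongrightarrow> extended_potential \<psi> x t) (at (x, t) within closure \<Omega> \<times> {0<..})"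
      by (rule tendsto_within_subset) auto
    then show "((\<lambda>(x, t). extended_potential \<psi> x t) \<longlongrightarrow> (case q of (x, t) \<Rightarrow> extended_potential \<psi> x t)) (at q within closure \<Omega> \<times> {0<..})"
      by (simp add: q(1))
  qed
  moreover have "continuous_on (closure \<Omega> \<times> {0<..T}) (\<lambda>q. (fst q, A (snd q)))"
    by (intro continuous_intros continuous_on_compose2[OF A_continuous]) auto
  moreover have "(\<lambda>q. (fst q, A (snd q))) ` (closure \<Omega> \<times> {0<..T}) \<subseteq> closure \<Omega> \<times> {0<..}"
    using A_pos by auto
  ultimately have "continuous_on (closure \<Omega> \<times> {0<..T}) (\<lambda>q. (case (fst q, A (snd q)) of (x, t) \<Rightarrow> extended_potential \<psi> x t))"
    by (rule continuous_on_compose2)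
  then show ?thesis by (simp add: case_prod_beta')
qed

end

theorem theorem3p3:
  fixes \<Omega> :: "(real^'n) set" and T \<alpha> :: real
    and a :: "real \<Rightarrow> real" and \<phi> :: "real^'n \<Rightarrow> real \<Rightarrow> real"
  assumes dim: "CARD('n) \<ge> 2"
    and T: "0 < T"
    and alpha: "0 < \<alpha>" "\<alpha> < 1"
    and domain: "open \<Omega>" "connected \<Omega>" "\<Omega> \<noteq> {}" "bounded \<Omega>"
    and boundary: "C1_Hoelder_boundary \<alpha> \<Omega>"
    and a_L1: "set_integrable lebesgue {0..T} a"
    and a_nonneg: "\<forall>t\<in>{0..T}. 0 \<le> a t"
    and a_zeros: "\<forall>t\<in>{t\<in>{0..T}. a t = 0}. t isolated_in {t\<in>{0..T}. a t = 0}"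
    and phi: "continuous_on (frontier \<Omega> \<times> {0..T}) (\<lambda>(\<xi>, \<tau>). \<phi> \<xi> \<tau>)"
  shows "(\<forall>x\<in>\<Omega>. \<forall>t\<in>{0<..T}. double_layer_upto_exists \<Omega> a \<phi> x t t) \<and>
    (\<forall>x\<^sub>0\<in>frontier \<Omega>. \<forall>t\<in>{0<..T}.
       (\<forall>h\<in>{0<..<t}. double_layer_upto_exists \<Omega> a \<phi> x\<^sub>0 t (t - h)) \<and>
       ((\<lambda>h. double_layer_upto \<Omega> a \<phi> x\<^sub>0 t (t - h)) \<longlongrightarrow> double_layer_boundary \<Omega> a \<phi> x\<^sub>0 t)
         (at_right 0) \<and>
       ((\<lambda>x. double_layer \<Omega> a \<phi> x t) \<longlongrightarrow>
          - (1 / 2) * \<phi> x\<^sub>0 t + double_layer_boundary \<Omega> a \<phi> x\<^sub>0 t) (at x\<^sub>0 within \<Omega>)) \<and>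
    continuous_on (closure \<Omega> \<times> {0<..T})
      (\<lambda>(x, t). if x \<in> \<Omega> then double_layer \<Omega> a \<phi> x t
                else - (1 / 2) * \<phi> x t + double_layer_boundary \<Omega> a \<phi> x t)"
proof -
  interpret H: hoelder_domain \<Omega> \<alpha> using alpha domain boundary by unfold_locales
  interpret C: time_change T a using T a_L1 a_nonneg a_zeros by unfold_locales
  obtain \<psi> B where \<psi>: "continuous_on UNIV (\<lambda>(\<xi>, t). \<psi> \<xi> t)" "\<forall>\<xi> t. \<bar>\<psi> \<xi> t\<bar> \<le> B"
    "\<forall>\<xi>\<in>frontier \<Omega>. \<forall>\<tau>\<in>{0..T}. \<psi> \<xi> (coeff_primitive a \<tau>) = \<phi> \<xi> \<tau>"
    by (rule C.time_changed_density[OF phi H.compact_frontier])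
  interpret D: double_layer_setting \<Omega> \<alpha> T a \<phi> \<psi>
  proof unfold_locales
    show "H.density_ok \<psi>" unfolding H.density_ok_def using \<psi>(1,2) by blast
    show "\<psi> \<xi> (coeff_primitive a \<tau>) = \<phi> \<xi> \<tau>" if "\<xi> \<in> frontier \<Omega>" "\<tau> \<in> {0..T}" for \<xi> \<tau>
      using \<psi>(3) that by blast
  qed
  let ?v = "\<lambda>x t. if x \<in> \<Omega> then double_layer \<Omega> a \<phi> x t else - (1 / 2) * \<phi> x t + double_layer_boundary \<Omega> a \<phi> x t"
  have v: "?v x t = H.extended_potential \<psi> x (coeff_primitive a t)" if "x \<in> closure \<Omega>" "t \<in> {0<..T}" for x t
  proof (cases "x \<in> \<Omega>")
    case True
    then show ?thesis using that D.double_layer_eq_potential[of t x] by (simp add: H.extended_potential_def)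
  next
    case False
    then have "x \<in> frontier \<Omega>" using that domain(1) by (simp add: frontier_def interior_open)
    then show ?thesis using False that D.double_layer_boundary_eq[of t x] D.\<psi>_eq[of x t]
      by (simp add: H.extended_potential_def)
  qed
  have cont: "continuous_on (closure \<Omega> \<times> {0<..T}) (\<lambda>(x, t). ?v x t)"
    by (rule continuous_on_cong[THEN iffD2, OF refl _ D.extended_continuous]) (auto simp: v)
  have lim: "((\<lambda>x. double_layer \<Omega> a \<phi> x t) \<longlongrightarrow> - (1 / 2) * \<phi> x0 t + double_layer_boundary \<Omega> a \<phi> x0 t) (at x0 within \<Omega>)"
    if x0: "x0 \<in> frontier \<Omega>" and t: "t \<in> {0<..T}" for x0 t
  proof -
    have x0': "x0 \<in> closure \<Omega>" "x0 \<notin> \<Omega>" using x0 domain(1) by (auto simp: frontier_def interior_open)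
    have "continuous_on (closure \<Omega>) (\<lambda>x. (\<lambda>(x, t). ?v x t) (x, t))"
      using t by (intro continuous_on_compose2[OF cont] continuous_intros) auto
    then have "((\<lambda>x. ?v x t) \<longlongrightarrow> ?v x0 t) (at x0 within closure \<Omega>)"
      using x0' unfolding continuous_on_def by auto
    then have "((\<lambda>x. ?v x t) \<longlongrightarrow> ?v x0 t) (at x0 within \<Omega>)"
      by (rule tendsto_within_subset) (rule closure_subset)
    then have "((\<lambda>x. ?v x t) \<longlongrightarrow> - (1 / 2) * \<phi> x0 t + double_layer_boundary \<Omega> a \<phi> x0 t) (at x0 within \<Omega>)"
      using x0' by simp
    moreover have "\<forall>\<^sub>F x in at x0 within \<Omega>. ?v x t = double_layer \<Omega> a \<phi> x t"
      by (auto simp: eventually_at_filter intro!: always_eventually)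
    ultimately show ?thesis by (rule Lim_transform_eventually)
  qed
  show ?thesis
  proof (intro conjI ballI)
    show "double_layer_upto_exists \<Omega> a \<phi> x t t" if "x \<in> \<Omega>" "t \<in> {0<..T}" for x t
      using that by (intro D.double_layer_upto(1)) auto
    show "double_layer_upto_exists \<Omega> a \<phi> x0 t (t - h)" if "t \<in> {0<..T}" "h \<in> {0<..<t}" for x0 t h
      using that by (intro D.double_layer_upto(1)) auto
    show "((\<lambda>h. double_layer_upto \<Omega> a \<phi> x0 t (t - h)) \<longlongrightarrow> double_layer_boundary \<Omega> a \<phi> x0 t) (at_right 0)"
      if "t \<in> {0<..T}" for x0 t
      using D.double_layer_improper[OF that] by (simp add: D.double_layer_boundary_eq[OF that])
  qed (use lim cont in auto)
qed

end
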